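(* Let $\beta:\mathbb{T}\times C_{\mathbb{T}}\to\mathbb{R}$ be a bounded Borel measurable function such that for all $t\in\mathbb{T}$ the function $\beta_t:\omega\in C_{\mathbb{T}}\mapsto\beta_t(\omega)\in\mathbb{R}$ is $\mathcal{F}_t$-measurable. Assume that: (i) the function $$N: h\in L^2_a(\mu_{\mathbb{T}},H_{\mathbb{T}})\mapsto \int_{[0,\cdot)_{\mathbb{T}}}\beta_s\circ\tau_h\,\lambda_\Delta(ds)\in L^2_a(\mu_{\mathbb{T}},H_{\mathbb{T}})$$ is continuous, where $\tau_h(\omega):=\omega+h(\omega)$; (ii) there exists $K\in[0,1)$ such that for every $h\in L^2_a(\mu_{\mathbb{T}},H_{\mathbb{T}})$ there exists $\epsilon\in(0,1]$ satisfying $$I(h)\leq K\epsilon^2\int_{C_{\mathbb{T}}}\left(\int_{\mathbb{T}}\left(h^\Delta_s(\omega)-\beta_s(\omega+h(\omega))\right)^2\lambda_\Delta(ds)\right)\mu_{\mathbb{T}}(d\omega),$$ where $$I(h):=\int_{C_{\mathbb{T}}}\left(\int_{\mathbb{T}}\left(\beta_s(\omega+h^\epsilon(\omega))-\beta_s(\omega+h(\omega))\right)^2\lambda_\Delta(ds)\right)\mu_{\mathbb{T}}(d\omega)$$ and $$h^\epsilon_s(\omega):=(1-\epsilon)h_s(\omega)+\epsilon\int_{[0,s)_{\mathbb{T}}}\beta_u(\omega+h(\omega))\lambda_\Delta(du),\quad\forall s\in\mathbb{T},\ \mu_{\mathbb{T}}\text{-a.s.}$$ Then, given an $(\mathcal{A}_t)_{t\in\mathbb{T}}$-sampled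 Brownian motion $(B_t)_{t\in\mathbb{T}}$ defined on a complete filtered probability space $(\Omega,\mathcal{A},(\mathcal{A}_t)_{t\in\mathbb{T}},\mathcal{P})$, there exists an $(\mathcal{A}_t)$-adapted stochastic process $(X_t)_{t\in\mathbb{T}}$ defined on $(\Omega,\mathcal{A},\mathcal{P})$ such that $$X_t=B_t+\int_{[0,t)_{\mathbb{T}}}\beta_s(X)\lambda_\Delta(ds),\quad\forall t\in\mathbb{T},\ \mathcal{P}\text{-a.s.}$$ Furthermore, $(X_t)_{t\in\mathbb{T}}$ is a strong solution of this equation for $(B_t)_{t\in\mathbb{T}}$, that is, there exists a Borel measurable function $F:C_{\mathbb{T}}\to C_{\mathbb{T}}$ such that $F^{-1}(\mathcal{F}_t)\subset\mathcal{F}_t^{\mu_{\mathbb{T}}}$ for all $t\in\mathbb{T}$ and $X_t=F_t(B)$ for all $t\in\mathbb{T}$, $\mathcal{P}$-a.s. In particular $\mathcal{G}_t^X=\mathcal{G}_t^B$ for all $t\in\mathbb{T}$, where $\mathcal{G}_t^X:=\sigma(X_s,s\in[0,t]_{\mathbb{T}})^{\mathcal{P}}$ and $\mathcal{G}_t^B:=\sigma(B_s,s\in[0,t]_{\mathbb{T}})^{\mathcal{P}}$. Moreover, the law $p_X:=X_\star\mathcal{P}$ of $X$ as a random $C_{\mathbb{T}}$-valued function is equivalent to the sampled Wiener measure $\mu_{\mathbb{T}}=B_\star\mathcal{P}$.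
   Context: $\mathbb{T}$ is a closed subset of $\mathbb{R}$ with $\{0,1\}\subset\mathbb{T}\subset[0,1]$; for an interval $I\subset[0,1]$, $I_{\mathbb{T}}:=I\cap\mathbb{T}$. Let $\bar\rho:[0,1]\to\mathbb{T}$ be $\bar\rho(t):=\sup\{u\in\mathbb{T}:u<t\}$ for $t\in(0,1]$ and $\bar\rho(0):=0$; $\lambda_\Delta:=\bar\rho_\star\lambda$ is the pushforward to $(\mathbb{T},\mathcal{B}(\mathbb{T}))$ of Lebesgue measure $\lambda$ on $[0,1]$. A point $t\in\mathbb{T}\setminus\{1\}$ is right-scattered if $\inf\{u\in\mathbb{T}:u>t\}>t$; $\mathbb{T}_{rs}$ is the set of right-scattered points. $C_{\mathbb{T}}$ is the Banach space of continuous $\omega:\mathbb{T}\to\mathbb{R}$ with $\omega(0)=0$, with the sup norm; $W_t(\omega):=\omega(t)$ is evaluation, and for a $C_{\mathbb{T}}$-valued map $F$, $F_t:=W_t\circ F$. $\mathcal{F}_t:=\sigma(W_s:s\in[0,t]_{\mathbb{T}})$. The sampled Wiener measure $\mu_{\mathbb{T}}$ is the law on $C_{\mathbb{T}}$ of $(b_t)_{t\in\mathbb{T}}$, where $(b_t)_{t\in[0,1]}$ is a standard Brownian motion started at $0$. On a complete probability space with measure $\mathbb{Q}$, $\mathcal{F}^{\mathbb{Q}}$ denotes the smallest $\sigma$-field containing $\mathcal{F}$ and all $\mathbb{Q}$-negligible sets of the whole space; Borel probabilities on $C_{\mathbb{T}}$ are extended to the completed Borel $\sigma$-field, and $\mathcal{F}_t^{\mu_{\mathbb{T}}}:=(\mathcal{F}_t)^{\mu_{\mathbb{T}}}$.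 $H_{\mathbb{T}}$ is the separable Hilbert space of $h\in C_{\mathbb{T}}$ of the form $h(t)=\int_{[0,t)_{\mathbb{T}}}h^\Delta(s)\lambda_\Delta(ds)$, $t\in\mathbb{T}$, with $h^\Delta\in L^2(\lambda_\Delta)$, with scalar product $\langle h,k\rangle_{H_{\mathbb{T}}}=\int_{\mathbb{T}}h^\Delta k^\Delta\,d\lambda_\Delta$. $L^2(\mu_{\mathbb{T}},H_{\mathbb{T}})$ is the Hilbert space of $\mu_{\mathbb{T}}$-equivalence classes of Borel measurable $u:C_{\mathbb{T}}\to C_{\mathbb{T}}$ with $\int\|u(\omega)\|_{H_{\mathbb{T}}}^2\mu_{\mathbb{T}}(d\omega)<\infty$. $L^2_a(\mu_{\mathbb{T}},H_{\mathbb{T}})$ is the subset of those $u=\int_{[0,\cdot)_{\mathbb{T}}}u^\Delta_s\lambda_\Delta(ds)$ such that $u_t:=W_t\circ u$ is $\mathcal{F}_t^{\mu_{\mathbb{T}}}$-measurable for all $t\in\mathbb{T}$ and $u^\Delta_t$ is $\mathcal{F}_t^{\mu_{\mathbb{T}}}$-measurable for all $t\in\mathbb{T}_{rs}$. For $h\in L^2_a(\mu_{\mathbb{T}},H_{\mathbb{T}})$ the pushforward of $\mu_{\mathbb{T}}$ by $\tau_h$ is absolutely continuous with respect to $\mu_{\mathbb{T}}$, so compositions with $\tau_h$ are well defined up to $\mu_{\mathbb{T}}$-null sets. A sampled Brownian motion $(B_t)_{t\in\mathbb{T}}$ is a process whose law, as a random element of $C_{\mathbb{T}}$, is $\mu_{\mathbb{T}}$.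 It is an $(\mathcal{A}_t)_{t\in\mathbb{T}}$-sampled Brownian motion on a complete filtered probability space $(\Omega,\mathcal{A},(\mathcal{A}_t)_{t\in\mathbb{T}},\mathcal{P})$ (each $\mathcal{A}_t$ complete) if it is $(\mathcal{A}_t)$-adapted and $E_{\mathcal{P}}[\exp(i\lambda(B_t-B_s))\mid\mathcal{A}_s]=\exp(-(t-s)\lambda^2/2)$ $\mathcal{P}$-a.s. for all $\lambda\in\mathbb{R}$ and $s<t$ in $\mathbb{T}$. *)

theory Defs
  imports "HOL-Probability.Probability"
begin

section \<open>Time scales\<close>

definition time_scale :: "real set \<Rightarrow> bool" where
  "time_scale T \<longleftrightarrow> closed T \<and> {0, 1} \<subseteq> T \<and> T \<subseteq> {0..1}"

definition rho :: "real set \<Rightarrow> real \<Rightarrow> real" where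
  "rho T t = (if t = 0 then 0 else Sup {u \<in> T. u < t})"

definition lambda_Delta :: "real set \<Rightarrow> real measure" where
  "lambda_Delta T = distr (restrict_space lborel {0..1}) (restrict_space borel T) (rho T)"

definition right_scattered :: "real set \<Rightarrow> real set" where
  "right_scattered T = {t \<in> T - {1}. Inf {u \<in> T. u > t} > t}"


section \<open>The path space\<close>

text \<open>Paths are functions on the reals that are \<open>undefined\<close> outside \<open>T\<close>; the library metric
  on continuous functions is the supremum metric.\<close>

definition path_metric :: "real set \<Rightarrow> (real \<Rightarrow> real) metric" where
  "path_metric T = submetric (cfunspace (top_of_set T) euclidean_metric) {\<omega>. \<omega> 0 = 0}"

definition path_space :: "real set \<Rightarrow> (real \<Rightarrow> real) set" where
  "path_space T = mspace (path_metric T)"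

definition path_borel :: "real set \<Rightarrow> (real \<Rightarrow> real) measure" where
  "path_borel T = sigma (path_space T) {U. openin (mtopology_of (path_metric T)) U}"

lemma space_path_borel [simp]: "space (path_borel T) = path_space T"
  using openin_subset[of "mtopology_of (path_metric T)"]
  by (auto simp: path_borel_def path_space_def space_measure_of_conv)

lemma path_space_iff:
  assumes "time_scale T"
  shows "\<omega> \<in> path_space T \<longleftrightarrow> \<omega> \<in> extensional T \<and> continuous_on T \<omega> \<and> \<omega> 0 = 0"
proof -
  have "compact T"
    using assms by (auto simp: time_scale_def compact_eq_bounded_closed intro: bounded_subset[OF bounded_closed_interval])
  then have "bounded (\<omega> ` T)" if "continuous_on T \<omega>"
    using that by (simp add: compact_continuous_image compact_imp_bounded)
  then show ?thesis
    by (auto simp: path_space_def path_metric_def)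
qed

definition sample_path :: "real set \<Rightarrow> (real \<Rightarrow> 'a \<Rightarrow> real) \<Rightarrow> 'a \<Rightarrow> real \<Rightarrow> real" where
  "sample_path T X x = (\<lambda>t\<in>T. X t x)"


section \<open>Sigma-fields\<close>

definition process_sigma :: "'a set \<Rightarrow> real set \<Rightarrow> (real \<Rightarrow> 'a \<Rightarrow> real) \<Rightarrow> 'a measure" where
  "process_sigma \<Omega> J X = sigma \<Omega> {X s -` S \<inter> \<Omega> | s S. s \<in> J \<and> S \<in> sets borel}"

definition canonical_filtration :: "real set \<Rightarrow> real \<Rightarrow> (real \<Rightarrow> real) measure" where
  "canonical_filtration T t = process_sigma (path_space T) ({0..t} \<inter> T) (\<lambda>s \<omega>. \<omega> s)"

text \<open>The smallest sigma-field containing \<open>G\<close> and all negligible sets of the whole space, where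
  negligible sets are the subsets of null sets.\<close>

definition augment :: "'a measure \<Rightarrow> 'a measure \<Rightarrow> 'a measure" where
  "augment Q G = sigma (space Q) (sets G \<union> null_sets (completion Q))"


section \<open>Brownian motion and the sampled Wiener measure\<close>

definition standard_brownian_motion :: "'a measure \<Rightarrow> (real \<Rightarrow> 'a \<Rightarrow> real) \<Rightarrow> bool" where
  "standard_brownian_motion M b \<longleftrightarrow>
     prob_space M \<and>
     (\<forall>t\<in>{0..1}. b t \<in> borel_measurable M) \<and>
     (\<forall>x\<in>space M. b 0 x = 0 \<and> continuous_on {0..1} (\<lambda>t. b t x)) \<and>
     (\<forall>s t. 0 \<le> s \<and> s < t \<and> t \<le> 1 \<longrightarrow>
        distributed M lborel (\<lambda>x. b t x - b s x) (\<lambda>y. ennreal (normal_density 0 (sqrt (t - s)) y))) \<and>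
     (\<forall>(n::nat) (r::nat \<Rightarrow> real).
        (\<forall>i\<le>n. r i \<in> {0..1}) \<and> (\<forall>i<n. r i < r (Suc i)) \<longrightarrow>
        prob_space.indep_vars M (\<lambda>_. borel) (\<lambda>i x. b (r (Suc i)) x - b (r i) x) {..<n})"

definition sampled_law :: "real set \<Rightarrow> 'a measure \<Rightarrow> (real \<Rightarrow> 'a \<Rightarrow> real) \<Rightarrow> (real \<Rightarrow> real) measure" where
  "sampled_law T M X = distr M (path_borel T) (sample_path T X)"

text \<open>Completeness of each \<open>A t\<close> means that it contains every null set of the ambient complete
  space, not only the negligible sets of its own restriction.\<close>

definition complete_filtered_prob_space :: "real set \<Rightarrow> 'a measure \<Rightarrow> (real \<Rightarrow> 'a measure) \<Rightarrow> bool" where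
  "complete_filtered_prob_space T P A \<longleftrightarrow>
     prob_space P \<and> complete_measure P \<and>
     (\<forall>t\<in>T. subalgebra P (A t) \<and> null_sets P \<subseteq> sets (A t)) \<and>
     (\<forall>s\<in>T. \<forall>t\<in>T. s \<le> t \<longrightarrow> sets (A s) \<subseteq> sets (A t))"

definition adapted :: "real set \<Rightarrow> (real \<Rightarrow> 'a measure) \<Rightarrow> (real \<Rightarrow> 'a \<Rightarrow> real) \<Rightarrow> bool" where
  "adapted T A X \<longleftrightarrow> (\<forall>t\<in>T. X t \<in> borel_measurable (A t))"

definition complex_cond_exp :: "'a measure \<Rightarrow> 'a measure \<Rightarrow> ('a \<Rightarrow> complex) \<Rightarrow> 'a \<Rightarrow> complex" where
  "complex_cond_exp M G f x =
     Complex (real_cond_exp M G (\<lambda>y. Re (f y)) x) (real_cond_exp M G (\<lambda>y. Im (f y)) x)"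

definition sampled_brownian_motion ::
    "real set \<Rightarrow> (real \<Rightarrow> real) measure \<Rightarrow> 'a measure \<Rightarrow> (real \<Rightarrow> 'a measure) \<Rightarrow> (real \<Rightarrow> 'a \<Rightarrow> real) \<Rightarrow> bool" where
  "sampled_brownian_motion T \<mu> P A B \<longleftrightarrow>
     sample_path T B \<in> measurable P (path_borel T) \<and>
     sampled_law T P B = \<mu> \<and>
     adapted T A B \<and>
     (\<forall>l. \<forall>s\<in>T. \<forall>t\<in>T. s < t \<longrightarrow>
        (AE x in P. complex_cond_exp P (A s) (\<lambda>y. exp (\<i> * complex_of_real (l * (B t y - B s y)))) x
            = complex_of_real (exp (- (t - s) * l\<^sup>2 / 2))))"


section \<open>The Cameron--Martin space and random shifts\<close>

definition has_delta_derivative :: "real set \<Rightarrow> (real \<Rightarrow> real) \<Rightarrow> (real \<Rightarrow> real) \<Rightarrow> bool" where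
  "has_delta_derivative T h g \<longleftrightarrow>
     g \<in> borel_measurable (lambda_Delta T) \<and> integrable (lambda_Delta T) (\<lambda>s. (g s)\<^sup>2) \<and>
     (\<forall>t\<in>T. h t = (LINT s:{0..<t} \<inter> T|lambda_Delta T. g s))"

definition cameron_martin :: "real set \<Rightarrow> (real \<Rightarrow> real) set" where
  "cameron_martin T = {h \<in> path_space T. \<exists>g. has_delta_derivative T h g}"

text \<open>A representative of the derivative, which is unique almost everywhere and hence unique at
  the right-scattered points, these being atoms. The value \<open>0\<close> is used where no derivative
  exists. Only the values of \<open>h\<close> on \<open>T\<close> matter.\<close>

definition delta_deriv :: "real set \<Rightarrow> (real \<Rightarrow> real) \<Rightarrow> real \<Rightarrow> real" where
  "delta_deriv T h =
     (if \<exists>g. has_delta_derivative T h g then SOME g. has_delta_derivative T h g else (\<lambda>_. 0))"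

definition H_inner :: "real set \<Rightarrow> (real \<Rightarrow> real) \<Rightarrow> (real \<Rightarrow> real) \<Rightarrow> real" where
  "H_inner T h k = (LINT s|lambda_Delta T. delta_deriv T h s * delta_deriv T k s)"

definition H_norm :: "real set \<Rightarrow> (real \<Rightarrow> real) \<Rightarrow> real" where
  "H_norm T h = sqrt (H_inner T h h)"

text \<open>Elements of \<open>L\<^sup>2(\<mu>, H)\<close> are handled through everywhere defined Borel representatives;
  \<open>L2H_dist\<close> is then a pseudometric, whose quotient is the Hilbert space distance. Finiteness
  of the squared norm almost everywhere is spelled out as almost sure membership in \<open>H\<close>.\<close>

definition L2H :: "real set \<Rightarrow> (real \<Rightarrow> real) measure \<Rightarrow> ((real \<Rightarrow> real) \<Rightarrow> real \<Rightarrow> real) set" where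
  "L2H T \<mu> = {u \<in> measurable (path_borel T) (path_borel T).
     (AE \<omega> in \<mu>. u \<omega> \<in> cameron_martin T) \<and>
     (\<integral>\<^sup>+ \<omega>. ennreal ((H_norm T (u \<omega>))\<^sup>2) \<partial>\<mu>) < \<infinity>}"

definition L2H_dist :: "real set \<Rightarrow> (real \<Rightarrow> real) measure \<Rightarrow>
    ((real \<Rightarrow> real) \<Rightarrow> real \<Rightarrow> real) \<Rightarrow> ((real \<Rightarrow> real) \<Rightarrow> real \<Rightarrow> real) \<Rightarrow> real" where
  "L2H_dist T \<mu> u v =
     sqrt (enn2real (\<integral>\<^sup>+ \<omega>. ennreal ((H_norm T (\<lambda>t\<in>T. u \<omega> t - v \<omega> t))\<^sup>2) \<partial>\<mu>))"

definition L2H_adapted ::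
    "real set \<Rightarrow> (real \<Rightarrow> real) measure \<Rightarrow> ((real \<Rightarrow> real) \<Rightarrow> real \<Rightarrow> real) set" where
  "L2H_adapted T \<mu> = {u \<in> L2H T \<mu>.
     (\<forall>t\<in>T. (\<lambda>\<omega>. u \<omega> t) \<in> borel_measurable (augment \<mu> (canonical_filtration T t))) \<and>
     (\<forall>t\<in>right_scattered T.
        (\<lambda>\<omega>. delta_deriv T (u \<omega>) t) \<in> borel_measurable (augment \<mu> (canonical_filtration T t)))}"

definition random_shift :: "real set \<Rightarrow> ((real \<Rightarrow> real) \<Rightarrow> real \<Rightarrow> real) \<Rightarrow> (real \<Rightarrow> real) \<Rightarrow> real \<Rightarrow> real" where
  "random_shift T h \<omega> = (\<lambda>t\<in>T. \<omega> t + h \<omega> t)"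

definition drift_map :: "real set \<Rightarrow> (real \<Rightarrow> (real \<Rightarrow> real) \<Rightarrow> real) \<Rightarrow>
    ((real \<Rightarrow> real) \<Rightarrow> real \<Rightarrow> real) \<Rightarrow> (real \<Rightarrow> real) \<Rightarrow> real \<Rightarrow> real" where
  "drift_map T \<beta> h \<omega> = (\<lambda>t\<in>T. LINT s:{0..<t} \<inter> T|lambda_Delta T. \<beta> s (random_shift T h \<omega>))"

text \<open>Continuity with respect to the pseudometric is continuity on equivalence classes. For a
  bounded adapted \<open>\<beta>\<close>, \<open>drift_map T \<beta>\<close> maps \<open>L2H_adapted T \<mu>\<close> into itself, so this is not part of
  the condition.\<close>

definition L2H_adapted_continuous :: "real set \<Rightarrow> (real \<Rightarrow> real) measure \<Rightarrow>
    (((real \<Rightarrow> real) \<Rightarrow> real \<Rightarrow> real) \<Rightarrow> (real \<Rightarrow> real) \<Rightarrow> real \<Rightarrow> real) \<Rightarrow> bool" where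
  "L2H_adapted_continuous T \<mu> N \<longleftrightarrow>
     (\<forall>h\<in>L2H_adapted T \<mu>. \<forall>e>0. \<exists>d>0. \<forall>k\<in>L2H_adapted T \<mu>.
        L2H_dist T \<mu> k h < d \<longrightarrow> L2H_dist T \<mu> (N k) (N h) < e)"

definition relax :: "real set \<Rightarrow> (real \<Rightarrow> (real \<Rightarrow> real) \<Rightarrow> real) \<Rightarrow> real \<Rightarrow>
    ((real \<Rightarrow> real) \<Rightarrow> real \<Rightarrow> real) \<Rightarrow> (real \<Rightarrow> real) \<Rightarrow> real \<Rightarrow> real" where
  "relax T \<beta> \<epsilon> h \<omega> = (\<lambda>s\<in>T. (1 - \<epsilon>) * h \<omega> s
     + \<epsilon> * (LINT u:{0..<s} \<inter> T|lambda_Delta T. \<beta> u (random_shift T h \<omega>)))"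

end

theory Submission
  imports Defs
begin

text \<open>A solution driven by \<open>B\<close> is \<open>F(B)\<close> with \<open>F = id + h\<close>, where \<open>h\<close> is an adapted fixed point of the
  drift map, and only shifts \<open>h\<close> with density bounded by the bound \<open>C\<close> of \<open>\<beta>\<close> are needed. They form a
  complete space in mean square, because the truncated pointwise limit of a sequence with summable
  increments is again such a density, and hypothesis (ii) makes the residual \<open>\<parallel>h - N h\<parallel>\<close> drop at a
  rate proportional to the length of the relaxation step. The Ekeland--Caristi principle then yields
  the fixed point.

  The law of \<open>F\<close> under \<open>\<mu>\<close> is compared with \<open>\<mu>\<close> without stochastic integrals. On the space of the
  Brownian motion \<open>b\<close> the shift extends from \<open>T\<close> to an adapted Lipschitz process on \<open>[0,1]\<close>; on
  the grid \<open>i/n\<close>, delayed by one step, it is a discrete drift whose Girsanov density \<open>Z\<close> satisfies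
  \<open>E Z\<^sup>2 \<le> exp (C\<^sup>2)\<close> and \<open>E (1/Z) \<le> exp (C\<^sup>2)\<close>. By the inequality of the arithmetic and geometric
  means each of the two laws of a test function is bounded by \<open>l exp (C\<^sup>2)\<close> plus \<open>1/l\<close> times the other,
  for every \<open>l > 0\<close>. These bounds survive the limit \<open>n \<longlonglongrightarrow> \<infinity>\<close> and the passage to sets, and null
  sets are compared by letting \<open>l\<close> tend to \<open>0\<close>.\<close>

section \<open>Gaussian increments\<close>

text \<open>Hypotheses (i) and (ii) concern all adapted shifts but are applied only to primitives of
  densities bounded by \<open>C\<close>. This class is stable: \<open>\<beta>\<close> takes values
  in [-C,C], and a relaxation step is a convex combination. On it the drift map acts on densities,
  with the distance of L2 of the product of \<open>\<mu>\<close> and \<open>lambda_Delta T\<close>.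
  For the laws, the obstacle is that the shift depends on the path. On a grid the drift of each step
  is known before the increment, so Gaussian integrals can be evaluated one at a time. Grid points
  leave \<open>T\<close>; since \<open>lambda_Delta T\<close> is an image of Lebesgue measure, a
  primitive at \<open>t\<close> is a Lebesgue integral of \<open>g (rho T s)\<close> over [0,t],
  which makes sense and is C-Lipschitz on all of [0,1]. Adaptedness holds only up to null sets while
  increments are independent of the raw past, whence the passage to versions. The constant exp(C^2)
  bounds the exponential of the energy, the sum of a_i^2/n, uniformly in n. The equality of the
  filtrations rests on B being recovered from X as X minus the integral of \<open>\<beta>\<close>
  along X.\<close>

lemma space_process_sigma [simp]: "space (process_sigma \<Omega> J X) = \<Omega>"
  by (auto simp: process_sigma_def space_measure_of_conv)

lemma sets_process_sigma:
  "sets (process_sigma \<Omega> J X) = sigma_sets \<Omega> {X s -` S \<inter> \<Omega> | s S. s \<in> J \<and> S \<in> sets borel}"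
  by (auto simp: process_sigma_def intro!: sets_measure_of)

lemma measurable_process_sigma_component:
  "s \<in> J \<Longrightarrow> X s \<in> borel_measurable (process_sigma \<Omega> J X)"
  by (rule measurableI) (auto simp: sets_process_sigma)

lemma measurable_into_process_sigma:
  assumes "\<And>x. x \<in> space N \<Longrightarrow> f x \<in> \<Omega>"
    and "\<And>s. s \<in> J \<Longrightarrow> (\<lambda>x. X s (f x)) \<in> borel_measurable N"
  shows "f \<in> measurable N (process_sigma \<Omega> J X)"
  unfolding process_sigma_def
proof (rule measurable_measure_of)
  fix A assume "A \<in> {X s -` S \<inter> \<Omega> | s S. s \<in> J \<and> S \<in> sets borel}"
  then obtain s S where A: "s \<in> J" "S \<in> sets borel" "A = X s -` S \<inter> \<Omega>" by auto
  have "f -` A \<inter> space N = (\<lambda>x. X s (f x)) -` S \<inter> space N"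
    using A assms(1) by auto
  also have "\<dots> \<in> sets N"
    using assms(2)[OF A(1)] A(2) by (rule measurable_sets)
  finally show "f -` A \<inter> space N \<in> sets N" .
qed (use assms(1) in auto)

text \<open>By induction on its generation, every set of the sigma-field contains both
  \<open>x\<close> and \<open>y\<close> or neither; this is applied to the preimage of the singleton
  of \<open>f x\<close>. It is what allows a path to be replaced by its stopped version
  later.\<close>

lemma process_sigma_measurable_imp_coordinates:
  assumes "f \<in> measurable (process_sigma \<Omega> J X) N" and N: "\<And>z. z \<in> space N \<Longrightarrow> {z} \<in> sets N"
    and "x \<in> \<Omega>" "y \<in> \<Omega>" "\<And>s. s \<in> J \<Longrightarrow> X s x = X s y"
  shows "f x = f y"
proof -
  have *: "x \<in> A \<longleftrightarrow> y \<in> A" if "A \<in> sets (process_sigma \<Omega> J X)" for A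
    using that unfolding sets_process_sigma
    by induction (use assms(3-5) in auto)
  have fx: "f x \<in> space N"
    using assms(1,3) by (auto simp: measurable_def)
  have "f -` {f x} \<inter> space (process_sigma \<Omega> J X) \<in> sets (process_sigma \<Omega> J X)"
    by (rule measurable_sets[OF assms(1) N[OF fx]])
  from *[OF this] show ?thesis using assms(3,4) by auto
qed

text \<open>The parameter is the variance, that is, the length of the time interval of a Brownian
  increment.\<close>

definition gauss :: "real \<Rightarrow> real measure" where
  "gauss \<delta> = density lborel (\<lambda>y. ennreal (normal_density 0 (sqrt \<delta>) y))"

lemma sets_gauss [simp, measurable_cong]: "sets (gauss \<delta>) = sets borel"
  and space_gauss [simp]: "space (gauss \<delta>) = UNIV"
  by (auto simp: gauss_def)

lemma prob_space_gauss: "\<delta> > 0 \<Longrightarrow> prob_space (gauss \<delta>)"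
  unfolding gauss_def by (rule prob_space_normal_density) simp

text \<open>Completing the square: the weight times the normal density at \<open>y\<close> is the
  normal density at \<open>y + a * \<delta>\<close>, and Lebesgue measure is translation invariant.
  This is the Girsanov formula for a single increment with a constant drift.\<close>

lemma nn_integral_gauss_shift:
  assumes [measurable]: "f \<in> borel_measurable borel" and "\<delta> > 0"
  shows "(\<integral>\<^sup>+ y. ennreal (exp (- a * y - a\<^sup>2 * \<delta> / 2)) * f (y + a * \<delta>) \<partial>gauss \<delta>) = (\<integral>\<^sup>+ y. f y \<partial>gauss \<delta>)"
proof -
  have *: "normal_density 0 (sqrt \<delta>) y * exp (- a * y - a\<^sup>2 * \<delta> / 2) = normal_density 0 (sqrt \<delta>) (a * \<delta> + 1 * y)" for y
  proof -
    have "- y\<^sup>2 / (2 * \<delta>) + (- a * y - a\<^sup>2 * \<delta> / 2) = - (a * \<delta> + y)\<^sup>2 / (2 * \<delta>)"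
      using \<open>\<delta> > 0\<close> by (simp add: field_simps power2_eq_square)
    then have "exp (- y\<^sup>2 / (2 * \<delta>)) * exp (- a * y - a\<^sup>2 * \<delta> / 2) = exp (- (a * \<delta> + y)\<^sup>2 / (2 * \<delta>))"
      by (metis exp_add)
    then show ?thesis
      using \<open>\<delta> > 0\<close> by (simp add: normal_density_def)
  qed
  have "(\<integral>\<^sup>+ y. ennreal (exp (- a * y - a\<^sup>2 * \<delta> / 2)) * f (y + a * \<delta>) \<partial>gauss \<delta>)
      = (\<integral>\<^sup>+ y. ennreal (normal_density 0 (sqrt \<delta>) (a * \<delta> + 1 * y)) * f (a * \<delta> + 1 * y) \<partial>lborel)"
    unfolding gauss_def
  proof (subst nn_integral_density, goal_cases)
    case 3
    show ?case
    proof (rule nn_integral_cong)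
      fix y
      have "ennreal (normal_density 0 (sqrt \<delta>) y) * (ennreal (exp (- a * y - a\<^sup>2 * \<delta> / 2)) * f (y + a * \<delta>))
        = ennreal (normal_density 0 (sqrt \<delta>) y * exp (- a * y - a\<^sup>2 * \<delta> / 2)) * f (y + a * \<delta>)"
        by (simp only: ennreal_mult' normal_density_nonneg mult.assoc)
      then show "ennreal (normal_density 0 (sqrt \<delta>) y) * (ennreal (exp (- a * y - a\<^sup>2 * \<delta> / 2)) * f (y + a * \<delta>))
        = ennreal (normal_density 0 (sqrt \<delta>) (a * \<delta> + 1 * y)) * f (a * \<delta> + 1 * y)"
        unfolding * by (simp add: add.commute)
    qed
  qed auto
  also have "\<dots> = (\<integral>\<^sup>+ y. ennreal (normal_density 0 (sqrt \<delta>) y) * f y \<partial>lborel)"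
    by (subst nn_integral_real_affine[where c=1 and t="a * \<delta>"]) auto
  also have "\<dots> = (\<integral>\<^sup>+ y. f y \<partial>gauss \<delta>)"
    unfolding gauss_def by (subst nn_integral_density) auto
  finally show ?thesis .
qed

text \<open>Independence on rectangles says that the joint law of the point, seen through
  \<open>H\<close>, and of \<open>\<xi>\<close> is a product measure. Tonelli then integrates
  \<open>\<xi>\<close> out with the past frozen.\<close>

lemma nn_integral_indep:
  assumes "prob_space P" and sub: "subalgebra P H"
    and ind: "\<And>A S. A \<in> sets H \<Longrightarrow> S \<in> sets borel \<Longrightarrow>
      measure P (A \<inter> (\<xi> -` S \<inter> space P)) = measure P A * measure P (\<xi> -` S \<inter> space P)"
    and \<xi> [measurable]: "\<xi> \<in> borel_measurable P"
    and law: "distr P borel \<xi> = gauss \<delta>" and "\<delta> > 0"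
    and F [measurable]: "case_prod F \<in> borel_measurable (H \<Otimes>\<^sub>M borel)"
  shows "(\<integral>\<^sup>+ x. F x (\<xi> x) \<partial>P) = (\<integral>\<^sup>+ x. (\<integral>\<^sup>+ y. F x y \<partial>gauss \<delta>) \<partial>P)"
proof -
  interpret prob_space P by fact
  interpret g: prob_space "gauss \<delta>" using \<open>\<delta> > 0\<close> by (rule prob_space_gauss)
  have id [measurable]: "(\<lambda>x. x) \<in> measurable P H"
    using sub by (auto simp: subalgebra_def measurable_def intro: sets.sets_into_space)
  have spH: "space H = space P" using sub by (simp add: subalgebra_def)
  interpret h: prob_space "distr P H (\<lambda>x. x)" by (rule prob_space_distr) simp
  have eq: "distr P H (\<lambda>x. x) \<Otimes>\<^sub>M gauss \<delta> = distr P (H \<Otimes>\<^sub>M borel) (\<lambda>x. (x, \<xi> x))"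
  proof (rule pair_measure_eqI)
    fix A S assume A: "A \<in> sets (distr P H (\<lambda>x. x))" and S: "S \<in> sets (gauss \<delta>)"
    then have A': "A \<in> sets P" using sub by (auto simp: subalgebra_def)
    have "(\<lambda>x. (x, \<xi> x)) -` (A \<times> S) \<inter> space P = A \<inter> (\<xi> -` S \<inter> space P)" by auto
    moreover have "(\<lambda>x. x) -` A \<inter> space P = A" using sets.sets_into_space[OF A'] by auto
    ultimately show "emeasure (distr P H (\<lambda>x. x)) A * emeasure (gauss \<delta>) S
        = emeasure (distr P (H \<Otimes>\<^sub>M borel) (\<lambda>x. (x, \<xi> x))) (A \<times> S)"
      using A S ind[of A S] unfolding law[symmetric]
      by (simp add: emeasure_distr emeasure_eq_measure ennreal_mult[symmetric])
  next
    show "sets (distr P H (\<lambda>x. x) \<Otimes>\<^sub>M gauss \<delta>) = sets (distr P (H \<Otimes>\<^sub>M borel) (\<lambda>x. (x, \<xi> x)))"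
      unfolding sets_distr by (rule sets_pair_measure_cong) simp_all
  qed (fact h.sigma_finite_measure_axioms g.sigma_finite_measure_axioms)+
  have "(\<integral>\<^sup>+ x. F x (\<xi> x) \<partial>P) = (\<integral>\<^sup>+ z. case_prod F z \<partial>distr P (H \<Otimes>\<^sub>M borel) (\<lambda>x. (x, \<xi> x)))"
    by (subst nn_integral_distr) auto
  also have "\<dots> = (\<integral>\<^sup>+ z. case_prod F z \<partial>(distr P H (\<lambda>x. x) \<Otimes>\<^sub>M gauss \<delta>))"
    by (simp add: eq)
  also have "\<dots> = (\<integral>\<^sup>+ x. (\<integral>\<^sup>+ y. F x y \<partial>gauss \<delta>) \<partial>distr P H (\<lambda>x. x))"
    using g.nn_integral_fst[of "case_prod F" "distr P H (\<lambda>x. x)"]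
    by (simp add: measurable_cong_sets[OF sets_pair_measure_cong[OF sets_distr sets_gauss] refl] F)
  also have "\<dots> = (\<integral>\<^sup>+ x. (\<integral>\<^sup>+ y. F x y \<partial>gauss \<delta>) \<partial>P)"
    by (subst nn_integral_distr) auto
  finally show ?thesis .
qed

text \<open>Induction on the number of steps, removing the last increment first. Given
  \<open>H n\<close>, the drift \<open>a n\<close> is a constant, so the one-step formula absorbs
  both the last weight and the last shift; what remains is the same statement for \<open>n\<close>
  steps with the last coordinate integrated out of the test function. Neither the test function nor
  the weight need be bounded, all integrals being of nonnegative functions.\<close>

lemma discrete_girsanov:
  fixes \<xi> a :: "nat \<Rightarrow> 'a \<Rightarrow> real"
  assumes P: "prob_space P" and \<delta>: "\<delta> > 0"
    and sub: "\<And>i. i < n \<Longrightarrow> subalgebra P (H i)"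
    and ind: "\<And>i A S. i < n \<Longrightarrow> A \<in> sets (H i) \<Longrightarrow> S \<in> sets borel \<Longrightarrow>
      measure P (A \<inter> (\<xi> i -` S \<inter> space P)) = measure P A * measure P (\<xi> i -` S \<inter> space P)"
    and \<xi>P: "\<And>i. i < n \<Longrightarrow> \<xi> i \<in> borel_measurable P"
    and law: "\<And>i. i < n \<Longrightarrow> distr P borel (\<xi> i) = gauss \<delta>"
    and a: "\<And>i k. i \<le> k \<Longrightarrow> k < n \<Longrightarrow> a i \<in> borel_measurable (H k)"
    and \<xi>: "\<And>i k. i < k \<Longrightarrow> k < n \<Longrightarrow> \<xi> i \<in> borel_measurable (H k)"
    and f: "f \<in> borel_measurable (PiM {..<n} (\<lambda>_. borel))"
  shows "(\<integral>\<^sup>+ x. ennreal (\<Prod>i<n. exp (- a i x * \<xi> i x - (a i x)\<^sup>2 * \<delta> / 2))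
             * f (\<lambda>i\<in>{..<n}. \<xi> i x + a i x * \<delta>) \<partial>P)
       = (\<integral>\<^sup>+ y. f y \<partial>PiM {..<n} (\<lambda>_. gauss \<delta>))"
  using sub ind \<xi>P law a \<xi> f
proof (induction n arbitrary: f)
  case 0
  interpret prob_space P by fact
  have "(\<lambda>i\<in>{..<0}. \<xi> i x + a i x * \<delta>) = (\<lambda>_. undefined)" for x by auto
  then show ?case
    by (simp add: emeasure_space_1 PiM_empty nn_integral_count_space_finite)
next
  case (Suc n)
  interpret prob_space P by fact
  interpret g: prob_space "gauss \<delta>" using \<delta> by (rule prob_space_gauss)
  interpret product_sigma_finite "\<lambda>_::nat. gauss \<delta>"
    by (simp add: \<delta> product_sigma_finite_def prob_space_gauss prob_space_imp_sigma_finite)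
  note [measurable] = Suc.prems(7)
  have ins: "{..<Suc n} = insert n {..<n}" by auto
  define Z where "Z x = (\<Prod>i<n. exp (- a i x * \<xi> i x - (a i x)\<^sup>2 * \<delta> / 2))" for x
  define v where "v x = (\<lambda>i\<in>{..<n}. \<xi> i x + a i x * \<delta>)" for x
  have [measurable]: "\<And>i. i \<le> n \<Longrightarrow> a i \<in> borel_measurable (H n)"
      "\<And>i. i < n \<Longrightarrow> \<xi> i \<in> borel_measurable (H n)"
    using Suc.prems(5,6)[of _ n] by auto
  have v [measurable]: "v \<in> measurable (H n) (PiM {..<n} (\<lambda>_. borel))"
    unfolding v_def by measurable
  have Z [measurable]: "Z \<in> borel_measurable (H n)"
    unfolding Z_def by measurable
  have Z0: "0 \<le> Z x" for x
    unfolding Z_def by (intro prod_nonneg) auto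
  have fupd [measurable]: "(\<lambda>(w, y). f (w(n := y))) \<in> borel_measurable (PiM {..<n} (\<lambda>_. borel) \<Otimes>\<^sub>M borel)"
  proof -
    have *: "(\<lambda>(w, y). w(n := y)) \<in> measurable (PiM {..<n} (\<lambda>_. borel) \<Otimes>\<^sub>M borel) (PiM (insert n {..<n}) (\<lambda>_. borel))"
      by (rule measurable_add_dim)
    show ?thesis
      using measurable_compose[OF * Suc.prems(7)[unfolded ins]] by (simp add: case_prod_unfold fun_upd_def)
  qed
  \<comment> \<open>The last increment is separated as the free variable \<open>y\<close>;
    everything else depends on \<open>x\<close> through \<open>H n\<close> only.\<close>
  define F where "F x y = ennreal (Z x) * (ennreal (exp (- a n x * y - (a n x)\<^sup>2 * \<delta> / 2)) * f ((v x)(n := y + a n x * \<delta>)))" for x y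
  have Fm: "case_prod F \<in> borel_measurable (H n \<Otimes>\<^sub>M borel)"
  proof -
    have "(\<lambda>p. (v (fst p), snd p + a n (fst p) * \<delta>)) \<in> measurable (H n \<Otimes>\<^sub>M borel) (PiM {..<n} (\<lambda>_. borel) \<Otimes>\<^sub>M borel)"
      by measurable
    from measurable_compose[OF this fupd] have [measurable]:
      "(\<lambda>p. f ((v (fst p))(n := snd p + a n (fst p) * \<delta>))) \<in> borel_measurable (H n \<Otimes>\<^sub>M borel)"
      by simp
    show ?thesis
      unfolding F_def case_prod_unfold by measurable
  qed
  \<comment> \<open>The test function to which the induction hypothesis is applied.\<close>
  define fh where "fh w = (\<integral>\<^sup>+ y. f (w(n := y)) \<partial>gauss \<delta>)" for w
  have "(\<integral>\<^sup>+ x. ennreal (\<Prod>i<Suc n. exp (- a i x * \<xi> i x - (a i x)\<^sup>2 * \<delta> / 2))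
             * f (\<lambda>i\<in>{..<Suc n}. \<xi> i x + a i x * \<delta>) \<partial>P) = (\<integral>\<^sup>+ x. F x (\<xi> n x) \<partial>P)"
  proof (rule nn_integral_cong)
    fix x
    have "(\<lambda>i\<in>{..<Suc n}. \<xi> i x + a i x * \<delta>) = (v x)(n := \<xi> n x + a n x * \<delta>)"
      by (auto simp: v_def fun_eq_iff)
    then show "ennreal (\<Prod>i<Suc n. exp (- a i x * \<xi> i x - (a i x)\<^sup>2 * \<delta> / 2))
             * f (\<lambda>i\<in>{..<Suc n}. \<xi> i x + a i x * \<delta>) = F x (\<xi> n x)"
      by (simp add: F_def Z_def ennreal_mult prod_nonneg mult.assoc)
  qed
  also have "\<dots> = (\<integral>\<^sup>+ x. (\<integral>\<^sup>+ y. F x y \<partial>gauss \<delta>) \<partial>P)"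
    using Suc.prems by (intro nn_integral_indep[OF P _ _ _ _ \<delta> Fm]) auto
  also have "\<dots> = (\<integral>\<^sup>+ x. ennreal (Z x) * fh (v x) \<partial>P)"
  proof (rule nn_integral_cong)
    fix x assume "x \<in> space P"
    then have "x \<in> space (H n)" using Suc.prems(1)[of n] by (simp add: subalgebra_def)
    then have vx: "v x \<in> space (PiM {..<n} (\<lambda>_. borel))" using v by (auto simp: measurable_def)
    have fm [measurable]: "(\<lambda>y. f ((v x)(n := y))) \<in> borel_measurable borel"
      using measurable_Pair2[OF fupd vx] by simp
    show "(\<integral>\<^sup>+ y. F x y \<partial>gauss \<delta>) = ennreal (Z x) * fh (v x)"
      unfolding F_def fh_def
      by (subst nn_integral_cmult, measurable) (simp only: nn_integral_gauss_shift[OF fm \<delta>])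
  qed
  also have "\<dots> = (\<integral>\<^sup>+ w. fh w \<partial>PiM {..<n} (\<lambda>_. gauss \<delta>))"
    unfolding Z_def v_def
  proof (rule Suc.IH)
    show "fh \<in> borel_measurable (PiM {..<n} (\<lambda>_. borel))"
      unfolding fh_def using fupd
      by (intro g.borel_measurable_nn_integral) (auto simp: case_prod_unfold cong: measurable_cong_sets)
  qed (use Suc.prems in auto)
  also have "\<dots> = (\<integral>\<^sup>+ y. f y \<partial>PiM {..<Suc n} (\<lambda>_. gauss \<delta>))"
    unfolding fh_def ins
  proof (rule product_nn_integral_insert[symmetric])
    have "sets (PiM (insert n {..<n}) (\<lambda>_::nat. gauss \<delta>)) = sets (PiM {..<Suc n} (\<lambda>_. borel))"
      unfolding ins by (intro sets_PiM_cong) auto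
    with Suc.prems(7) show "f \<in> borel_measurable (PiM (insert n {..<n}) (\<lambda>_. gauss \<delta>))"
      by (metis measurable_cong_sets)
  qed auto
  finally show ?case .
qed

section \<open>Brownian increments\<close>

text \<open>The definition of Brownian motion gives independence of finitely many successive
  increments only. Events about finitely many values before \<open>s\<close> are events about such
  increments, because \<open>b 0 = 0\<close> makes values partial sums of increments. These events
  form an intersection-stable generator of the past, and independence extends to the generated
  sigma-fields.\<close>

lemma indep_brownian_increment:
  assumes bm: "standard_brownian_motion M b" and st: "0 \<le> s" "s < t" "t \<le> 1"
    and A: "A \<in> sets (process_sigma (space M) {0..s} b)" and S: "S \<in> sets borel"
  shows "measure M (A \<inter> ((\<lambda>x. b t x - b s x) -` S \<inter> space M))
    = measure M A * measure M ((\<lambda>x. b t x - b s x) -` S \<inter> space M)"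
proof -
  interpret prob_space M using bm by (simp add: standard_brownian_motion_def)
  have bm_meas [measurable]: "\<And>u. u \<in> {0..1} \<Longrightarrow> b u \<in> borel_measurable M"
    and b0: "\<And>x. x \<in> space M \<Longrightarrow> b 0 x = 0"
    and inc: "\<And>n (r :: nat \<Rightarrow> real). (\<forall>i\<le>n. r i \<in> {0..1}) \<Longrightarrow> (\<forall>i<n. r i < r (Suc i)) \<Longrightarrow>
        indep_vars (\<lambda>_. borel) (\<lambda>i x. b (r (Suc i)) x - b (r i) x) {..<n}"
    using bm by (auto simp: standard_brownian_motion_def)
  define \<xi> where "\<xi> x = b t x - b s x" for x
  have \<xi>[measurable]: "\<xi> \<in> borel_measurable M"
    unfolding \<xi>_def using bm_meas[of s] bm_meas[of t] st by simp
  define E where "E = {{x \<in> space M. \<forall>r\<in>R. b r x \<in> Q r} | R Q. finite R \<and> R \<subseteq> {0..s} \<and> (\<forall>r\<in>R. Q r \<in> sets borel)}"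
  define D where "D = {\<xi> -` S \<inter> space M | S. S \<in> sets borel}"
  have prod: "prob (X \<inter> Y) = prob X * prob Y" if X: "X \<in> E" and Y: "Y \<in> D" for X Y
  proof -
    obtain R Q where R: "finite R" "R \<subseteq> {0..s}" and Q: "\<And>r. r \<in> R \<Longrightarrow> Q r \<in> sets borel"
      and X_eq: "X = {x \<in> space M. \<forall>r\<in>R. b r x \<in> Q r}" using X by (auto simp: E_def)
    obtain S where S: "S \<in> sets borel" and Y_eq: "Y = \<xi> -` S \<inter> space M" using Y by (auto simp: D_def)
    \<comment> \<open>The points 0 and \<open>s\<close> are added so that the telescoping sums start
      at \<open>b 0 = 0\<close> and the last time before \<open>t\<close> is exactly
      \<open>s\<close>.\<close>
    define l where "l = sorted_list_of_set (insert 0 (insert s R))"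
    have setl: "set l = insert 0 (insert s R)" using R set_sorted_list_of_set[of "insert 0 (insert s R)"] by (simp only: l_def finite_insert)
    have sl: "sorted_wrt (<) l" unfolding l_def by simp
    then have lless: "\<And>i j. i < j \<Longrightarrow> j < length l \<Longrightarrow> l ! i < l ! j" by (rule sorted_wrt_nth_less)
    have lle: "l ! i \<le> l ! j" if "i \<le> j" "j < length l" for i j
      using lless[of i j] that by (cases "i = j") auto
    have lpos: "length l > 0" using setl by (auto simp: length_greater_0_conv)
    define m where "m = length l - 1"
    have lm: "length l = Suc m" using lpos by (simp add: m_def)
    have l_in: "l ! i \<in> {0..s}" if "i \<le> m" for i
    proof -
      have "l ! i \<in> set l" using that lm by (intro nth_mem) simp
      then show ?thesis using setl R st by auto
    qed
    have l0: "l ! 0 = 0"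
    proof -
      obtain j where "j < length l" "l ! j = 0" using setl by (metis in_set_conv_nth insertI1)
      then have "l ! 0 \<le> 0" using lle[of 0 j] by simp
      then show ?thesis using l_in[of 0] by simp
    qed
    have lms: "l ! m = s"
    proof -
      obtain j where "j < length l" "l ! j = s" using setl by (metis in_set_conv_nth insertI1 insertI2)
      then have "s \<le> l ! m" using lle[of j m] lm by simp
      then show ?thesis using l_in[of m] by simp
    qed
    \<comment> \<open>With \<open>t\<close> appended after \<open>s\<close>, the increment of index
      \<open>m\<close> is the one whose independence is claimed.\<close>
    define r where "r i = (if i \<le> m then l ! i else t)" for i
    have r_in: "\<forall>i\<le>Suc m. r i \<in> {0..1}"
      using l_in st by (auto simp: r_def dest: l_in)
    have r_less: "\<forall>i<Suc m. r i < r (Suc i)"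
    proof (intro allI impI)
      fix i assume "i < Suc m"
      then show "r i < r (Suc i)"
        using lless[of i "Suc i"] lm lms st by (cases "i = m") (auto simp: r_def)
    qed
    define V where "V i x = b (r (Suc i)) x - b (r i) x" for i x
    have iv: "indep_vars (\<lambda>_. borel) V {..<Suc m}"
      unfolding V_def using inc[OF r_in r_less] .
    have ivr: "indep_var (PiM {..<m} (\<lambda>_. borel)) (\<lambda>x. restrict (\<lambda>i. V i x) {..<m})
        (PiM {m} (\<lambda>_. borel)) (\<lambda>x. restrict (\<lambda>i. V i x) {m})"
      by (rule indep_var_restrict[OF iv]) auto
    have "\<forall>q\<in>R. \<exists>j\<le>m. l ! j = q"
      using setl lm by (metis in_set_conv_nth insertCI less_Suc_eq_le)
    then obtain idx where idx: "\<And>q. q \<in> R \<Longrightarrow> idx q \<le> m" "\<And>q. q \<in> R \<Longrightarrow> l ! idx q = q"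
      by metis
    have tele: "(\<Sum>i<j. V i x) = b (l ! j) x" if "x \<in> space M" "j \<le> m" for x j
    proof -
      have "(\<Sum>i<j. V i x) = b (r j) x - b (r 0) x"
        unfolding V_def by (rule sum_lessThan_telescope)
      then show ?thesis using that l0 b0 by (simp add: r_def)
    qed
    \<comment> \<open>\<open>D1\<close> and \<open>D2\<close> express the two events through
      disjoint blocks of increments: those of index below \<open>m\<close>, and the one of index
      \<open>m\<close>.\<close>
    define D1 where "D1 = {w \<in> space (PiM {..<m} (\<lambda>_. borel :: real measure)). \<forall>q\<in>R. (\<Sum>i<idx q. w i) \<in> Q q}"
    define D2 where "D2 = {w \<in> space (PiM {m} (\<lambda>_. borel :: real measure)). w m \<in> S}"
    have D1: "D1 \<in> sets (PiM {..<m} (\<lambda>_. borel))"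
    proof -
      have "{w \<in> space (PiM {..<m} (\<lambda>_. borel :: real measure)). (\<Sum>i<idx q. w i) \<in> Q q} \<in> sets (PiM {..<m} (\<lambda>_. borel))"
        if "q \<in> R" for q
      proof -
        have [measurable]: "Q q \<in> sets borel" using Q that by simp
        have "(\<lambda>w. (\<Sum>i<idx q. w i)) \<in> borel_measurable (PiM {..<m} (\<lambda>_. borel :: real measure))"
          using idx(1)[OF that] by (intro borel_measurable_sum measurable_component_singleton) auto
        then show ?thesis by measurable
      qed
      then show ?thesis
        unfolding D1_def using R(1) by (intro sets.sets_Collect_finite_All) auto
    qed
    have D2: "D2 \<in> sets (PiM {m} (\<lambda>_. borel))"
    proof -
      have "(\<lambda>w. w m) \<in> borel_measurable (PiM {m} (\<lambda>_. borel :: real measure))"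
        by (intro measurable_component_singleton) auto
      then show ?thesis
        unfolding D2_def using S by measurable
    qed
    have 1: "X = (\<lambda>x. restrict (\<lambda>i. V i x) {..<m}) -` D1 \<inter> space M"
    proof -
      have "(\<Sum>i<idx q. restrict (\<lambda>i. V i x) {..<m} i) = b q x" if "x \<in> space M" "q \<in> R" for x q
        using tele[OF that(1) idx(1)[OF that(2)]] idx[OF that(2)] by (simp add: restrict_def)
      then show ?thesis
        unfolding X_eq D1_def by (auto simp: space_PiM)
    qed
    have 2: "Y = (\<lambda>x. restrict (\<lambda>i. V i x) {m}) -` D2 \<inter> space M"
      unfolding Y_eq D2_def by (auto simp: space_PiM V_def \<xi>_def r_def lms)
    have "X \<inter> Y = (\<lambda>x. (restrict (\<lambda>i. V i x) {..<m}, restrict (\<lambda>i. V i x) {m})) -` (D1 \<times> D2) \<inter> space M"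
      unfolding 1 2 by blast
    then show ?thesis
      using indep_varD[OF ivr D1 D2] unfolding 1 2 by simp
  qed
  have E_ev: "E \<subseteq> events"
  proof
    fix X assume "X \<in> E"
    then obtain R Q where R: "finite R" "R \<subseteq> {0..s}" and Q: "\<And>r. r \<in> R \<Longrightarrow> Q r \<in> sets borel"
      and X_eq: "X = {x \<in> space M. \<forall>r\<in>R. b r x \<in> Q r}" by (auto simp: E_def)
    have "{x \<in> space M. b r x \<in> Q r} \<in> events" if "r \<in> R" for r
    proof -
      have "b r -` Q r \<inter> space M \<in> events"
        using that R st Q by (intro measurable_sets[OF bm_meas]) auto
      then show ?thesis by (simp add: vimage_def Int_def conj_ac)
    qed
    then show "X \<in> events"
      unfolding X_eq using R(1) by (intro sets.sets_Collect_finite_All) auto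
  qed
  have "indep_set E D"
    unfolding indep_sets2_eq using E_ev prod by (auto simp: D_def)
  moreover have "Int_stable E"
  proof (rule Int_stableI)
    fix X X' assume "X \<in> E" "X' \<in> E"
    from \<open>X \<in> E\<close> obtain R Q where R: "finite R" "R \<subseteq> {0..s}" and Q: "\<And>r. r \<in> R \<Longrightarrow> Q r \<in> sets borel"
      and X_eq: "X = {x \<in> space M. \<forall>r\<in>R. b r x \<in> Q r}" by (auto simp: E_def)
    from \<open>X' \<in> E\<close> obtain R' Q' where R': "finite R'" "R' \<subseteq> {0..s}" and Q': "\<And>r. r \<in> R' \<Longrightarrow> Q' r \<in> sets borel"
      and X'_eq: "X' = {x \<in> space M. \<forall>r\<in>R'. b r x \<in> Q' r}" by (auto simp: E_def)
    define Q'' where "Q'' r = (if r \<in> R then Q r else UNIV) \<inter> (if r \<in> R' then Q' r else UNIV)" for r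
    have "X \<inter> X' = {x \<in> space M. \<forall>r\<in>R \<union> R'. b r x \<in> Q'' r}"
      unfolding X_eq X'_eq Q''_def by auto
    moreover have "\<forall>r\<in>R \<union> R'. Q'' r \<in> sets borel"
      using Q Q' by (auto simp: Q''_def)
    ultimately show "X \<inter> X' \<in> E"
      unfolding E_def mem_Collect_eq using R R' by (intro exI[of _ "R \<union> R'"] exI[of _ Q'']) auto
  qed
  moreover have "Int_stable D"
  proof (rule Int_stableI)
    fix X X' assume "X \<in> D" "X' \<in> D"
    then obtain S S' where "S \<in> sets borel" "S' \<in> sets borel" "X = \<xi> -` S \<inter> space M" "X' = \<xi> -` S' \<inter> space M"
      by (auto simp: D_def)
    then show "X \<inter> X' \<in> D"
      unfolding D_def mem_Collect_eq by (intro exI[of _ "S \<inter> S'"]) auto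
  qed
  ultimately have ind: "indep_set (sigma_sets (space M) E) (sigma_sets (space M) D)"
    by (rule indep_set_sigma_sets)
  have "A \<in> sigma_sets (space M) E"
    using A unfolding sets_process_sigma
  proof (rule rev_subsetD, intro sigma_sets_mono subsetI)
    fix X assume "X \<in> {b u -` S \<inter> space M | u S. u \<in> {0..s} \<and> S \<in> sets borel}"
    then obtain u S where "X = b u -` S \<inter> space M" "u \<in> {0..s}" "S \<in> sets borel" by auto
    then have "X \<in> E"
      unfolding E_def mem_Collect_eq by (intro exI[of _ "{u}"] exI[of _ "\<lambda>_. S"]) auto
    then show "X \<in> sigma_sets (space M) E" by auto
  qed
  moreover have "\<xi> -` S \<inter> space M \<in> sigma_sets (space M) D"
    using S by (auto simp: D_def)
  ultimately show ?thesis
    using ind unfolding indep_sets2_eq \<xi>_def by blast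
qed

lemma process_sigma_mono:
  "J \<subseteq> K \<Longrightarrow> sets (process_sigma \<Omega> J X) \<subseteq> sets (process_sigma \<Omega> K X)"
  unfolding sets_process_sigma by (intro sigma_sets_mono') auto

lemma measurable_process_sigma_mono:
  "f \<in> measurable (process_sigma \<Omega> J X) N \<Longrightarrow> J \<subseteq> K \<Longrightarrow> f \<in> measurable (process_sigma \<Omega> K X) N"
  using process_sigma_mono[of J K \<Omega> X] by (auto simp: measurable_def)

section \<open>Continuous cylinder functions\<close>

text \<open>The three rules mirror the generation of the Borel sets: ramps approximate the
  indicators of half-lines, \<open>1 - f\<close> corresponds to complements and \<open>max\<close>
  to finite unions. All these functions are [0,1]-valued, depend on finitely many coordinates and
  are continuous in them, so they pass to limits of discretized paths.\<close>

inductive cyl_fun :: "real set \<Rightarrow> ((real \<Rightarrow> real) \<Rightarrow> real) \<Rightarrow> bool" for T where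
  coord: "t \<in> T \<Longrightarrow> cyl_fun T (\<lambda>w. max 0 (min 1 (k * (c - w t))))"
| compl: "cyl_fun T f \<Longrightarrow> cyl_fun T (\<lambda>w. 1 - f w)"
| sup: "cyl_fun T f \<Longrightarrow> cyl_fun T g \<Longrightarrow> cyl_fun T (\<lambda>w. max (f w) (g w))"

lemma cyl_fun_bounds: "cyl_fun T f \<Longrightarrow> 0 \<le> f w \<and> f w \<le> 1"
  by (induction rule: cyl_fun.induct) auto

lemma cyl_fun_measurable:
  "cyl_fun T f \<Longrightarrow> (\<And>t. t \<in> T \<Longrightarrow> (\<lambda>y. V t y) \<in> borel_measurable N) \<Longrightarrow>
    (\<lambda>y. f (\<lambda>t. V t y)) \<in> borel_measurable N"
  by (induction rule: cyl_fun.induct) auto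

lemma cyl_fun_tendsto:
  "cyl_fun T f \<Longrightarrow> (\<And>t. t \<in> T \<Longrightarrow> (\<lambda>n. V n t) \<longlonglongrightarrow> w t) \<Longrightarrow> (\<lambda>n. f (V n)) \<longlonglongrightarrow> f w"
  by (induction rule: cyl_fun.induct) (auto intro!: tendsto_intros)

lemma cyl_fun_cong:
  "cyl_fun T f \<Longrightarrow> (\<And>t. t \<in> T \<Longrightarrow> v t = w t) \<Longrightarrow> f v = f w"
  by (induction rule: cyl_fun.induct) auto

section \<open>Shifts of Brownian motion by adapted Lipschitz processes\<close>

lemma brownian_increment_gauss:
  assumes "standard_brownian_motion M b" "0 \<le> s" "s < t" "t \<le> 1"
  shows "distr M borel (\<lambda>x. b t x - b s x) = gauss (t - s)"
proof -
  have "distributed M lborel (\<lambda>x. b t x - b s x) (\<lambda>y. ennreal (normal_density 0 (sqrt (t - s)) y))"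
    using assms unfolding standard_brownian_motion_def by blast
  then have "distr M lborel (\<lambda>x. b t x - b s x) = gauss (t - s)"
    by (simp add: distributed_def gauss_def)
  moreover have "distr M borel (\<lambda>x. b t x - b s x) = distr M lborel (\<lambda>x. b t x - b s x)"
    by (intro distr_cong) auto
  ultimately show ?thesis by simp
qed

text \<open>The third bound is for the drift delayed by one grid step. For the cell of index 0 the
  truncated subtraction gives index 0 again, which is even closer.\<close>

lemma grid_floor:
  assumes "0 \<le> t" "t \<le> (1::real)" "n > 0"
  shows "nat \<lfloor>real n * t\<rfloor> \<le> n" "\<bar>real (nat \<lfloor>real n * t\<rfloor>) / n - t\<bar> \<le> 1 / n"
    "\<bar>real (nat \<lfloor>real n * t\<rfloor> - 1) / n - t\<bar> \<le> 2 / n"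
proof -
  have nt: "0 \<le> real n * t" "real n * t \<le> n" using assms by (auto simp: mult_left_le)
  then have *: "real (nat \<lfloor>real n * t\<rfloor>) \<le> real n * t" "real n * t < real (nat \<lfloor>real n * t\<rfloor>) + 1"
    by (auto simp: le_nat_floor)
  then show "nat \<lfloor>real n * t\<rfloor> \<le> n" using nt by linarith
  have "real n * \<bar>real (nat \<lfloor>real n * t\<rfloor>) / n - t\<bar> = \<bar>real (nat \<lfloor>real n * t\<rfloor>) - real n * t\<bar>"
    using assms(3) by (simp add: abs_mult[symmetric] field_simps)
  also have "\<dots> \<le> 1" using * by linarith
  finally show "\<bar>real (nat \<lfloor>real n * t\<rfloor>) / n - t\<bar> \<le> 1 / n"
    using assms(3) by (simp add: field_simps)
  have "real n * \<bar>real (nat \<lfloor>real n * t\<rfloor> - 1) / n - t\<bar> = \<bar>real (nat \<lfloor>real n * t\<rfloor> - 1) - real n * t\<bar>"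
    using assms(3) by (simp add: abs_mult[symmetric] field_simps)
  also have "\<dots> \<le> 2" using * nt by (cases "nat \<lfloor>real n * t\<rfloor>") auto
  finally show "\<bar>real (nat \<lfloor>real n * t\<rfloor> - 1) / n - t\<bar> \<le> 2 / n"
    using assms(3) by (simp add: field_simps)
qed

text \<open>Both moments of \<open>Z\<close> reduce to Girsanov weights of mean 1: the square of
  \<open>Z\<close> is the weight for the drift \<open>2 a\<close> times the exponential of the
  energy, and \<open>1 / Z\<close> is the weight for \<open>- a\<close> times the same exponential.
  Together with the identity E(Z Y) = E X, pointwise inequalities between \<open>Y\<close>,
  \<open>Z Y\<close> and a moment of \<open>Z\<close> give the two bounds.\<close>

lemma discrete_girsanov_bounds:
  fixes \<xi> a :: "nat \<Rightarrow> 'a \<Rightarrow> real"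
  assumes P: "prob_space P" and n: "n > 0" and \<delta>: "\<delta> = 1 / real n"
    and sub: "\<And>i. i < n \<Longrightarrow> subalgebra P (H i)"
    and ind: "\<And>i A S. i < n \<Longrightarrow> A \<in> sets (H i) \<Longrightarrow> S \<in> sets borel \<Longrightarrow>
      measure P (A \<inter> (\<xi> i -` S \<inter> space P)) = measure P A * measure P (\<xi> i -` S \<inter> space P)"
    and \<xi>P: "\<And>i. i < n \<Longrightarrow> \<xi> i \<in> borel_measurable P"
    and law: "\<And>i. i < n \<Longrightarrow> distr P borel (\<xi> i) = gauss \<delta>"
    and a: "\<And>i k. i \<le> k \<Longrightarrow> k < n \<Longrightarrow> a i \<in> borel_measurable (H k)"
    and aC: "\<And>i x. \<bar>a i x\<bar> \<le> C"
    and \<xi>: "\<And>i k. i < k \<Longrightarrow> k < n \<Longrightarrow> \<xi> i \<in> borel_measurable (H k)"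
    and f [measurable]: "f \<in> borel_measurable (PiM {..<n} (\<lambda>_. borel))"
    and f01: "\<And>y. 0 \<le> f y \<and> f y \<le> (1::real)" and l: "l > 0"
  shows "(\<integral> x. f (\<lambda>i\<in>{..<n}. \<xi> i x) \<partial>P) \<le> l * exp (C\<^sup>2) + (\<integral> x. f (\<lambda>i\<in>{..<n}. \<xi> i x + a i x * \<delta>) \<partial>P) / l" (is ?A)
    and "(\<integral> x. f (\<lambda>i\<in>{..<n}. \<xi> i x + a i x * \<delta>) \<partial>P) \<le> l * exp (C\<^sup>2) + (\<integral> x. f (\<lambda>i\<in>{..<n}. \<xi> i x) \<partial>P) / l" (is ?B)
proof -
  interpret prob_space P by fact
  have d0: "\<delta> > 0" using n \<delta> by simp
  interpret g: prob_space "gauss \<delta>" using d0 by (rule prob_space_gauss)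
  interpret gP: prob_space "PiM {..<n} (\<lambda>_::nat. gauss \<delta>)"
    by (rule prob_space_PiM) (rule g.prob_space_axioms)
  have aP [measurable]: "a i \<in> borel_measurable P" if "i < n" for i
    using a[of i i] sub[OF that] that measurable_from_subalg by blast
  note \<xi>P [measurable]
  \<comment> \<open>The drift is scaled by \<open>c\<close>: the values 1 and 0 compare the shifted
    and the unshifted increments, the values 2 and -1 yield the two moments.\<close>
  have girs: "(\<integral>\<^sup>+ x. ennreal (\<Prod>i<n. exp (- (c * a i x) * \<xi> i x - (c * a i x)\<^sup>2 * \<delta> / 2))
             * h (\<lambda>i\<in>{..<n}. \<xi> i x + (c * a i x) * \<delta>) \<partial>P)
       = (\<integral>\<^sup>+ y. h y \<partial>PiM {..<n} (\<lambda>_. gauss \<delta>))"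
    if "h \<in> borel_measurable (PiM {..<n} (\<lambda>_. borel))" for h c
    using a \<xi> by (intro discrete_girsanov[OF P d0 sub ind \<xi>P law _ _ that]) auto
  define Z where "Z x = (\<Prod>i<n. exp (- a i x * \<xi> i x - (a i x)\<^sup>2 * \<delta> / 2))" for x
  define Y where "Y x = f (\<lambda>i\<in>{..<n}. \<xi> i x + a i x * \<delta>)" for x
  define X where "X x = f (\<lambda>i\<in>{..<n}. \<xi> i x)" for x
  have Ym [measurable]: "Y \<in> borel_measurable P" and Xm [measurable]: "X \<in> borel_measurable P"
    and Zm [measurable]: "Z \<in> borel_measurable P"
    unfolding Y_def X_def Z_def by measurable
  have Zpos: "0 < Z x" for x unfolding Z_def by (intro prod_pos) auto
  have XY: "(\<integral>\<^sup>+ x. ennreal (Z x) * ennreal (Y x) \<partial>P) = (\<integral>\<^sup>+ x. ennreal (X x) \<partial>P)"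
    using girs[of "\<lambda>y. ennreal (f y)" 1] girs[of "\<lambda>y. ennreal (f y)" 0]
    by (simp add: Z_def Y_def X_def)
  have Lm [measurable]: "(\<lambda>x. \<Prod>i<n. exp (- (c * a i x) * \<xi> i x - (c * a i x)\<^sup>2 * \<delta> / 2)) \<in> borel_measurable P" for c
    by measurable
  have L1: "(\<integral>\<^sup>+ x. ennreal (\<Prod>i<n. exp (- (c * a i x) * \<xi> i x - (c * a i x)\<^sup>2 * \<delta> / 2)) \<partial>P) = 1" for c
    using girs[of "\<lambda>_. 1" c] by (simp add: gP.emeasure_space_1)
  \<comment> \<open>There are \<open>n\<close> terms of size at most C^2 \<open>\<delta>\<close>,
    and \<open>n * \<delta> = 1\<close>; hence the bound does not depend on
    \<open>n\<close>.\<close>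
  have ea: "(\<Prod>i<n. exp ((a i x)\<^sup>2 * \<delta>)) \<le> exp (C\<^sup>2)" for x
  proof -
    have "(\<Sum>i<n. (a i x)\<^sup>2 * \<delta>) \<le> (\<Sum>i<n. C\<^sup>2 * \<delta>)"
      using d0 order_trans[OF aC abs_ge_self]
      by (intro sum_mono mult_right_mono) (auto simp: abs_le_square_iff[symmetric])
    also have "\<dots> = C\<^sup>2" using n by (simp add: \<delta>)
    finally show ?thesis by (simp add: exp_sum[symmetric])
  qed
  have Z2: "(\<integral>\<^sup>+ x. ennreal ((Z x)\<^sup>2) \<partial>P) \<le> ennreal (exp (C\<^sup>2))"
  proof -
    have "(Z x)\<^sup>2 \<le> exp (C\<^sup>2) * (\<Prod>i<n. exp (- (2 * a i x) * \<xi> i x - (2 * a i x)\<^sup>2 * \<delta> / 2))" for x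
    proof -
      have "(Z x)\<^sup>2 = (\<Prod>i<n. exp ((a i x)\<^sup>2 * \<delta>)) * (\<Prod>i<n. exp (- (2 * a i x) * \<xi> i x - (2 * a i x)\<^sup>2 * \<delta> / 2))"
        unfolding Z_def prod_power_distrib prod.distrib[symmetric]
        by (intro prod.cong refl) (simp add: exp_add[symmetric] power2_eq_square[of "exp _"] field_simps power_mult_distrib)
      then show ?thesis using ea[of x] by (auto intro!: mult_right_mono prod_nonneg)
    qed
    then have "(\<integral>\<^sup>+ x. ennreal ((Z x)\<^sup>2) \<partial>P) \<le> (\<integral>\<^sup>+ x. ennreal (exp (C\<^sup>2)) * ennreal (\<Prod>i<n. exp (- (2 * a i x) * \<xi> i x - (2 * a i x)\<^sup>2 * \<delta> / 2)) \<partial>P)"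
      by (intro nn_integral_mono) (simp only: ennreal_mult'[symmetric] exp_ge_zero ennreal_leI)
    also have "\<dots> = ennreal (exp (C\<^sup>2))"
      by (subst nn_integral_cmult) (simp_all only: L1 Lm measurable_compose[OF Lm measurable_ennreal] mult_1_right)
    finally show ?thesis .
  qed
  have Zi: "(\<integral>\<^sup>+ x. ennreal (1 / Z x) \<partial>P) \<le> ennreal (exp (C\<^sup>2))"
  proof -
    have "1 / Z x \<le> exp (C\<^sup>2) * (\<Prod>i<n. exp (- (-1 * a i x) * \<xi> i x - (-1 * a i x)\<^sup>2 * \<delta> / 2))" for x
    proof -
      have "1 / Z x = (\<Prod>i<n. exp ((a i x)\<^sup>2 * \<delta>)) * (\<Prod>i<n. exp (- (-1 * a i x) * \<xi> i x - (-1 * a i x)\<^sup>2 * \<delta> / 2))"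
        unfolding Z_def prod.distrib[symmetric] inverse_eq_divide[symmetric] prod_inversef[symmetric] comp_def
        by (intro prod.cong refl) (simp add: exp_add[symmetric] exp_minus[symmetric] field_simps)
      then show ?thesis using ea[of x] by (auto intro!: mult_right_mono prod_nonneg)
    qed
    then have "(\<integral>\<^sup>+ x. ennreal (1 / Z x) \<partial>P) \<le> (\<integral>\<^sup>+ x. ennreal (exp (C\<^sup>2)) * ennreal (\<Prod>i<n. exp (- (-1 * a i x) * \<xi> i x - (-1 * a i x)\<^sup>2 * \<delta> / 2)) \<partial>P)"
      by (intro nn_integral_mono) (simp only: ennreal_mult'[symmetric] exp_ge_zero ennreal_leI)
    also have "\<dots> = ennreal (exp (C\<^sup>2))"
      by (subst nn_integral_cmult) (simp_all only: L1 Lm measurable_compose[OF Lm measurable_ennreal] mult_1_right)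
    finally show ?thesis .
  qed
  have bnd: "0 \<le> X x" "X x \<le> 1" "0 \<le> Y x" "Y x \<le> 1" for x using f01 by (auto simp: X_def Y_def)
  have int: "integrable P X" "integrable P Y"
    using bnd by (auto intro!: integrable_const_bound[of _ 1])
  have nnX: "(\<integral>\<^sup>+ x. ennreal (X x) \<partial>P) = ennreal (integral\<^sup>L P X)"
    and nnY: "(\<integral>\<^sup>+ x. ennreal (Y x) \<partial>P) = ennreal (integral\<^sup>L P Y)"
    using int bnd by (auto intro!: nn_integral_eq_integral)
  have nonneg: "0 \<le> integral\<^sup>L P X" "0 \<le> integral\<^sup>L P Y" using bnd by auto
  have "ennreal (integral\<^sup>L P X) \<le> (\<integral>\<^sup>+ x. ennreal l * ennreal ((Z x)\<^sup>2) + ennreal (1 / l) * ennreal (Y x) \<partial>P)"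
    unfolding nnX[symmetric] XY[symmetric]
  proof (rule nn_integral_mono)
    fix x
    \<comment> \<open>The square of \<open>l * Z x - Y x\<close> is nonnegative, and the square of
      \<open>Y x\<close> is at most \<open>Y x\<close> since its values lie in [0,1].\<close>
    have "Z x * Y x \<le> l * (Z x)\<^sup>2 + 1 / l * Y x"
    proof -
      have "0 \<le> (l * Z x - Y x)\<^sup>2" by simp
      then have "2 * l * (Z x * Y x) \<le> l * (l * (Z x)\<^sup>2) + (Y x)\<^sup>2"
        by (simp add: power2_eq_square algebra_simps)
      also have "(Y x)\<^sup>2 \<le> Y x" using bnd[of x] by (simp add: power2_eq_square mult_left_le)
      finally have "2 * (Z x * Y x) \<le> l * (Z x)\<^sup>2 + 1 / l * Y x"
        using l by (simp add: field_simps)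
      moreover have "0 \<le> Z x * Y x" using Zpos[of x] bnd[of x] by simp
      ultimately show ?thesis by linarith
    qed
    then show "ennreal (Z x) * ennreal (Y x) \<le> ennreal l * ennreal ((Z x)\<^sup>2) + ennreal (1 / l) * ennreal (Y x)"
      using Zpos[of x] bnd[of x] l by (simp add: ennreal_mult'[symmetric] ennreal_plus[symmetric] del: ennreal_plus)
  qed
  also have "\<dots> = ennreal l * (\<integral>\<^sup>+ x. ennreal ((Z x)\<^sup>2) \<partial>P) + ennreal (1 / l) * ennreal (integral\<^sup>L P Y)"
    by (simp add: nn_integral_add nn_integral_cmult nnY)
  also have "\<dots> \<le> ennreal l * ennreal (exp (C\<^sup>2)) + ennreal (1 / l) * ennreal (integral\<^sup>L P Y)"
    by (intro add_right_mono mult_left_mono Z2) auto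
  also have "\<dots> = ennreal (l * exp (C\<^sup>2) + integral\<^sup>L P Y / l)"
    using l nonneg by (simp add: ennreal_mult'[symmetric] ennreal_plus[symmetric] del: ennreal_plus)
  finally have "integral\<^sup>L P X \<le> l * exp (C\<^sup>2) + integral\<^sup>L P Y / l"
    using l nonneg by (subst (asm) ennreal_le_iff) auto
  then show ?A by (simp add: X_def[abs_def] Y_def[abs_def])
  have "ennreal (integral\<^sup>L P Y) \<le> (\<integral>\<^sup>+ x. ennreal l * ennreal (1 / Z x) + ennreal (1 / l) * (ennreal (Z x) * ennreal (Y x)) \<partial>P)"
    unfolding nnY[symmetric]
  proof (rule nn_integral_mono)
    fix x
    \<comment> \<open>If \<open>Z x\<close> is at least \<open>l\<close>, the second term alone
      dominates \<open>Y x\<close>; otherwise the first exceeds 1.\<close>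
    have "Y x \<le> l * (1 / Z x) + 1 / l * (Z x * Y x)"
    proof (cases "Z x \<ge> l")
      case True
      then have "l * Y x \<le> Z x * Y x" using bnd[of x] by (intro mult_right_mono) auto
      then have "Y x \<le> 1 / l * (Z x * Y x)" using l by (simp add: field_simps)
      moreover have "0 \<le> l * (1 / Z x)" using l Zpos[of x] by simp
      ultimately show ?thesis by linarith
    next
      case False
      then have "1 \<le> l * (1 / Z x)" using Zpos[of x] by (simp add: field_simps)
      moreover have "0 \<le> 1 / l * (Z x * Y x)" using l Zpos[of x] bnd[of x] by simp
      ultimately show ?thesis using bnd[of x] by linarith
    qed
    then show "ennreal (Y x) \<le> ennreal l * ennreal (1 / Z x) + ennreal (1 / l) * (ennreal (Z x) * ennreal (Y x))"
      using Zpos[of x] bnd[of x] l by (simp add: ennreal_mult'[symmetric] ennreal_plus[symmetric] less_imp_le del: ennreal_plus)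
  qed
  also have "\<dots> = ennreal l * (\<integral>\<^sup>+ x. ennreal (1 / Z x) \<partial>P) + ennreal (1 / l) * ennreal (integral\<^sup>L P X)"
    by (simp add: nn_integral_add nn_integral_cmult XY nnX)
  also have "\<dots> \<le> ennreal l * ennreal (exp (C\<^sup>2)) + ennreal (1 / l) * ennreal (integral\<^sup>L P X)"
    by (intro add_right_mono mult_left_mono Zi) auto
  also have "\<dots> = ennreal (l * exp (C\<^sup>2) + integral\<^sup>L P X / l)"
    using l nonneg by (simp add: ennreal_mult'[symmetric] ennreal_plus[symmetric] del: ennreal_plus)
  finally have "integral\<^sup>L P Y \<le> l * exp (C\<^sup>2) + integral\<^sup>L P X / l"
    using l nonneg by (subst (asm) ennreal_le_iff) auto
  then show ?B by (simp add: X_def[abs_def] Y_def[abs_def])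
qed

text \<open>The discrete bounds hold at every grid size with the same constant. The discretized
  paths converge at each time of \<open>T\<close>, the Brownian part by continuity and the delayed
  shift by the Lipschitz bound, so dominated convergence transfers the bounds to continuous cylinder
  functions.\<close>

lemma brownian_shift_bounds:
  assumes bm: "standard_brownian_motion M b" and C: "0 \<le> C" and T: "T \<subseteq> {0..1}"
    and U0: "\<And>x. x \<in> space M \<Longrightarrow> U 0 x = 0"
    and lip: "\<And>s t x. x \<in> space M \<Longrightarrow> s \<in> {0..1} \<Longrightarrow> t \<in> {0..1} \<Longrightarrow> \<bar>U s x - U t x\<bar> \<le> C * \<bar>s - t\<bar>"
    and Um: "\<And>t. t \<in> {0..1} \<Longrightarrow> U t \<in> borel_measurable M"
    and adapted: "\<And>t. t \<in> {0..1} \<Longrightarrow> \<exists>U'\<in>borel_measurable (process_sigma (space M) {0..t} b). AE x in M. U t x = U' x"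
    and f: "cyl_fun T f" and l: "l > 0"
  shows "(\<integral> x. f (\<lambda>t. b t x) \<partial>M) \<le> l * exp (C\<^sup>2) + (\<integral> x. f (\<lambda>t. b t x + U t x) \<partial>M) / l" (is ?A)
    and "(\<integral> x. f (\<lambda>t. b t x + U t x) \<partial>M) \<le> l * exp (C\<^sup>2) + (\<integral> x. f (\<lambda>t. b t x) \<partial>M) / l" (is ?B)
proof -
  interpret prob_space M using bm by (simp add: standard_brownian_motion_def)
  have bm_meas [measurable]: "\<And>u. u \<in> {0..1} \<Longrightarrow> b u \<in> borel_measurable M"
    and b0: "\<And>x. x \<in> space M \<Longrightarrow> b 0 x = 0"
    and bcont: "\<And>x. x \<in> space M \<Longrightarrow> continuous_on {0..1} (\<lambda>t. b t x)"
    using bm by (auto simp: standard_brownian_motion_def)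
  \<comment> \<open>Independence of the increments is available for the raw past only, so the slopes
    must be built from versions measurable for it.\<close>
  obtain U' where U'm: "\<And>t. t \<in> {0..1} \<Longrightarrow> U' t \<in> borel_measurable (process_sigma (space M) {0..t} b)"
    and U'eq: "\<And>t. t \<in> {0..1} \<Longrightarrow> AE x in M. U t x = U' t x"
    using adapted by metis
  define N where "N n = Suc n" for n :: nat
  define g where "g n i = real i / real (N n)" for n i
  define \<xi> where "\<xi> n i x = b (g n (Suc i)) x - b (g n i) x" for n i x
  txt \<open>The slope over the preceding grid interval is known at time \<open>g n i\<close>; truncation leaves it
    unchanged almost surely and makes the version \<open>U'\<close> bounded everywhere. At \<open>i = 0\<close> it is \<open>0\<close>
    because \<open>0 - 1 = 0\<close>.\<close>
  define a where "a n i x = max (- C) (min C (real (N n) * (U' (g n i) x - U' (g n (i - 1)) x)))" for n i x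
  define k where "k n t = nat \<lfloor>real (N n) * t\<rfloor>" for n and t :: real
  define H where "H n i = process_sigma (space M) {0..g n i} b" for n i
  have Npos: "real (N n) > 0" for n by (simp add: N_def)
  have g01: "g n i \<in> {0..1}" if "i \<le> N n" for n i
    using that by (auto simp: g_def N_def field_simps)
  have gmono: "g n i \<le> g n j" if "i \<le> j" for n i j
    using that by (auto simp: g_def N_def intro: divide_right_mono)
  have gSuc: "g n (Suc i) - g n i = 1 / real (N n)" for n i
    by (simp add: g_def diff_divide_distrib[symmetric])
  have gless: "g n i < g n (Suc i)" for n i
    by (simp add: g_def N_def divide_strict_right_mono)
  have k: "k n t \<le> N n" "\<bar>g n (k n t) - t\<bar> \<le> 1 / N n" "\<bar>g n (k n t - 1) - t\<bar> \<le> 2 / N n" if "t \<in> T" for n t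
    using grid_floor[of t "N n"] that T by (auto simp: k_def g_def N_def)
  have sub: "subalgebra M (H n i)" if "i \<le> N n" for n i
    unfolding subalgebra_def
  proof
    show "sets (H n i) \<subseteq> sets M"
      unfolding H_def sets_process_sigma
    proof (rule sets.sigma_sets_subset)
      show "{b s -` S \<inter> space M |s S. s \<in> {0..g n i} \<and> S \<in> sets borel} \<subseteq> events"
        using g01[OF that] by (auto intro!: measurable_sets[OF bm_meas])
    qed
  qed (simp add: H_def)
  have Hmono: "sets (H n i) \<subseteq> sets (H n j)" if "i \<le> j" for n i j
    unfolding H_def using gmono[OF that] by (intro process_sigma_mono) auto
  have Hm: "h \<in> borel_measurable (H n j)" if "h \<in> borel_measurable (process_sigma (space M) {0..g n i} b)" "i \<le> j"
    for h :: "'a \<Rightarrow> real" and n i j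
    unfolding H_def using gmono[OF that(2)] by (intro measurable_process_sigma_mono[OF that(1)]) auto
  have bH: "b (g n i) \<in> borel_measurable (H n j)" if "i \<le> j" for n i j
    by (rule Hm[OF measurable_process_sigma_component that]) (auto simp: g_def)
  have aH: "a n i \<in> borel_measurable (H n j)" if "i \<le> j" "j < N n" for n i j
  proof -
    have [measurable]: "U' (g n i) \<in> borel_measurable (H n j)" "U' (g n (i - 1)) \<in> borel_measurable (H n j)"
      using that by (auto intro!: Hm U'm g01)
    show ?thesis unfolding a_def by measurable
  qed
  have aC: "\<bar>a n i x\<bar> \<le> C" for n i x using C by (auto simp: a_def)
  \<comment> \<open>The coordinates of \<open>y\<close> are read as increments: the discretized path
    at time \<open>t\<close> is the sum of those before the grid index \<open>k n t\<close>.\<close>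
  define F where "F n y = f (\<lambda>t. \<Sum>i<k n t. y i)" for n and y :: "nat \<Rightarrow> real"
  have Fm: "F n \<in> borel_measurable (PiM {..<N n} (\<lambda>_. borel))" for n
    unfolding F_def
  proof (rule cyl_fun_measurable[OF f])
    fix t assume "t \<in> T"
    then show "(\<lambda>y. \<Sum>i<k n t. y i) \<in> borel_measurable (PiM {..<N n} (\<lambda>_. borel :: real measure))"
      using k(1)[of t n] by (intro borel_measurable_sum measurable_component_singleton) auto
  qed
  define XX where "XX n x = F n (\<lambda>i\<in>{..<N n}. \<xi> n i x)" for n x
  define YY where "YY n x = F n (\<lambda>i\<in>{..<N n}. \<xi> n i x + a n i x * (1 / N n))" for n x
  have \<xi>M [measurable]: "\<xi> n i \<in> borel_measurable M" if "i < N n" for n i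
    unfolding \<xi>_def using bm_meas[of "g n i"] bm_meas[of "g n (Suc i)"] g01[of i n] g01[of "Suc i" n] that by simp
  have aM [measurable]: "a n i \<in> borel_measurable M" if "i < N n" for n i
    using aH[of i i n] sub[of i n] that measurable_from_subalg less_imp_le by blast
  have bounds: "(\<integral> x. XX n x \<partial>M) \<le> l * exp (C\<^sup>2) + (\<integral> x. YY n x \<partial>M) / l"
      "(\<integral> x. YY n x \<partial>M) \<le> l * exp (C\<^sup>2) + (\<integral> x. XX n x \<partial>M) / l" for n
  proof -
    have pos: "N n > 0" by (simp add: N_def)
    have ind: "prob (A \<inter> (\<xi> n i -` S \<inter> space M)) = prob A * prob (\<xi> n i -` S \<inter> space M)"
      if "i < N n" "A \<in> sets (H n i)" "S \<in> sets borel" for i A S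
      unfolding \<xi>_def using that g01[of "Suc i" n] g01[of i n] gless[of n i]
      by (intro indep_brownian_increment[OF bm]) (auto simp: H_def)
    have law: "distr M borel (\<xi> n i) = gauss (1 / N n)" if "i < N n" for i
      unfolding \<xi>_def[abs_def] using that g01[of "Suc i" n] g01[of i n] gless[of n i]
      by (subst brownian_increment_gauss[OF bm]) (auto simp: gSuc)
    have \<xi>H: "\<xi> n i \<in> borel_measurable (H n j)" if "i < j" "j < N n" for i j
      unfolding \<xi>_def using that bH[of i j n] bH[of "Suc i" j n] by simp
    have sub': "\<And>i. i < N n \<Longrightarrow> subalgebra M (H n i)" using sub by simp
    have F01: "\<And>y. 0 \<le> F n y \<and> F n y \<le> 1" unfolding F_def using cyl_fun_bounds[OF f] by simp
    show "(\<integral> x. XX n x \<partial>M) \<le> l * exp (C\<^sup>2) + (\<integral> x. YY n x \<partial>M) / l"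
      unfolding XX_def YY_def
      by (rule discrete_girsanov_bounds(1)[where H="H n" and \<xi>="\<xi> n" and a="a n", OF prob_space_axioms pos refl sub' ind \<xi>M law aH aC \<xi>H Fm F01 l])
    show "(\<integral> x. YY n x \<partial>M) \<le> l * exp (C\<^sup>2) + (\<integral> x. XX n x \<partial>M) / l"
      unfolding XX_def YY_def
      by (rule discrete_girsanov_bounds(2)[where H="H n" and \<xi>="\<xi> n" and a="a n", OF prob_space_axioms pos refl sub' ind \<xi>M law aH aC \<xi>H Fm F01 l])
  qed
  have glim: "(\<lambda>n. g n (k n t)) \<longlonglongrightarrow> t" "(\<lambda>n. g n (k n t - 1)) \<longlonglongrightarrow> t" if "t \<in> T" for t
  proof -
    have 1: "(\<lambda>n. c / real (N n)) \<longlonglongrightarrow> 0" for c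
      using LIMSEQ_Suc[OF lim_const_over_n[of c]] by (simp add: N_def)
    have "(\<lambda>n. g n (k n t) - t) \<longlonglongrightarrow> 0"
      by (rule Lim_null_comparison[OF _ 1[of 1]]) (use k(2)[OF that] in auto)
    then show "(\<lambda>n. g n (k n t)) \<longlonglongrightarrow> t" by (simp add: LIM_zero_iff)
    have "(\<lambda>n. g n (k n t - 1) - t) \<longlonglongrightarrow> 0"
      by (rule Lim_null_comparison[OF _ 1[of 2]]) (use k(3)[OF that] in auto)
    then show "(\<lambda>n. g n (k n t - 1)) \<longlonglongrightarrow> t" by (simp add: LIM_zero_iff)
  qed
  have blim: "(\<lambda>n. b (g n (k n t)) x) \<longlonglongrightarrow> b t x" if "t \<in> T" "x \<in> space M" for t x
    using continuous_on_tendsto_compose[OF bcont[OF that(2)] glim(1)[OF that(1)]] that(1) T g01[OF k(1)[OF that(1)]] by auto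
  have Ulim: "(\<lambda>n. U (g n (k n t - 1)) x) \<longlonglongrightarrow> U t x" if "t \<in> T" "x \<in> space M" for t x
  proof -
    have "(\<lambda>n. C * \<bar>g n (k n t - 1) - t\<bar>) \<longlonglongrightarrow> C * \<bar>t - t\<bar>"
      by (intro tendsto_intros glim that)
    then have "(\<lambda>n. C * \<bar>g n (k n t - 1) - t\<bar>) \<longlonglongrightarrow> 0" by simp
    moreover have "\<bar>U (g n (k n t - 1)) x - U t x\<bar> \<le> C * \<bar>g n (k n t - 1) - t\<bar>" for n
    proof (rule lip[OF that(2)])
      show "g n (k n t - 1) \<in> {0..1}" using k(1)[OF that(1), of n] by (intro g01) linarith
      show "t \<in> {0..1}" using that(1) T by blast
    qed
    then have "\<forall>\<^sub>F n in sequentially. norm (U (g n (k n t - 1)) x - U t x) \<le> C * \<bar>g n (k n t - 1) - t\<bar>"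
      by (intro always_eventually allI) (simp only: real_norm_def)
    ultimately have "(\<lambda>n. U (g n (k n t - 1)) x - U t x) \<longlonglongrightarrow> 0"
      by (rule Lim_null_comparison[rotated])
    then show ?thesis by (simp add: LIM_zero_iff)
  qed
  have sum\<xi>: "(\<Sum>i<k n t. \<xi> n i x) = b (g n (k n t)) x" if "x \<in> space M" for n t x
    unfolding \<xi>_def using b0[OF that] by (subst sum_lessThan_telescope) (simp add: g_def)
  \<comment> \<open>There are only countably many grid points over all \<open>n\<close>, so one null
    set serves for all of them.\<close>
  have ae: "AE x in M. \<forall>n. \<forall>i\<in>{..N n}. U (g n i) x = U' (g n i) x"
  proof (intro AE_all_countable[THEN iffD2] allI AE_finite_allI finite_atMost)
    fix n i assume "i \<in> {..N n}"
    then show "AE x in M. U (g n i) x = U' (g n i) x" by (intro U'eq g01) simp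
  qed
  \<comment> \<open>Off this null set the Lipschitz bound makes the truncation in \<open>a\<close>
    inactive and the slopes telescope. Each slope is that of the preceding interval, so
    \<open>j\<close> steps accumulate the shift up to index \<open>j - 1\<close>; the steps 0 and 1
    agree with \<open>U 0 = 0\<close>.\<close>
  have suma: "(\<Sum>i<j. a n i x * (1 / N n)) = U (g n (j - 1)) x"
    if "x \<in> space M" "\<forall>n. \<forall>i\<in>{..N n}. U (g n i) x = U' (g n i) x" "j \<le> N n" for n j x
    using that(3)
  proof (induction j)
    case 0
    then show ?case using U0[OF that(1)] by (simp add: g_def)
  next
    case (Suc j)
    have "\<bar>U (g n j) x - U (g n (j - 1)) x\<bar> \<le> C * \<bar>g n j - g n (j - 1)\<bar>"
      using Suc.prems by (intro lip that g01) auto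
    also have "\<dots> \<le> C * (1 / N n)"
      using C gSuc[of n "j - 1"] by (intro mult_left_mono) (cases j; auto)+
    finally have "\<bar>real (N n) * (U (g n j) x - U (g n (j - 1)) x)\<bar> \<le> C"
      using Npos[of n] by (simp add: abs_mult pos_le_divide_eq mult.commute)
    then have "a n j x = real (N n) * (U (g n j) x - U (g n (j - 1)) x)"
      using Suc.prems that(2) by (auto simp: a_def)
    then show ?case using Suc by (simp add: N_def)
  qed
  have X_lim: "(\<lambda>n. XX n x) \<longlonglongrightarrow> f (\<lambda>t. b t x)" if "x \<in> space M" for x
  proof -
    have "(\<Sum>i<k n t. (\<lambda>i\<in>{..<N n}. \<xi> n i x) i) = b (g n (k n t)) x" if "t \<in> T" for n t
      using k(1)[OF that, of n] sum\<xi>[OF \<open>x \<in> space M\<close>, of n t, symmetric] by (auto intro!: sum.cong)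
    then show ?thesis
      unfolding XX_def F_def using blim that by (intro cyl_fun_tendsto[OF f]) auto
  qed
  have Y_lim: "(\<lambda>n. YY n x) \<longlonglongrightarrow> f (\<lambda>t. b t x + U t x)"
    if "x \<in> space M" "\<forall>n. \<forall>i\<in>{..N n}. U (g n i) x = U' (g n i) x" for x
  proof -
    have "(\<Sum>i<k n t. (\<lambda>i\<in>{..<N n}. \<xi> n i x + a n i x * (1 / N n)) i) = b (g n (k n t)) x + U (g n (k n t - 1)) x" if "t \<in> T" for n t
    proof -
      have "(\<Sum>i<k n t. (\<lambda>i\<in>{..<N n}. \<xi> n i x + a n i x * (1 / N n)) i) = (\<Sum>i<k n t. \<xi> n i x + a n i x * (1 / N n))"
        using k(1)[OF that, of n] by (intro sum.cong) auto
      also have "\<dots> = b (g n (k n t)) x + U (g n (k n t - 1)) x"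
        unfolding sum.distrib using sum\<xi>[OF \<open>x \<in> space M\<close>] suma[OF \<open>x \<in> space M\<close> _ k(1)[OF that]] \<open>\<forall>n. _\<close> by simp
      finally show ?thesis .
    qed
    then show ?thesis
      unfolding YY_def F_def using blim Ulim that by (intro cyl_fun_tendsto[OF f]) (auto intro!: tendsto_add)
  qed
  have XXm: "XX n \<in> borel_measurable M" for n
    unfolding XX_def by (rule measurable_compose[OF _ Fm]) measurable
  have YYm: "YY n \<in> borel_measurable M" for n
    unfolding YY_def by (rule measurable_compose[OF _ Fm]) measurable
  have bdd: "\<bar>XX n x\<bar> \<le> 1" "\<bar>YY n x\<bar> \<le> 1" for n x
    using cyl_fun_bounds[OF f] by (auto simp: XX_def YY_def F_def abs_le_iff intro: order_trans[of _ 0])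
  have bT: "b t \<in> borel_measurable M" "U t \<in> borel_measurable M" if "t \<in> T" for t
    using that T bm_meas Um by auto
  have XI: "(\<lambda>n. \<integral> x. XX n x \<partial>M) \<longlonglongrightarrow> (\<integral> x. f (\<lambda>t. b t x) \<partial>M)"
    by (rule integral_dominated_convergence[where w="\<lambda>_. 1"])
       (use XXm X_lim bdd in \<open>auto intro!: cyl_fun_measurable[OF f] bT\<close>)
  have YI: "(\<lambda>n. \<integral> x. YY n x \<partial>M) \<longlonglongrightarrow> (\<integral> x. f (\<lambda>t. b t x + U t x) \<partial>M)"
  proof (rule integral_dominated_convergence[where w="\<lambda>_. 1"])
    show "AE x in M. (\<lambda>n. YY n x) \<longlonglongrightarrow> f (\<lambda>t. b t x + U t x)"
      using ae AE_space by eventually_elim (rule Y_lim)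
  qed (use YYm bdd in \<open>auto intro!: cyl_fun_measurable[OF f] borel_measurable_add bT\<close>)
  have "(\<lambda>n. l * exp (C\<^sup>2) + (\<integral> x. YY n x \<partial>M) / l) \<longlonglongrightarrow> l * exp (C\<^sup>2) + (\<integral> x. f (\<lambda>t. b t x + U t x) \<partial>M) / l"
    using l by (intro tendsto_intros YI) simp
  from LIMSEQ_le[OF XI this] show ?A using bounds(1) by blast
  have "(\<lambda>n. l * exp (C\<^sup>2) + (\<integral> x. XX n x \<partial>M) / l) \<longlonglongrightarrow> l * exp (C\<^sup>2) + (\<integral> x. f (\<lambda>t. b t x) \<partial>M) / l"
    using l by (intro tendsto_intros XI) simp
  from LIMSEQ_le[OF YI this] show ?B using bounds(2) by blast
qed

section \<open>The path space\<close>

lemma time_scaleD: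
  assumes "time_scale T"
  shows "closed T" "compact T" "0 \<in> T" "1 \<in> T" "T \<subseteq> {0..1}" "T \<noteq> {}"
  using assms by (auto simp: time_scale_def compact_eq_bounded_closed intro: bounded_subset[OF bounded_closed_interval])

text \<open>Closed balls are used because a non-strict bound on the supremum metric is the same as
  the pointwise bound, as in \<open>cfunspace_mdist_le\<close>.\<close>

lemma openin_path_metric:
  assumes "time_scale T"
  shows "openin (mtopology_of (path_metric T)) U \<longleftrightarrow> U \<subseteq> path_space T \<and>
    (\<forall>\<omega>\<in>U. \<exists>r>0. \<forall>\<eta>\<in>path_space T. (\<forall>t\<in>T. \<bar>\<eta> t - \<omega> t\<bar> \<le> r) \<longrightarrow> \<eta> \<in> U)"
proof -
  have le: "mdist (path_metric T) \<omega> \<eta> \<le> r \<longleftrightarrow> (\<forall>t\<in>T. \<bar>\<eta> t - \<omega> t\<bar> \<le> r)"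
    if "\<omega> \<in> path_space T" "\<eta> \<in> path_space T" for \<omega> \<eta> r
  proof -
    have "\<omega> \<in> mspace (cfunspace (top_of_set T) euclidean_metric)" "\<eta> \<in> mspace (cfunspace (top_of_set T) euclidean_metric)"
      using that by (auto simp: path_space_def path_metric_def)
    from cfunspace_mdist_le[OF this] show ?thesis
      using time_scaleD(6)[OF assms] by (simp add: path_metric_def dist_real_def abs_minus_commute)
  qed
  have *: "openin (mtopology_of (path_metric T)) U \<longleftrightarrow> U \<subseteq> mspace (path_metric T) \<and>
      (\<forall>\<omega>. \<omega> \<in> U \<longrightarrow> (\<exists>r>0. mcball_of (path_metric T) \<omega> r \<subseteq> U))"
    unfolding mtopology_of_def mcball_of_def
    by (rule Metric_space.openin_mtopology_mcball) (rule Metric_space_mspace_mdist)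
  have mc: "mcball_of (path_metric T) \<omega> r = {\<eta> \<in> path_space T. \<forall>t\<in>T. \<bar>\<eta> t - \<omega> t\<bar> \<le> r}"
    if "\<omega> \<in> path_space T" for \<omega> r
    using le[OF that] that by (auto simp: path_space_def)
  have "(\<exists>r>0. mcball_of (path_metric T) \<omega> r \<subseteq> U) \<longleftrightarrow>
      (\<exists>r>0. \<forall>\<eta>\<in>path_space T. (\<forall>t\<in>T. \<bar>\<eta> t - \<omega> t\<bar> \<le> r) \<longrightarrow> \<eta> \<in> U)" if "\<omega> \<in> path_space T" for \<omega>
    unfolding mc[OF that] by blast
  then show ?thesis
    unfolding * path_space_def[symmetric] by blast
qed

definition step_path :: "nat \<Rightarrow> rat list \<Rightarrow> real \<Rightarrow> real" where
  "step_path n qs t = of_rat (qs ! nat \<lfloor>real n * t\<rfloor>)"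

text \<open>Countably many step functions serve as centres of balls; they are not continuous, so the balls
  are taken over a countable dense set of times.\<close>

lemma step_path_dense:
  assumes T: "time_scale T" and \<omega>: "\<omega> \<in> path_space T" and e: "e > 0"
  shows "\<exists>n qs. \<forall>t\<in>T. \<bar>\<omega> t - step_path n qs t\<bar> < e"
proof -
  have "uniformly_continuous_on T \<omega>"
    using \<omega> T by (auto simp: path_space_iff intro!: compact_uniformly_continuous time_scaleD)
  then obtain d where d: "d > 0" "\<And>s t. s \<in> T \<Longrightarrow> t \<in> T \<Longrightarrow> dist s t < d \<Longrightarrow> dist (\<omega> s) (\<omega> t) < e / 2"
    using e unfolding uniformly_continuous_on_def by (metis half_gt_zero)
  obtain m where m: "inverse (real (Suc m)) < d" using d(1) reals_Archimedean by blast
  define n where "n = Suc m"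
  define cell where "cell t = nat \<lfloor>real n * t\<rfloor>" for t :: real
  \<comment> \<open>A representative time of each cell. For a cell that misses \<open>T\<close> the
    choice is arbitrary, but only cells of the form \<open>cell t\<close> with \<open>t\<close> in
    \<open>T\<close> are used.\<close>
  define p where "p i = (SOME t. t \<in> T \<and> cell t = i)" for i
  have p: "p (cell t) \<in> T \<and> cell (p (cell t)) = cell t" if "t \<in> T" for t
    unfolding p_def by (rule someI) (use that in auto)
  have "\<exists>q. \<bar>\<omega> (p i) - of_rat q\<bar> < e / 2" for i
  proof -
    obtain q where "\<omega> (p i) - e / 2 < of_rat q" "of_rat q < \<omega> (p i)"
      using of_rat_dense[of "\<omega> (p i) - e / 2" "\<omega> (p i)"] e by auto
    then show ?thesis by (intro exI[of _ q]) auto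
  qed
  then obtain q where q: "\<And>i. \<bar>\<omega> (p i) - of_rat (q i)\<bar> < e / 2" by metis
  have "\<bar>\<omega> t - step_path n (map q [0..<Suc n]) t\<bar> < e" if t: "t \<in> T" for t
  proof -
    have t01: "0 \<le> t" "t \<le> 1" using t time_scaleD(5)[OF T] by auto
    have "0 < n" by (simp add: n_def)
    then have "cell t \<le> n" unfolding cell_def by (rule grid_floor(1)[OF t01])
    then have 1: "step_path n (map q [0..<Suc n]) t = of_rat (q (cell t))"
      unfolding step_path_def cell_def[symmetric] by (simp add: nth_append less_Suc_eq_le del: upt_Suc)
    have p01: "0 \<le> p (cell t)" "p (cell t) \<le> 1" using p[OF t] time_scaleD(5)[OF T] by auto
    have "\<bar>real n * t - real n * p (cell t)\<bar> < 1"
    proof -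
      have "nat \<lfloor>real n * t\<rfloor> = nat \<lfloor>real n * p (cell t)\<rfloor>" using p[OF t] by (simp add: cell_def)
      moreover have "0 \<le> \<lfloor>real n * t\<rfloor>" "0 \<le> \<lfloor>real n * p (cell t)\<rfloor>" using t01 p01 by auto
      ultimately have "\<lfloor>real n * t\<rfloor> = \<lfloor>real n * p (cell t)\<rfloor>" by (metis nat_eq_iff2)
      then show ?thesis by linarith
    qed
    then have "real n * \<bar>t - p (cell t)\<bar> < 1"
      by (simp add: right_diff_distrib[symmetric] abs_mult)
    then have "\<bar>t - p (cell t)\<bar> < inverse (real n)"
      by (simp add: n_def field_simps)
    then have "dist t (p (cell t)) < d" using m by (simp add: dist_real_def n_def)
    then have "\<bar>\<omega> t - \<omega> (p (cell t))\<bar> < e / 2"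
      using d(2)[OF t] p[OF t] by (simp add: dist_real_def)
    then show ?thesis using q[of "cell t"] 1 by linarith
  qed
  then show ?thesis by blast
qed

section \<open>Coordinates generate the Borel sigma-field of the path space\<close>

definition half_lines :: "real set \<Rightarrow> (real \<Rightarrow> real) set set" where
  "half_lines T = {{\<omega> \<in> path_space T. \<omega> t < c} | t c. t \<in> T}"

lemma half_lines_coordinate:
  assumes "t \<in> T"
  shows "(\<lambda>\<omega>. \<omega> t) \<in> borel_measurable (sigma (path_space T) (half_lines T))"
proof -
  have sub: "half_lines T \<subseteq> Pow (path_space T)" by (auto simp: half_lines_def)
  show ?thesis
    unfolding borel_measurable_iff_less using assms
    by (auto simp: sets_measure_of[OF sub] space_measure_of_conv half_lines_def)
qed

text \<open>Separability in disguise: an open set is the union of the countably many sets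
  \<open>E n qs r\<close> contained in it, each of which is a countable intersection of coordinate
  conditions. Conversely, half-lines are open because evaluation is continuous.\<close>

lemma sets_path_borel_half_lines:
  assumes T: "time_scale T"
  shows "sets (path_borel T) = sigma_sets (path_space T) (half_lines T)"
proof -
  have sub: "half_lines T \<subseteq> Pow (path_space T)" by (auto simp: half_lines_def)
  have sub': "{U. openin (mtopology_of (path_metric T)) U} \<subseteq> Pow (path_space T)"
    using openin_path_metric[OF T] by auto
  have sets: "sets (path_borel T) = sigma_sets (path_space T) {U. openin (mtopology_of (path_metric T)) U}"
    unfolding path_borel_def by (rule sets_measure_of[OF sub'])
  define S where "S = sigma (path_space T) (half_lines T)"
  have setsS: "sets S = sigma_sets (path_space T) (half_lines T)" and spS: "space S = path_space T"
    unfolding S_def by (auto simp: sets_measure_of[OF sub] space_measure_of_conv)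
  obtain D where D: "countable D" "D \<subseteq> T" "T \<subseteq> closure D" by (rule separable)
  \<comment> \<open>A ball in which the distance is tested on \<open>D\<close> only. Two paths that
    satisfy the condition differ by at most twice the radius on \<open>D\<close>, and by continuity
    on all of \<open>T\<close>; this is why a radius below \<open>r / 2\<close> is chosen
    later.\<close>
  define E where "E n qs r = {\<eta> \<in> path_space T. \<forall>t\<in>D. \<bar>\<eta> t - step_path n qs t\<bar> \<le> of_rat r}" for n qs and r :: rat
  have E_sets: "E n qs r \<in> sets S" for n qs r
  proof -
    have [measurable]: "(\<lambda>\<eta>. \<eta> t) \<in> borel_measurable S" if "t \<in> D" for t
      unfolding S_def using half_lines_coordinate that D by auto
    have "{\<eta> \<in> space S. \<forall>t\<in>D. \<bar>\<eta> t - step_path n qs t\<bar> \<le> of_rat r} \<in> sets S"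
      using D(1) by measurable
    then show ?thesis by (simp add: E_def spS)
  qed
  have open_in: "U \<in> sets S" if U: "openin (mtopology_of (path_metric T)) U" for U
  proof -
    have U_sub: "U \<subseteq> path_space T" and U_ball: "\<And>\<omega>. \<omega> \<in> U \<Longrightarrow> \<exists>r>0. \<forall>\<eta>\<in>path_space T. (\<forall>t\<in>T. \<bar>\<eta> t - \<omega> t\<bar> \<le> r) \<longrightarrow> \<eta> \<in> U"
      using U unfolding openin_path_metric[OF T] by auto
    have "U = \<Union> ((\<lambda>(n, qs, r). E n qs r) ` {(n, qs, r). E n qs r \<subseteq> U})"
    proof (intro equalityI subsetI)
      fix \<omega> assume \<omega>: "\<omega> \<in> U"
      then have \<omega>p: "\<omega> \<in> path_space T" using U_sub by auto
      obtain r where r: "r > 0" "\<And>\<eta>. \<eta> \<in> path_space T \<Longrightarrow> (\<forall>t\<in>T. \<bar>\<eta> t - \<omega> t\<bar> \<le> r) \<Longrightarrow> \<eta> \<in> U"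
        using U_ball[OF \<omega>] by auto
      obtain q where q: "0 < real_of_rat q" "real_of_rat q < r / 2"
        using of_rat_dense[OF half_gt_zero[OF r(1)]] by blast
      obtain n qs where nq: "\<And>t. t \<in> T \<Longrightarrow> \<bar>\<omega> t - step_path n qs t\<bar> < of_rat q"
        using step_path_dense[OF T \<omega>p q(1)] by auto
      have "\<omega> \<in> E n qs q" using \<omega>p nq D(2) by (force simp: E_def)
      moreover have "E n qs q \<subseteq> U"
      proof
        fix \<eta> assume \<eta>: "\<eta> \<in> E n qs q"
        then have \<eta>p: "\<eta> \<in> path_space T" by (simp add: E_def)
        have "\<bar>\<eta> t - \<omega> t\<bar> \<le> r" if "t \<in> D" for t
          using nq[of t] \<eta> that D(2) q by (force simp: E_def)
        moreover have "continuous_on T (\<lambda>t. \<bar>\<eta> t - \<omega> t\<bar>)"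
          using \<eta>p \<omega>p T by (auto simp: path_space_iff intro!: continuous_intros)
        ultimately have "\<bar>\<eta> t - \<omega> t\<bar> \<le> r" if "t \<in> T" for t
        proof -
          have cl: "closure D = T"
            using D time_scaleD(1)[OF T] by (simp add: closure_minimal subset_antisym)
          show ?thesis
            by (rule continuous_le_on_closure[of D])
              (use cl that \<open>continuous_on T _\<close> \<open>\<And>t. t \<in> D \<Longrightarrow> _\<close> in auto)
        qed
        then show "\<eta> \<in> U" using r(2)[OF \<eta>p] by blast
      qed
      ultimately show "\<omega> \<in> \<Union> ((\<lambda>(n, qs, r). E n qs r) ` {(n, qs, r). E n qs r \<subseteq> U})" by blast
    qed auto
    also have "\<dots> \<in> sets S"
      by (intro sets.countable_Union countable_image) (use E_sets in auto)
    finally show ?thesis .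
  qed
  show ?thesis
  proof (intro equalityI)
    show "sets (path_borel T) \<subseteq> sigma_sets (path_space T) (half_lines T)"
      using sets.sigma_sets_subset[of "{U. openin (mtopology_of (path_metric T)) U}" S] open_in
      by (auto simp: sets setsS spS)
    have "half_lines T \<subseteq> sets (path_borel T)"
    proof
      fix X assume "X \<in> half_lines T"
      then obtain t c where t: "t \<in> T" and X: "X = {\<omega> \<in> path_space T. \<omega> t < c}" by (auto simp: half_lines_def)
      have "openin (mtopology_of (path_metric T)) X"
        unfolding openin_path_metric[OF T]
      proof (intro conjI ballI)
        fix \<omega> assume "\<omega> \<in> X"
        then have "\<omega> t < c" by (simp add: X)
        have "\<eta> \<in> X" if "\<eta> \<in> path_space T" "\<forall>s\<in>T. \<bar>\<eta> s - \<omega> s\<bar> \<le> (c - \<omega> t) / 2" for \<eta>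
        proof -
          have "\<bar>\<eta> t - \<omega> t\<bar> \<le> (c - \<omega> t) / 2" using that t by blast
          then have "\<eta> t - \<omega> t \<le> (c - \<omega> t) / 2" by (rule order_trans[OF abs_ge_self])
          then have "\<eta> t < c" using \<open>\<omega> t < c\<close> by (simp add: field_simps)
          then show ?thesis using that(1) by (simp add: X)
        qed
        then show "\<exists>r>0. \<forall>\<eta>\<in>path_space T. (\<forall>t\<in>T. \<bar>\<eta> t - \<omega> t\<bar> \<le> r) \<longrightarrow> \<eta> \<in> X"
          using \<open>\<omega> t < c\<close> by (intro exI[of _ "(c - \<omega> t) / 2"]) auto
      qed (auto simp: X)
      then show "X \<in> sets (path_borel T)" unfolding sets by auto
    qed
    then show "sigma_sets (path_space T) (half_lines T) \<subseteq> sets (path_borel T)"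
      using sets.sigma_sets_subset[of "half_lines T" "path_borel T"] by simp
  qed
qed

lemma path_borel_coordinate:
  assumes "time_scale T" "t \<in> T"
  shows "(\<lambda>\<omega>. \<omega> t) \<in> borel_measurable (path_borel T)"
proof -
  have sub: "half_lines T \<subseteq> Pow (path_space T)" by (auto simp: half_lines_def)
  have "sets (path_borel T) = sets (sigma (path_space T) (half_lines T))"
    using sets_path_borel_half_lines[OF assms(1)] sets_measure_of[OF sub] by simp
  then show ?thesis
    using half_lines_coordinate[OF assms(2)] measurable_cong_sets by blast
qed

lemma measurable_into_path_borel:
  assumes T: "time_scale T" and sp: "\<And>x. x \<in> space N \<Longrightarrow> f x \<in> path_space T"
    and f: "\<And>t. t \<in> T \<Longrightarrow> (\<lambda>x. f x t) \<in> borel_measurable N"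
  shows "f \<in> measurable N (path_borel T)"
proof -
  have sub: "half_lines T \<subseteq> Pow (path_space T)" by (auto simp: half_lines_def)
  have "f \<in> measurable N (sigma (path_space T) (half_lines T))"
  proof (rule measurable_measure_of[OF sub])
    fix A assume "A \<in> half_lines T"
    then obtain t c where t: "t \<in> T" and A: "A = {\<omega> \<in> path_space T. \<omega> t < c}" by (auto simp: half_lines_def)
    have "f -` A \<inter> space N = {x \<in> space N. f x t < c}" using sp by (auto simp: A)
    also have "\<dots> \<in> sets N" using f[OF t] by measurable
    finally show "f -` A \<inter> space N \<in> sets N" .
  qed (use sp in auto)
  moreover have "sets (path_borel T) = sets (sigma (path_space T) (half_lines T))"
    using sets_path_borel_half_lines[OF T] sets_measure_of[OF sub] by simp
  ultimately show ?thesis using measurable_cong_sets by blast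
qed

text \<open>One cylinder function approximates the indicator for all the measures in
  \<open>N\<close> at once. This is needed since two laws are compared through the same test
  function.\<close>

lemma cyl_fun_approx:
  assumes T: "time_scale T" and fin: "finite N"
    and N: "\<And>\<nu>. \<nu> \<in> N \<Longrightarrow> prob_space \<nu> \<and> sets \<nu> = sets (path_borel T)"
    and A: "A \<in> sets (path_borel T)" and e: "e > 0"
  shows "\<exists>f. cyl_fun T f \<and> (\<forall>\<nu>\<in>N. (\<integral>w. \<bar>f w - indicator A w\<bar> \<partial>\<nu>) < e)"
proof -
  have fm: "f \<in> borel_measurable \<nu>" if "cyl_fun T f" "\<nu> \<in> N" for f \<nu>
  proof -
    have "(\<lambda>w. f (\<lambda>t. w t)) \<in> borel_measurable (path_borel T)"
      by (rule cyl_fun_measurable[OF that(1)]) (rule path_borel_coordinate[OF T])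
    then show ?thesis using N[OF that(2)] measurable_cong_sets by auto
  qed
  have spN: "space \<nu> = path_space T" if "\<nu> \<in> N" for \<nu>
    using N[OF that] sets_eq_imp_space_eq[of \<nu> "path_borel T"] by simp
  have int: "integrable \<nu> (\<lambda>w. \<bar>f w - indicator A w\<bar>)"
    if f: "cyl_fun T f" and \<nu>: "\<nu> \<in> N" and A: "A \<in> sets (path_borel T)" for f \<nu> A
  proof -
    interpret prob_space \<nu> using N \<nu> by auto
    have [measurable]: "f \<in> borel_measurable \<nu>" "A \<in> sets \<nu>" using fm f \<nu> N A by auto
    have "\<bar>f w - indicator A w\<bar> \<le> 1" for w
      using cyl_fun_bounds[OF f, of w] by (auto simp: indicator_def)
    then show ?thesis by (intro integrable_const_bound[of _ 1]) auto
  qed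
  have zero: "cyl_fun T (\<lambda>_. 0)"
    using cyl_fun.coord[OF time_scaleD(3)[OF T], of 0] by simp
  \<comment> \<open>The approximable sets: half-lines belong by ramps of growing slope, complements
    by \<open>1 - f\<close>, finite unions by \<open>max\<close>, and countable unions by bounded
    convergence along partial unions.\<close>
  define ap where "ap A \<longleftrightarrow> A \<in> sets (path_borel T) \<and>
      (\<forall>e>0. \<exists>f. cyl_fun T f \<and> (\<forall>\<nu>\<in>N. (\<integral>w. \<bar>f w - indicator A w\<bar> \<partial>\<nu>) < e))" for A :: "(real \<Rightarrow> real) set"
  have lim: "ap A"
    if As: "\<And>n. ap (B n)" and AM: "A \<in> sets (path_borel T)"
      and conv: "\<And>w. w \<in> path_space T \<Longrightarrow> (\<lambda>n. indicator (B n) w :: real) \<longlonglongrightarrow> indicator A w" for A B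
    unfolding ap_def
  proof (intro conjI allI impI)
    fix e :: real assume "e > 0"
    have Bs: "B n \<in> sets (path_borel T)" for n using As by (simp add: ap_def)
    have "\<forall>\<^sub>F n in sequentially. \<forall>\<nu>\<in>N. (\<integral>w. \<bar>indicator (B n) w - indicator A w :: real\<bar> \<partial>\<nu>) < e / 2"
    proof (rule eventually_ball_finite[OF fin], rule ballI)
      fix \<nu> assume \<nu>: "\<nu> \<in> N"
      interpret prob_space \<nu> using N \<nu> by auto
      have [measurable]: "A \<in> sets \<nu>" "\<And>n. B n \<in> sets \<nu>" using N[OF \<nu>] AM Bs by auto
      have "(\<lambda>n. \<integral>w. \<bar>indicator (B n) w - indicator A w :: real\<bar> \<partial>\<nu>) \<longlonglongrightarrow> (\<integral>w. \<bar>0 :: real\<bar> \<partial>\<nu>)"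
      proof (rule integral_dominated_convergence[where w="\<lambda>_. 1"])
        show "AE w in \<nu>. (\<lambda>n. \<bar>indicator (B n) w - indicator A w :: real\<bar>) \<longlonglongrightarrow> \<bar>0\<bar>"
        proof (rule AE_I2)
          fix w assume "w \<in> space \<nu>"
          then show "(\<lambda>n. \<bar>indicator (B n) w - indicator A w :: real\<bar>) \<longlonglongrightarrow> \<bar>0\<bar>"
            using LIM_zero[OF conv[of w]] spN[OF \<nu>] by (intro tendsto_rabs) auto
        qed
      qed (auto simp: indicator_def)
      then show "\<forall>\<^sub>F n in sequentially. (\<integral>w. \<bar>indicator (B n) w - indicator A w :: real\<bar> \<partial>\<nu>) < e / 2"
        by (rule order_tendstoD(2)) (use \<open>e > 0\<close> in simp)
    qed
    then obtain n where n: "\<And>\<nu>. \<nu> \<in> N \<Longrightarrow> (\<integral>w. \<bar>indicator (B n) w - indicator A w :: real\<bar> \<partial>\<nu>) < e / 2"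
      by (auto simp: eventually_sequentially)
    obtain f where f: "cyl_fun T f" "\<And>\<nu>. \<nu> \<in> N \<Longrightarrow> (\<integral>w. \<bar>f w - indicator (B n) w\<bar> \<partial>\<nu>) < e / 2"
      using As[of n] \<open>e > 0\<close> unfolding ap_def by (meson half_gt_zero)
    have "(\<integral>w. \<bar>f w - indicator A w\<bar> \<partial>\<nu>) < e" if \<nu>: "\<nu> \<in> N" for \<nu>
    proof -
      interpret prob_space \<nu> using N \<nu> by auto
      have [measurable]: "A \<in> sets \<nu>" "B n \<in> sets \<nu>" using N[OF \<nu>] AM Bs by auto
      have i: "integrable \<nu> (\<lambda>w. \<bar>indicator (B n) w - indicator A w :: real\<bar>)"
        by (intro integrable_const_bound[of _ 1]) (auto simp: indicator_def)
      have "(\<integral>w. \<bar>f w - indicator A w\<bar> \<partial>\<nu>) \<le> (\<integral>w. \<bar>f w - indicator (B n) w\<bar> + \<bar>indicator (B n) w - indicator A w\<bar> \<partial>\<nu>)"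
        using int[OF f(1) \<nu> AM] int[OF f(1) \<nu> Bs] i by (intro integral_mono) auto
      also have "\<dots> < e / 2 + e / 2"
        using int[OF f(1) \<nu> Bs] i f(2)[OF \<nu>] n[OF \<nu>] by (subst Bochner_Integration.integral_add) auto
      finally show ?thesis by simp
    qed
    with f(1) show "\<exists>f. cyl_fun T f \<and> (\<forall>\<nu>\<in>N. (\<integral>w. \<bar>f w - indicator A w\<bar> \<partial>\<nu>) < e)" by blast
  qed (rule AM)
  have union: "ap (A \<union> B)" if A: "ap A" and B: "ap B" for A B
    unfolding ap_def
  proof (intro conjI allI impI)
    have AB: "A \<in> sets (path_borel T)" "B \<in> sets (path_borel T)" using A B by (auto simp: ap_def)
    then show "A \<union> B \<in> sets (path_borel T)" by auto
    fix e :: real assume "e > 0"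
    obtain f where f: "cyl_fun T f" "\<And>\<nu>. \<nu> \<in> N \<Longrightarrow> (\<integral>w. \<bar>f w - indicator A w\<bar> \<partial>\<nu>) < e / 2"
      using A \<open>e > 0\<close> unfolding ap_def by (meson half_gt_zero)
    obtain g where g: "cyl_fun T g" "\<And>\<nu>. \<nu> \<in> N \<Longrightarrow> (\<integral>w. \<bar>g w - indicator B w\<bar> \<partial>\<nu>) < e / 2"
      using B \<open>e > 0\<close> unfolding ap_def by (meson half_gt_zero)
    have fg: "cyl_fun T (\<lambda>w. max (f w) (g w))" by (rule cyl_fun.sup[OF f(1) g(1)])
    have "(\<integral>w. \<bar>max (f w) (g w) - indicator (A \<union> B) w\<bar> \<partial>\<nu>) < e" if \<nu>: "\<nu> \<in> N" for \<nu>
    proof -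
      have "(\<integral>w. \<bar>max (f w) (g w) - indicator (A \<union> B) w\<bar> \<partial>\<nu>) \<le> (\<integral>w. \<bar>f w - indicator A w\<bar> + \<bar>g w - indicator B w\<bar> \<partial>\<nu>)"
      proof (rule integral_mono)
        fix w
        show "\<bar>max (f w) (g w) - indicator (A \<union> B) w\<bar> \<le> \<bar>f w - indicator A w\<bar> + \<bar>g w - indicator B w\<bar>"
          using cyl_fun_bounds[OF f(1), of w] cyl_fun_bounds[OF g(1), of w] by (auto simp: indicator_def)
      qed (use int[OF f(1) \<nu> AB(1)] int[OF g(1) \<nu> AB(2)] int[OF fg \<nu>] AB in auto)
      also have "\<dots> < e / 2 + e / 2"
        using int[OF f(1) \<nu> AB(1)] int[OF g(1) \<nu> AB(2)] f(2)[OF \<nu>] g(2)[OF \<nu>]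
        by (subst Bochner_Integration.integral_add) auto
      finally show ?thesis by simp
    qed
    with fg show "\<exists>f. cyl_fun T f \<and> (\<forall>\<nu>\<in>N. (\<integral>w. \<bar>f w - indicator (A \<union> B) w\<bar> \<partial>\<nu>) < e)" by blast
  qed
  have empty: "ap {}"
    unfolding ap_def using zero by (auto intro!: exI[of _ "\<lambda>_. 0"])
  have "ap A"
    using A unfolding sets_path_borel_half_lines[OF T]
  proof induction
    case (Basic A)
    then obtain t c where t: "t \<in> T" and A: "A = {\<omega> \<in> path_space T. \<omega> t < c}" by (auto simp: half_lines_def)
    have AM: "A \<in> sets (path_borel T)"
      using Basic by (simp add: sets_path_borel_half_lines[OF T])
    \<comment> \<open>A ramp equal to 0 for \<open>w t \<ge> c\<close> and to 1 once
      \<open>w t\<close> lies at least \<open>1 / k\<close> below \<open>c\<close>; it converges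
      pointwise to the strict half-line indicator.\<close>
    define f where "f k w = max 0 (min 1 (real k * (c - w t)))" for k :: nat and w :: "real \<Rightarrow> real"
    have f: "cyl_fun T (f k)" for k unfolding f_def by (rule cyl_fun.coord[OF t])
    have conv: "(\<lambda>k. f k w) \<longlonglongrightarrow> indicator A w" if w: "w \<in> path_space T" for w
    proof (cases "w t < c")
      case True
      obtain m where m: "1 / (c - w t) \<le> real m" using real_arch_simple by blast
      have "f k w = 1" if "k \<ge> m" for k
      proof -
        have "1 / (c - w t) \<le> real k" using m that by (simp add: order_trans)
        then show ?thesis using True by (simp add: f_def field_simps)
      qed
      then have "\<forall>\<^sub>F k in sequentially. f k w = 1" by (auto simp: eventually_sequentially)
      then show ?thesis using True w by (simp add: A tendsto_eventually)
    next
      case False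
      then have "real k * (c - w t) \<le> 0" for k by (intro mult_nonneg_nonpos) auto
      then have "f k w = 0" for k using order_trans[OF \<open>_ \<le> 0\<close> zero_le_one] by (simp add: f_def)
      then show ?thesis using False by (simp add: A)
    qed
    have "\<exists>k. \<forall>\<nu>\<in>N. (\<integral>w. \<bar>f k w - indicator A w\<bar> \<partial>\<nu>) < e" if "e > 0" for e
    proof -
      have "\<forall>\<^sub>F k in sequentially. \<forall>\<nu>\<in>N. (\<integral>w. \<bar>f k w - indicator A w\<bar> \<partial>\<nu>) < e"
      proof (rule eventually_ball_finite[OF fin], rule ballI)
        fix \<nu> assume \<nu>: "\<nu> \<in> N"
        interpret prob_space \<nu> using N \<nu> by auto
        have [measurable]: "A \<in> sets \<nu>" "\<And>k. f k \<in> borel_measurable \<nu>" using N[OF \<nu>] AM fm[OF f \<nu>] by auto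
        have "(\<lambda>k. \<integral>w. \<bar>f k w - indicator A w\<bar> \<partial>\<nu>) \<longlonglongrightarrow> (\<integral>w. \<bar>0 :: real\<bar> \<partial>\<nu>)"
        proof (rule integral_dominated_convergence[where w="\<lambda>_. 1"])
          show "AE w in \<nu>. (\<lambda>k. \<bar>f k w - indicator A w\<bar>) \<longlonglongrightarrow> \<bar>0\<bar>"
          proof (rule AE_I2)
            fix w assume "w \<in> space \<nu>"
            then show "(\<lambda>k. \<bar>f k w - indicator A w\<bar>) \<longlonglongrightarrow> \<bar>0\<bar>"
              using LIM_zero[OF conv[of w]] spN[OF \<nu>] by (intro tendsto_rabs) auto
          qed
          show "AE w in \<nu>. norm \<bar>f k w - indicator A w\<bar> \<le> 1" for k
          proof (rule AE_I2)
            fix w show "norm \<bar>f k w - indicator A w\<bar> \<le> 1"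
              using cyl_fun_bounds[OF f, of k w] by (auto simp: indicator_def)
          qed
        qed auto
        then show "\<forall>\<^sub>F k in sequentially. (\<integral>w. \<bar>f k w - indicator A w\<bar> \<partial>\<nu>) < e"
          by (rule order_tendstoD(2)) (use that in simp)
      qed
      then show ?thesis by (auto simp: eventually_sequentially)
    qed
    then show ?case unfolding ap_def using AM f by blast
  next
    case Empty
    show ?case by (rule empty)
  next
    case (Compl A)
    have AM: "path_space T - A \<in> sets (path_borel T)"
      using Compl.IH sets.compl_sets[of A "path_borel T"] by (simp add: ap_def)
    have eq: "(\<integral>w. \<bar>(1 - f w) - indicator (path_space T - A) w\<bar> \<partial>\<nu>) = (\<integral>w. \<bar>f w - indicator A w\<bar> \<partial>\<nu>)"
      if "\<nu> \<in> N" for f :: "(real \<Rightarrow> real) \<Rightarrow> real" and \<nu>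
      using spN[OF that] by (intro Bochner_Integration.integral_cong) (auto simp: indicator_def)
    show ?case
      unfolding ap_def
    proof (intro conjI allI impI AM)
      fix e :: real assume "e > 0"
      then obtain f where "cyl_fun T f" "\<forall>\<nu>\<in>N. (\<integral>w. \<bar>f w - indicator A w\<bar> \<partial>\<nu>) < e"
        using Compl.IH by (auto simp: ap_def)
      then show "\<exists>f. cyl_fun T f \<and> (\<forall>\<nu>\<in>N. (\<integral>w. \<bar>f w - indicator (path_space T - A) w\<bar> \<partial>\<nu>) < e)"
        using eq by (intro exI[of _ "\<lambda>w. 1 - f w"]) (auto intro: cyl_fun.compl)
    qed
  next
    case (Union A)
    have fin_un: "ap (\<Union>i<n. A i)" for n
      by (induction n) (auto simp: lessThan_Suc Un_commute intro: empty union Union.IH)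
    show ?case
    proof (rule lim[OF fin_un])
      show "(\<Union>i. A i) \<in> sets (path_borel T)" using Union.IH by (auto simp: ap_def)
      fix w
      show "(\<lambda>n. indicator (\<Union>i<n. A i) w :: real) \<longlonglongrightarrow> indicator (\<Union>i. A i) w"
        by (rule LIMSEQ_indicator_UN)
    qed
  qed
  then show ?thesis using e by (simp add: ap_def)
qed

text \<open>Although only the laws on \<open>T\<close> are compared, the shift is given on all of
  [0,1], because the grid of the discretization is not contained in \<open>T\<close>.\<close>

theorem brownian_shift_equivalent:
  assumes T: "time_scale T" and bm: "standard_brownian_motion M b" and C: "0 \<le> C"
    and U0: "\<And>x. x \<in> space M \<Longrightarrow> U 0 x = 0"
    and lip: "\<And>s t x. x \<in> space M \<Longrightarrow> s \<in> {0..1} \<Longrightarrow> t \<in> {0..1} \<Longrightarrow> \<bar>U s x - U t x\<bar> \<le> C * \<bar>s - t\<bar>"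
    and Um: "\<And>t. t \<in> {0..1} \<Longrightarrow> U t \<in> borel_measurable M"
    and adapted: "\<And>t. t \<in> {0..1} \<Longrightarrow> \<exists>U'\<in>borel_measurable (process_sigma (space M) {0..t} b). AE x in M. U t x = U' x"
    and bp: "sample_path T b \<in> measurable M (path_borel T)"
    and Up: "sample_path T (\<lambda>t x. b t x + U t x) \<in> measurable M (path_borel T)"
  shows "absolutely_continuous (sampled_law T M b) (sampled_law T M (\<lambda>t x. b t x + U t x))"
    and "absolutely_continuous (sampled_law T M (\<lambda>t x. b t x + U t x)) (sampled_law T M b)"
proof -
  interpret prob_space M using bm by (simp add: standard_brownian_motion_def)
  define \<nu>1 where "\<nu>1 = sampled_law T M b"
  define \<nu>2 where "\<nu>2 = sampled_law T M (\<lambda>t x. b t x + U t x)"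
  have sets: "sets \<nu>1 = sets (path_borel T)" "sets \<nu>2 = sets (path_borel T)"
    by (auto simp: \<nu>1_def \<nu>2_def sampled_law_def)
  have prob: "prob_space \<nu>1" "prob_space \<nu>2"
    unfolding \<nu>1_def \<nu>2_def sampled_law_def using bp Up by (auto intro: prob_space_distr)
  interpret n1: prob_space \<nu>1 by fact
  interpret n2: prob_space \<nu>2 by fact
  have fm: "f \<in> borel_measurable (path_borel T)" if "cyl_fun T f" for f
    using cyl_fun_measurable[OF that, of "\<lambda>t w. w t"] path_borel_coordinate[OF T] by simp
  have b1: "(\<integral>w. f w \<partial>\<nu>1) = (\<integral>x. f (\<lambda>t. b t x) \<partial>M)" if f: "cyl_fun T f" for f
    unfolding \<nu>1_def sampled_law_def
    by (subst integral_distr[OF bp fm[OF f]], intro Bochner_Integration.integral_cong refl cyl_fun_cong[OF f])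
       (auto simp: sample_path_def)
  have b2: "(\<integral>w. f w \<partial>\<nu>2) = (\<integral>x. f (\<lambda>t. b t x + U t x) \<partial>M)" if f: "cyl_fun T f" for f
    unfolding \<nu>2_def sampled_law_def
    by (subst integral_distr[OF Up fm[OF f]], intro Bochner_Integration.integral_cong refl cyl_fun_cong[OF f])
       (auto simp: sample_path_def)
  have le: "(\<integral>w. f w \<partial>\<nu>1) \<le> l * exp (C\<^sup>2) + (\<integral>w. f w \<partial>\<nu>2) / l" "(\<integral>w. f w \<partial>\<nu>2) \<le> l * exp (C\<^sup>2) + (\<integral>w. f w \<partial>\<nu>1) / l"
    if f: "cyl_fun T f" and l: "l > 0" for f l
    unfolding b1[OF f] b2[OF f]
    using brownian_shift_bounds[OF bm C time_scaleD(5)[OF T] U0 lip Um adapted f l] by auto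
  \<comment> \<open>Stated for an ordered pair of measures so that both directions follow by
    exchanging the two laws.\<close>
  have key: "measure \<nu> A = 0"
    if N: "{\<nu>, \<nu>'} = {\<nu>1, \<nu>2}" and A: "A \<in> sets (path_borel T)" and z: "measure \<nu>' A = 0"
      and le: "\<And>f l. cyl_fun T f \<Longrightarrow> l > 0 \<Longrightarrow> (\<integral>w. f w \<partial>\<nu>) \<le> l * exp (C\<^sup>2) + (\<integral>w. f w \<partial>\<nu>') / l" for \<nu> \<nu>' A
  proof -
    have p: "\<nu>'' \<in> {\<nu>, \<nu>'} \<Longrightarrow> prob_space \<nu>'' \<and> sets \<nu>'' = sets (path_borel T)" for \<nu>''
      unfolding N using prob sets by auto
    have close: "\<bar>(\<integral>w. f w \<partial>\<nu>'') - measure \<nu>'' A\<bar> \<le> (\<integral>w. \<bar>f w - indicator A w\<bar> \<partial>\<nu>'')"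
      if f: "cyl_fun T f" and "\<nu>'' \<in> {\<nu>, \<nu>'}" for f \<nu>''
    proof -
      interpret q: prob_space \<nu>'' using p that by auto
      have s: "sets \<nu>'' = sets (path_borel T)" using p that by auto
      have [measurable]: "f \<in> borel_measurable \<nu>''" "A \<in> sets \<nu>''" using fm[OF f] A s measurable_cong_sets by auto
      have 1: "integrable \<nu>'' f" using cyl_fun_bounds[OF f] by (intro q.integrable_const_bound[of _ 1]) auto
      have 2: "integrable \<nu>'' (indicator A :: _ \<Rightarrow> real)"
        by (intro q.integrable_const_bound[of _ 1]) (auto simp: indicator_def)
      have "(\<integral>w. f w \<partial>\<nu>'') - measure \<nu>'' A = (\<integral>w. f w - indicator A w \<partial>\<nu>'')"
        using 1 2 by (subst Bochner_Integration.integral_diff) auto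
      then show ?thesis by simp
    qed
    have "measure \<nu> A \<le> l * (exp (C\<^sup>2) + l + 1)" if l: "l > 0" for l
    proof -
      \<comment> \<open>The accuracy is the square of \<open>l\<close> because the error under the
        second law is divided by \<open>l\<close>; both errors then vanish as \<open>l\<close> tends
        to 0.\<close>
      obtain f where f: "cyl_fun T f" "\<And>\<nu>''. \<nu>'' \<in> {\<nu>, \<nu>'} \<Longrightarrow> (\<integral>w. \<bar>f w - indicator A w\<bar> \<partial>\<nu>'') < l\<^sup>2"
        using cyl_fun_approx[OF T _ p A, of "{\<nu>, \<nu>'}" "l\<^sup>2"] l by auto
      have "(\<integral>w. f w \<partial>\<nu>') \<le> l\<^sup>2"
        using close[OF f(1), of \<nu>'] f(2)[of \<nu>'] z by auto
      then have "(\<integral>w. f w \<partial>\<nu>') / l \<le> l"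
        using l by (simp add: field_simps power2_eq_square)
      then show ?thesis
        using close[OF f(1), of \<nu>] f(2)[of \<nu>] le[OF f(1) l] by (simp add: algebra_simps power2_eq_square)
    qed
    then have "\<forall>\<^sub>F l in at_right 0. measure \<nu> A \<le> l * (exp (C\<^sup>2) + l + 1)"
      by (auto simp: eventually_at_right_less eventually_at_filter)
    moreover have "((\<lambda>l. l * (exp (C\<^sup>2) + l + 1)) \<longlongrightarrow> 0 * (exp (C\<^sup>2) + 0 + 1)) (at_right 0)"
      by (intro tendsto_intros)
    ultimately have "measure \<nu> A \<le> 0"
      using tendsto_lowerbound[of _ _ "at_right (0::real)" "measure \<nu> A"] by fastforce
    then show ?thesis by (simp add: measure_le_0_iff)
  qed
  show "absolutely_continuous (sampled_law T M b) (sampled_law T M (\<lambda>t x. b t x + U t x))"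
    unfolding absolutely_continuous_def \<nu>1_def[symmetric] \<nu>2_def[symmetric]
    using key[of \<nu>2 \<nu>1] le(2) sets by (auto simp: null_sets_def n1.emeasure_eq_measure n2.emeasure_eq_measure)
  show "absolutely_continuous (sampled_law T M (\<lambda>t x. b t x + U t x)) (sampled_law T M b)"
    unfolding absolutely_continuous_def \<nu>1_def[symmetric] \<nu>2_def[symmetric]
    using key[of \<nu>1 \<nu>2] le(1) sets by (auto simp: null_sets_def n1.emeasure_eq_measure n2.emeasure_eq_measure)
qed

section \<open>Augmented filtrations\<close>

lemma space_augment [simp]: "space (augment Q G) = space Q"
  by (simp add: augment_def space_measure_of_conv)

lemma sets_augment:
  assumes "subalgebra Q G"
  shows "sets (augment Q G) = sigma_sets (space Q) (sets G \<union> null_sets (completion Q))"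
  unfolding augment_def
proof (rule sets_measure_of)
  have "sets G \<subseteq> Pow (space Q)" using assms sets.space_closed[of G] by (simp add: subalgebra_def)
  moreover have "null_sets (completion Q) \<subseteq> Pow (space Q)"
    using sets.space_closed[of "completion Q"] by (auto simp: null_sets_def)
  ultimately show "sets G \<union> null_sets (completion Q) \<subseteq> Pow (space Q)" by simp
qed

lemma sets_augment_base: "subalgebra Q G \<Longrightarrow> A \<in> sets G \<Longrightarrow> A \<in> sets (augment Q G)"
  and sets_augment_null: "subalgebra Q G \<Longrightarrow> N \<in> null_sets (completion Q) \<Longrightarrow> N \<in> sets (augment Q G)"
  by (auto simp: sets_augment)

lemma measurable_augment_base:
  assumes G: "subalgebra Q G" and f: "f \<in> measurable G N"
  shows "f \<in> measurable (augment Q G) N"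
proof (rule measurableI)
  have sp: "space G = space Q" using G by (simp add: subalgebra_def)
  show "f x \<in> space N" if "x \<in> space (augment Q G)" for x
    using measurable_space[OF f] that sp by simp
  show "f -` A \<inter> space (augment Q G) \<in> sets (augment Q G)" if "A \<in> sets N" for A
    using sets_augment_base[OF G measurable_sets[OF f that]] sp by simp
qed

lemma sets_augment_mono:
  assumes "subalgebra Q G" "subalgebra Q G'" "sets G \<subseteq> sets G'"
  shows "sets (augment Q G) \<subseteq> sets (augment Q G')"
  unfolding sets_augment[OF assms(1)] sets_augment[OF assms(2)]
  using assms(3) by (intro sigma_sets_mono') auto

text \<open>The sets that differ from a set of \<open>G\<close> by a negligible set are closed under
  complements and countable unions and contain both kinds of generators.\<close>

lemma augment_mod_null:
  assumes G: "subalgebra Q G" and A: "A \<in> sets (augment Q G)"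
  shows "\<exists>B\<in>sets G. sym_diff A B \<in> null_sets (completion Q)"
  using A unfolding sets_augment[OF G]
proof induction
  case (Basic A)
  then show ?case
  proof
    assume "A \<in> sets G"
    then show ?thesis by (intro bexI[of _ A]) auto
  next
    assume "A \<in> null_sets (completion Q)"
    then show ?thesis by (intro bexI[of _ "{}"]) auto
  qed
next
  case Empty
  show ?case by (intro bexI[of _ "{}"]) auto
next
  case (Compl A)
  then obtain B where B: "B \<in> sets G" "sym_diff A B \<in> null_sets (completion Q)" by auto
  have "space Q - B \<in> sets G" using B(1) G by (metis sets.compl_sets subalgebra_def)
  moreover have "sym_diff (space Q - A) (space Q - B) \<subseteq> sym_diff A B" by auto
  ultimately show ?case using null_sets_completion_subset[OF _ B(2)] by blast
next
  case (Union A)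
  then obtain B where B: "\<And>i. B i \<in> sets G" "\<And>i. sym_diff (A i) (B i) \<in> null_sets (completion Q)" by metis
  have "sym_diff (\<Union>i. A i) (\<Union>i. B i) \<subseteq> (\<Union>i. sym_diff (A i) (B i))" by auto
  moreover have "(\<Union>i. sym_diff (A i) (B i)) \<in> null_sets (completion Q)" using B(2) by (rule null_sets_UN)
  ultimately have "sym_diff (\<Union>i. A i) (\<Union>i. B i) \<in> null_sets (completion Q)"
    by (rule null_sets_completion_subset)
  then show ?case using B(1) by (intro bexI[of _ "\<Union>i. B i"]) auto
qed

lemma augment_AE_sets:
  assumes G: "subalgebra Q G" and A: "A \<in> sets (augment Q G)" and sub: "B \<subseteq> space Q"
    and ae: "AE x in Q. x \<in> A \<longleftrightarrow> x \<in> B"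
  shows "B \<in> sets (augment Q G)"
proof -
  have A_sub: "A \<subseteq> space Q" using sets.sets_into_space[OF A] by simp
  obtain N where N: "N \<in> null_sets Q" "{x \<in> space Q. \<not> (x \<in> A \<longleftrightarrow> x \<in> B)} \<subseteq> N"
    using ae unfolding eventually_ae_filter by auto
  have 1: "A - B \<in> null_sets (completion Q)" "B - A \<in> null_sets (completion Q)"
    unfolding null_sets_completion_iff2 using N A_sub sub by (auto intro!: bexI[OF _ N(1)])
  have "B = (A - (A - B)) \<union> (B - A)" by auto
  also have "\<dots> \<in> sets (augment Q G)"
    by (intro sets.Un sets.Diff A sets_augment_null[OF G] 1)
  finally show ?thesis .
qed

lemma augment_AE_measurable:
  assumes G: "subalgebra Q G" and f: "f \<in> borel_measurable (augment Q G)" and ae: "AE x in Q. f x = g x"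
  shows "g \<in> borel_measurable (augment Q G)"
proof (rule measurableI)
  fix S :: "'b set" assume S: "S \<in> sets borel"
  show "g -` S \<inter> space (augment Q G) \<in> sets (augment Q G)"
    by (rule augment_AE_sets[OF G measurable_sets[OF f S]]) (use ae AE_space in \<open>auto elim!: eventually_elim2\<close>)
qed auto

text \<open>Each of the countably many sets where \<open>f\<close> lies below a rational is replaced
  by a set of \<open>G\<close>; off the union of the exceptional null sets, \<open>f\<close> is
  recovered as the infimum of the rationals above it.\<close>

lemma augment_version:
  fixes f :: "'a \<Rightarrow> real"
  assumes G: "subalgebra Q G" and f: "f \<in> borel_measurable (augment Q G)"
  shows "\<exists>f'\<in>borel_measurable G. AE x in Q. f x = f' x"
proof -
  have spG: "space G = space Q" using G by (simp add: subalgebra_def)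
  have "\<exists>B. \<forall>q. B q \<in> sets G \<and> sym_diff {x \<in> space Q. f x < of_rat q} (B q) \<in> null_sets (completion Q)"
  proof (rule choice, rule allI)
    fix q :: rat
    have "{x \<in> space (augment Q G). f x < of_rat q} \<in> sets (augment Q G)"
      using f by measurable
    from augment_mod_null[OF G this]
    show "\<exists>B. B \<in> sets G \<and> sym_diff {x \<in> space Q. f x < of_rat q} B \<in> null_sets (completion Q)"
      by (simp add: Bex_def)
  qed
  then obtain B where B: "\<And>q. B q \<in> sets G"
      "\<And>q. sym_diff {x \<in> space Q. f x < of_rat q} (B q) \<in> null_sets (completion Q)"
    by blast
  \<comment> \<open>The infimum is taken in the extended reals, so that it is measurable everywhere;
    on the null set where it is infinite the conversion to a real gives an arbitrary value.\<close>
  define f' where "f' x = real_of_ereal (INF q. if x \<in> B q then ereal (of_rat q) else \<infinity>)" for x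
  have "f' \<in> borel_measurable G"
    unfolding f'_def using B(1)
    by (intro borel_measurable_real_of_ereal borel_measurable_INF measurable_If_set) auto
  moreover have "AE x in Q. f x = f' x"
  proof -
    have "AE x in completion Q. \<forall>q. x \<notin> sym_diff {x \<in> space Q. f x < of_rat q} (B q)"
      by (intro AE_all_countable[THEN iffD2] allI AE_not_in B(2))
    then have "AE x in Q. \<forall>q. x \<notin> sym_diff {x \<in> space Q. f x < of_rat q} (B q)"
      unfolding AE_completion_iff .
    then show ?thesis
      using AE_space
    proof eventually_elim
      case (elim x)
      then have iff: "x \<in> B q \<longleftrightarrow> f x < of_rat q" for q by auto
      have "(INF q. if x \<in> B q then ereal (of_rat q) else \<infinity>) = ereal (f x)"
      proof (rule antisym)
        show "ereal (f x) \<le> (INF q. if x \<in> B q then ereal (of_rat q) else \<infinity>)"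
          by (rule INF_greatest) (auto simp: iff)
        show "(INF q. if x \<in> B q then ereal (of_rat q) else \<infinity>) \<le> ereal (f x)"
        proof (rule ereal_le_epsilon2)
          fix e :: real assume "e > 0"
          then have "f x < f x + e" by simp
          then obtain q where q: "f x < of_rat q" "of_rat q < f x + e" using of_rat_dense by blast
          have "(INF q. if x \<in> B q then ereal (of_rat q) else \<infinity>) \<le> (if x \<in> B q then ereal (of_rat q) else \<infinity>)"
            by (rule INF_lower) simp
          also have "\<dots> \<le> ereal (f x) + ereal e" using q by (simp add: iff)
          finally show "(INF q. if x \<in> B q then ereal (of_rat q) else \<infinity>) \<le> ereal (f x) + ereal e" .
        qed
      qed
      then show ?case by (simp add: f'_def)
    qed
  qed
  ultimately show ?thesis by blast
qed

text \<open>Null sets of the target are the only generators not covered by measurability of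
  \<open>f\<close>, and a completion-null set lies in a genuine one. The condition \<open>ac\<close>
  holds later because the law of the Brownian path is \<open>\<mu>\<close>.\<close>

lemma measurable_augment:
  assumes G: "subalgebra Q G" and G': "subalgebra Q' G'"
    and f: "f \<in> measurable G G'"
    and ac: "\<And>N. N \<in> null_sets Q' \<Longrightarrow> f -` N \<inter> space Q \<in> null_sets (completion Q)"
  shows "f \<in> measurable (augment Q G) (augment Q' G')"
proof -
  have sp: "space G = space Q" "space G' = space Q'" using G G' by (auto simp: subalgebra_def)
  have sub: "sets G' \<union> null_sets (completion Q') \<subseteq> Pow (space Q')"
    using sets.space_closed[of G'] sets.space_closed[of "completion Q'"] by (auto simp: null_sets_def sp)
  have fsp: "f \<in> space Q \<rightarrow> space Q'" using measurable_space[OF f] by (auto simp: sp)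
  show ?thesis
    unfolding augment_def[of Q']
  proof (rule measurable_measure_of[OF sub])
    fix A assume "A \<in> sets G' \<union> null_sets (completion Q')"
    then show "f -` A \<inter> space (augment Q G) \<in> sets (augment Q G)"
    proof
      assume "A \<in> sets G'"
      from sets_augment_base[OF G measurable_sets[OF f this]] show ?thesis by (simp only: sp space_augment)
    next
      assume "A \<in> null_sets (completion Q')"
      then obtain N where N: "N \<in> null_sets Q'" "A \<subseteq> N" by (auto simp: null_sets_completion_iff2)
      then have "f -` A \<inter> space Q \<subseteq> f -` N \<inter> space Q" by auto
      then have "f -` A \<inter> space Q \<in> null_sets (completion Q)"
        using ac[OF N(1)] null_sets_completion_subset by blast
      then show ?thesis using sets_augment_null[OF G] by simp
    qed
  qed (use fsp in simp)
qed

lemma subalgebra_process_sigma: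
  assumes "\<And>s. s \<in> J \<Longrightarrow> X s \<in> borel_measurable Q"
  shows "subalgebra Q (process_sigma (space Q) J X)"
  unfolding subalgebra_def
proof
  show "sets (process_sigma (space Q) J X) \<subseteq> sets Q"
    unfolding sets_process_sigma using assms
    by (intro sets.sigma_sets_subset) (auto intro: measurable_sets)
qed simp

lemma subalgebra_canonical_filtration:
  assumes T: "time_scale T" and Q: "sets Q = sets (path_borel T)"
  shows "subalgebra Q (canonical_filtration T t)"
proof -
  have sp: "space Q = path_space T" using sets_eq_imp_space_eq[OF Q] by simp
  show ?thesis
    unfolding canonical_filtration_def sp[symmetric]
    by (rule subalgebra_process_sigma) (use path_borel_coordinate[OF T] measurable_cong_sets[OF Q] in auto)
qed

lemma space_canonical_filtration [simp]: "space (canonical_filtration T t) = path_space T"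
  by (simp add: canonical_filtration_def)

lemma measurable_into_canonical_filtration:
  assumes "\<And>x. x \<in> space N \<Longrightarrow> f x \<in> path_space T"
    and "\<And>s. s \<in> T \<Longrightarrow> 0 \<le> s \<Longrightarrow> s \<le> t \<Longrightarrow> (\<lambda>x. f x s) \<in> borel_measurable N"
  shows "f \<in> measurable N (canonical_filtration T t)"
  unfolding canonical_filtration_def
  using assms by (intro measurable_into_process_sigma[where X="\<lambda>s \<omega>. \<omega> s"]) auto

lemma canonical_filtration_coordinate:
  "s \<in> T \<Longrightarrow> 0 \<le> s \<Longrightarrow> s \<le> t \<Longrightarrow> (\<lambda>\<omega>. \<omega> s) \<in> borel_measurable (canonical_filtration T t)"
  unfolding canonical_filtration_def
  using measurable_process_sigma_component[of s "{0..t} \<inter> T" "\<lambda>s \<omega>. \<omega> s"] by simp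

lemma sets_canonical_filtration_mono:
  "s \<le> t \<Longrightarrow> sets (canonical_filtration T s) \<subseteq> sets (canonical_filtration T t)"
  unfolding canonical_filtration_def by (intro process_sigma_mono) auto

text \<open>For \<open>t\<close> in \<open>T\<close> the time \<open>min s t\<close> stays in
  \<open>T\<close>, so the stopped path is again a path. Stopping depends on the values up to
  \<open>t\<close> only, yet has values in the full path space, where jointly measurable functions
  can be evaluated.\<close>

definition stop_path :: "real set \<Rightarrow> real \<Rightarrow> (real \<Rightarrow> real) \<Rightarrow> real \<Rightarrow> real" where
  "stop_path T t \<omega> = (\<lambda>s\<in>T. \<omega> (min s t))"

lemma stop_path_in_path_space:
  assumes T: "time_scale T" and t: "t \<in> T" and \<omega>: "\<omega> \<in> path_space T"
  shows "stop_path T t \<omega> \<in> path_space T"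
proof -
  have "min s t \<in> T" if "s \<in> T" for s using that t by (simp add: min_def)
  moreover have "min 0 t = 0" using t time_scaleD(5)[OF T] by (auto simp: min_def)
  moreover have "continuous_on T (\<lambda>s. \<omega> (min s t))"
    using \<omega> t by (intro continuous_on_compose2[of T \<omega> T "\<lambda>s. min s t"] continuous_intros)
      (auto simp: path_space_iff[OF T] min_def)
  then have "continuous_on T (stop_path T t \<omega>)"
    by (rule continuous_on_eq) (simp add: stop_path_def)
  ultimately show ?thesis
    using \<omega> time_scaleD(3)[OF T] by (auto simp: path_space_iff[OF T] stop_path_def)
qed

lemma measurable_stop_path:
  assumes T: "time_scale T" and t: "t \<in> T"
  shows "stop_path T t \<in> measurable (canonical_filtration T t) (path_borel T)"
proof (rule measurable_into_path_borel[OF T])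
  fix s assume s: "s \<in> T"
  then have "min s t \<in> T" "0 \<le> min s t" "min s t \<le> t" using t time_scaleD(5)[OF T] by (auto simp: min_def)
  from canonical_filtration_coordinate[OF this]
  show "(\<lambda>\<omega>. stop_path T t \<omega> s) \<in> borel_measurable (canonical_filtration T t)"
    using s by (simp add: stop_path_def)
qed (simp add: stop_path_in_path_space[OF T t])

text \<open>The path and its stopped version agree on all coordinates up to \<open>s\<close>, and
  \<open>f\<close> cannot separate such paths.\<close>

lemma canonical_filtration_stop:
  fixes f :: "(real \<Rightarrow> real) \<Rightarrow> real"
  assumes T: "time_scale T" and t: "t \<in> T" "s \<le> t"
    and f: "f \<in> borel_measurable (canonical_filtration T s)" and \<omega>: "\<omega> \<in> path_space T"
  shows "f (stop_path T t \<omega>) = f \<omega>"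
  by (rule process_sigma_measurable_imp_coordinates[OF f[unfolded canonical_filtration_def]])
     (use stop_path_in_path_space[OF T t(1) \<omega>] \<omega> t in \<open>auto simp: stop_path_def min_def\<close>)

section \<open>The measure of a time scale\<close>

lemma rho_props:
  assumes T: "time_scale T" and s: "s \<in> {0..1}"
  shows "rho T s \<in> T" "rho T s \<le> s" "\<And>t. t \<in> T \<Longrightarrow> t < s \<Longrightarrow> t \<le> rho T s"
proof -
  note TD = time_scaleD[OF T]
  have pos: "rho T s \<in> T \<and> rho T s \<le> s \<and> (\<forall>t\<in>T. t < s \<longrightarrow> t \<le> rho T s)" if "s > 0"
  proof -
    have ne: "{u \<in> T. u < s} \<noteq> {}" and bdd: "bdd_above {u \<in> T. u < s}"
      using TD(3) that by (auto intro!: bdd_aboveI[of _ s])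
    have "Sup {u \<in> T. u < s} \<in> closure {u \<in> T. u < s}" by (rule closure_contains_Sup[OF ne bdd])
    also have "\<dots> \<subseteq> T" using TD(1) by (intro closure_minimal) auto
    finally have "Sup {u \<in> T. u < s} \<in> T" .
    moreover have "Sup {u \<in> T. u < s} \<le> s" using ne by (intro cSup_least) auto
    moreover have "t \<le> Sup {u \<in> T. u < s}" if "t \<in> T" "t < s" for t
      using that bdd by (intro cSup_upper) auto
    ultimately show ?thesis using that by (auto simp: rho_def)
  qed
  have zero: "rho T 0 = 0" by (simp add: rho_def)
  show "rho T s \<in> T" "rho T s \<le> s" "\<And>t. t \<in> T \<Longrightarrow> t < s \<Longrightarrow> t \<le> rho T s"
    using pos zero TD(3,5) s by (cases "s = 0"; force)+
qed

abbreviation unit_lebesgue :: "real measure" where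
  "unit_lebesgue \<equiv> restrict_space lborel {0..1}"

lemma prob_space_unit_lebesgue: "prob_space unit_lebesgue"
proof (rule prob_spaceI)
  show "emeasure unit_lebesgue (space unit_lebesgue) = 1"
    by (simp add: emeasure_restrict_space space_restrict_space)
qed

lemma measurable_rho:
  assumes T: "time_scale T"
  shows "rho T \<in> measurable unit_lebesgue (restrict_space borel T)"
proof (rule measurable_restrict_space2)
  show "rho T \<in> space unit_lebesgue \<rightarrow> T"
    using rho_props(1)[OF T] by (auto simp: space_restrict_space)
  have "mono_on {0..1} (rho T)"
  proof (rule mono_onI)
    fix r s :: real assume rs: "r \<in> {0..1}" "s \<in> {0..1}" "r \<le> s"
    show "rho T r \<le> rho T s"
    proof (cases "rho T r < s")
      case True
      then show ?thesis using rho_props[OF T] rs by auto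
    next
      case False
      then have "rho T r = s" "r = s" using rho_props(2)[OF T rs(1)] rs by auto
      then show ?thesis by simp
    qed
  qed
  then have "rho T \<in> borel_measurable (restrict_space borel {0..1})" by (rule borel_measurable_mono_on_fnc)
  then show "rho T \<in> borel_measurable unit_lebesgue"
    by (simp cong: measurable_cong_sets add: measurable_cong_sets[OF sets_restrict_space_cong[OF sets_lborel] refl])
qed

lemma sets_lambda_Delta [measurable_cong]: "sets (lambda_Delta T) = sets (restrict_space borel T)"
  and space_lambda_Delta: "space (lambda_Delta T) = T"
  unfolding lambda_Delta_def by (simp_all only: sets_distr space_distr space_restrict_space space_borel Int_UNIV_right)

lemma prob_space_lambda_Delta: "time_scale T \<Longrightarrow> prob_space (lambda_Delta T)"
  unfolding lambda_Delta_def
  by (rule prob_space.prob_space_distr[OF prob_space_unit_lebesgue measurable_rho])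

text \<open>Only \<open>s = t\<close> is in doubt, where the value of \<open>rho T t\<close> depends
  on whether \<open>T\<close> has a gap just before \<open>t\<close>; a single point is
  Lebesgue-null.\<close>

lemma AE_rho_less:
  assumes T: "time_scale T" and t: "t \<in> T"
  shows "AE s in unit_lebesgue. rho T s < t \<longleftrightarrow> s \<le> t"
proof -
  have "AE s in lborel. s \<noteq> t" by (rule AE_lborel_singleton)
  then have "AE s in unit_lebesgue. s \<noteq> t" by (subst AE_restrict_space_iff) auto
  moreover have "AE s in unit_lebesgue. s \<in> {0..1}"
    by (rule AE_I2) (simp add: space_restrict_space)
  ultimately show ?thesis
  proof eventually_elim
    case (elim s)
    then show ?case using rho_props[OF T elim(2)] t by (cases "s < t") force+
  qed
qed

text \<open>Pulled back by \<open>rho T\<close>, the half-open interval of \<open>T\<close> becomes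
  [0,t] up to one point. The right-hand side makes sense also for \<open>t\<close> outside
  \<open>T\<close>, which provides the extension of primitives to [0,1].\<close>

lemma set_integral_lambda_Delta:
  fixes g :: "real \<Rightarrow> real"
  assumes T: "time_scale T" and t: "t \<in> T" and g: "g \<in> borel_measurable (restrict_space borel T)"
  shows "(LINT s:{0..<t} \<inter> T|lambda_Delta T. g s) = (LINT s:{0..t}|lborel. g (rho T s))"
proof -
  note TD = time_scaleD[OF T]
  have t01: "0 \<le> t" "t \<le> 1" using t TD(5) by auto
  note m = measurable_rho[OF T]
  have A: "{0..<t} \<inter> T \<in> sets (restrict_space borel T)"
    by (auto simp: sets_restrict_space)
  have "(LINT s:{0..<t} \<inter> T|lambda_Delta T. g s) = (\<integral>s. indicator ({0..<t} \<inter> T) (rho T s) * g (rho T s) \<partial>unit_lebesgue)"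
    unfolding lambda_Delta_def set_lebesgue_integral_def
    using A g by (subst integral_distr[OF m]) auto
  also have "\<dots> = (\<integral>s. indicator {0..t} s * g (rho T s) \<partial>unit_lebesgue)"
  proof (rule integral_cong_AE)
    have gm: "(\<lambda>s. g (rho T s)) \<in> borel_measurable unit_lebesgue" using measurable_compose[OF m g] .
    have im: "(\<lambda>s. indicator ({0..<t} \<inter> T) (rho T s) :: real) \<in> borel_measurable unit_lebesgue"
      by (rule measurable_compose[OF m borel_measurable_indicator[OF A]])
    show "(\<lambda>s. indicator ({0..<t} \<inter> T) (rho T s) * g (rho T s)) \<in> borel_measurable unit_lebesgue"
      by (rule borel_measurable_times[OF im gm])
    have im2: "(\<lambda>s. indicator {0..t} s :: real) \<in> borel_measurable unit_lebesgue"
      by (rule measurable_restrict_space1) auto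
    show "(\<lambda>s. indicator {0..t} s * g (rho T s)) \<in> borel_measurable unit_lebesgue"
      by (rule borel_measurable_times[OF im2 gm])
    have "AE s in unit_lebesgue. s \<in> {0..1}"
      by (rule AE_I2) (simp add: space_restrict_space)
    with AE_rho_less[OF T t]
    show "AE s in unit_lebesgue. indicator ({0..<t} \<inter> T) (rho T s) * g (rho T s) = indicator {0..t} s * g (rho T s)"
    proof eventually_elim
      case (elim s)
      then show ?case using rho_props(1)[OF T elim(2)] TD(5) by (auto simp: indicator_def)
    qed
  qed
  also have "\<dots> = (\<integral>s. indicator {0..1} s * (indicator {0..t} s * g (rho T s)) \<partial>lborel)"
    by (subst integral_restrict_space) auto
  also have "\<dots> = (LINT s:{0..t}|lborel. g (rho T s))"
    unfolding set_lebesgue_integral_def using t01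
    by (intro Bochner_Integration.integral_cong) (auto simp: indicator_def)
  finally show ?thesis .
qed

text \<open>The integral of the difference vanishes on the intervals [0,t) of \<open>T\<close>, an
  intersection-stable generator once \<open>T\<close> itself is added, hence on all Borel sets of
  \<open>T\<close>.\<close>

lemma delta_derivative_unique:
  assumes T: "time_scale T" and g: "has_delta_derivative T h g" and k: "has_delta_derivative T h k"
  shows "AE s in lambda_Delta T. g s = k s"
proof -
  interpret prob_space "lambda_Delta T" using T by (rule prob_space_lambda_Delta)
  note TD = time_scaleD[OF T]
  have int: "integrable (lambda_Delta T) f" if "has_delta_derivative T h f" for f
  proof -
    have "f \<in> borel_measurable (lambda_Delta T)" "integrable (lambda_Delta T) (\<lambda>s. (f s)\<^sup>2)"
      using that by (auto simp: has_delta_derivative_def)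
    then show ?thesis by (rule square_integrable_imp_integrable)
  qed
  note ig = int[OF g] and ik = int[OF k]
  have si: "set_integrable (lambda_Delta T) A f" if "A \<in> sets (lambda_Delta T)" "integrable (lambda_Delta T) f"
    for A and f :: "real \<Rightarrow> real"
    unfolding set_integrable_def using that by (rule integrable_mult_indicator)
  define d where "d s = g s - k s" for s
  have id: "integrable (lambda_Delta T) d" unfolding d_def using ig ik by simp
  \<comment> \<open>No interval with \<open>t\<close> in \<open>T\<close> contains the point 1. The
    whole set is therefore added; it represents half-lines beyond \<open>T\<close> and starts the
    argument for complements.\<close>
  define G where "G = {{0..<t} \<inter> T | t. t \<in> T} \<union> {T}"
  have G_sub: "G \<subseteq> Pow T" by (auto simp: G_def)
  have G_sets: "sets (lambda_Delta T) = sigma_sets T G"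
  proof -
    have "sigma_sets T G = sets (restrict_space borel T)"
    proof (rule antisym)
      have sp: "space (restrict_space borel T) = T" by (simp add: space_restrict_space)
      have "G \<subseteq> sets (restrict_space borel T)"
        using sets.top[of "restrict_space borel T"] by (auto simp: G_def sets_restrict_space)
      then show "sigma_sets T G \<subseteq> sets (restrict_space borel T)"
        using sets.sigma_sets_subset[of G "restrict_space borel T"] by (simp add: sp)
      define S where "S = sigma T G"
      have S: "sets S = sigma_sets T G" "space S = T"
        using G_sub by (auto simp: S_def sets_measure_of space_measure_of_conv)
      have "{s \<in> T. s < c} \<in> sigma_sets T G" for c
      proof (cases "{u \<in> T. c \<le> u} = {}")
        case True
        then have "{s \<in> T. s < c} = T" by force
        then show ?thesis by (auto simp: G_def)
      next
        case False
        \<comment> \<open>The bound \<open>c\<close> need not belong to \<open>T\<close>; the next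
          point of \<open>T\<close> cuts off the same part of \<open>T\<close>.\<close>
        define t where "t = Inf {u \<in> T. c \<le> u}"
        have bdd: "bdd_below {u \<in> T. c \<le> u}" by (auto intro!: bdd_belowI[of _ c])
        have "t \<in> closure {u \<in> T. c \<le> u}" unfolding t_def by (rule closure_contains_Inf[OF False bdd])
        moreover have "closed {u \<in> T. c \<le> u}"
          using closed_Int[OF TD(1) closed_atLeast[of c]] by (simp add: Int_def)
        ultimately have t: "t \<in> T" "c \<le> t" by auto
        have "s < t \<longleftrightarrow> s < c" if "s \<in> T" for s
        proof
          assume "s < t"
          show "s < c"
          proof (rule ccontr)
            assume "\<not> s < c"
            then have "t \<le> s" unfolding t_def using that bdd by (intro cInf_lower) auto
            then show False using \<open>s < t\<close> by simp
          qed
        qed (use t in simp)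
        then have "{s \<in> T. s < c} = {0..<t} \<inter> T" using TD(5) by auto
        then show ?thesis using t(1) by (auto simp: G_def)
      qed
      then have "(\<lambda>s. s) \<in> borel_measurable S"
        unfolding borel_measurable_iff_less S by (auto simp: S)
      then have "(\<lambda>s. s) \<in> measurable S (restrict_space borel T)"
        by (intro measurable_restrict_space2) (auto simp: S)
      then show "sets (restrict_space borel T) \<subseteq> sigma_sets T G"
      proof (intro subsetI)
        fix A assume A: "A \<in> sets (restrict_space borel T)"
        then have "A \<subseteq> T" using sets.sets_into_space[OF A] by (simp add: space_restrict_space)
        then have "(\<lambda>s. s) -` A \<inter> space S = A" by (auto simp: S)
        with measurable_sets[OF \<open>(\<lambda>s. s) \<in> measurable S (restrict_space borel T)\<close> A]
        show "A \<in> sigma_sets T G" by (simp add: S)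
      qed
    qed
    then show ?thesis by (simp add: sets_lambda_Delta)
  qed
  have "Int_stable G"
  proof (rule Int_stableI)
    fix A B assume "A \<in> G" "B \<in> G"
    then consider "A = T" | "B = T" | t t' where "t \<in> T" "t' \<in> T" "A = {0..<t} \<inter> T" "B = {0..<t'} \<inter> T"
      by (auto simp: G_def)
    then show "A \<inter> B \<in> G"
    proof cases
      case 3
      then have "A \<inter> B = {0..<min t t'} \<inter> T" by auto
      moreover have "min t t' \<in> T" using 3 by (simp add: min_def)
      ultimately show ?thesis by (auto simp: G_def)
    qed (use \<open>A \<in> G\<close> \<open>B \<in> G\<close> G_sub in \<open>auto simp: Int_absorb1 Int_absorb2\<close>)
  qed
  have base: "(LINT s:{0..<t} \<inter> T|lambda_Delta T. d s) = 0" if "t \<in> T" for t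
  proof -
    have A: "{0..<t} \<inter> T \<in> sets (lambda_Delta T)" using that by (subst G_sets) (auto simp: G_def)
    have "(LINT s:{0..<t} \<inter> T|lambda_Delta T. d s) = (LINT s:{0..<t} \<inter> T|lambda_Delta T. g s) - (LINT s:{0..<t} \<inter> T|lambda_Delta T. k s)"
      unfolding d_def using ig ik A by (intro set_integral_diff si)
    also have "\<dots> = 0" using g k that by (simp add: has_delta_derivative_def)
    finally show ?thesis .
  qed
  \<comment> \<open>\<open>T\<close> and [0,1) in \<open>T\<close> differ by the point 1, which has
    no mass because \<open>rho T s < 1\<close> for almost every \<open>s\<close>.\<close>
  have whole: "(LINT s:T|lambda_Delta T. d s) = 0"
  proof -
    have 1: "AE s in unit_lebesgue. s \<noteq> 1"
      by (subst AE_restrict_space_iff) (use AE_lborel_singleton[of "1::real"] in auto)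
    have 2: "AE s in unit_lebesgue. rho T s < 1 \<longleftrightarrow> s \<le> 1" by (rule AE_rho_less[OF T TD(4)])
    have "AE s in unit_lebesgue. rho T s \<in> {0..<1} \<inter> T"
      using 2 AE_space
    proof eventually_elim
      case (elim s)
      then show ?case using rho_props(1)[OF T, of s] TD(5) by (auto simp: space_restrict_space)
    qed
    then have ae1: "AE s in lambda_Delta T. s \<in> {0..<1} \<inter> T"
      unfolding lambda_Delta_def
      by (subst AE_distr_iff[OF measurable_rho[OF T]])
         (use TD in \<open>auto simp: sets_restrict_space space_restrict_space intro!: image_eqI[of _ _ "{0..<1}"]\<close>)
    have "(LINT s:T|lambda_Delta T. d s) = (LINT s:{0..<1} \<inter> T|lambda_Delta T. d s)"
      unfolding set_lebesgue_integral_def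
    proof (intro integral_cong_AE)
      have TG: "T \<in> sets (lambda_Delta T)" "{0..<1} \<inter> T \<in> sets (lambda_Delta T)"
        unfolding G_sets using TD(4) by (auto simp: G_def)
      show "(\<lambda>s. indicator T s *\<^sub>R d s) \<in> borel_measurable (lambda_Delta T)"
        "(\<lambda>s. indicator ({0..<1} \<inter> T) s *\<^sub>R d s) \<in> borel_measurable (lambda_Delta T)"
        using borel_measurable_integrable[OF si[OF TG(1) id, unfolded set_integrable_def]]
          borel_measurable_integrable[OF si[OF TG(2) id, unfolded set_integrable_def]] by auto
      show "AE s in lambda_Delta T. indicator T s *\<^sub>R d s = indicator ({0..<1} \<inter> T) s *\<^sub>R d s"
        using ae1 by eventually_elim simp
    qed
    then show ?thesis using base[OF TD(4)] by simp
  qed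
  have zero: "(LINT s:A|lambda_Delta T. d s) = 0" if A: "A \<in> sets (lambda_Delta T)" for A
    using \<open>Int_stable G\<close> G_sub A[unfolded G_sets]
  proof (induction rule: sigma_sets_induct_disjoint)
    case (basic A)
    then show ?case using base whole by (auto simp: G_def)
  next
    case empty
    show ?case by (simp add: set_lebesgue_integral_def)
  next
    case (compl A)
    then have A: "A \<in> sets (lambda_Delta T)" by (simp add: G_sets)
    have TT: "T \<in> sets (lambda_Delta T)" using sets.top[of "lambda_Delta T"] by (simp add: space_lambda_Delta)
    have "A \<subseteq> T" using sets.sets_into_space[OF A] by (simp add: space_lambda_Delta)
    then have "A \<union> (T - A) = T" by auto
    then have "(LINT s:T|lambda_Delta T. d s) = (LINT s:A|lambda_Delta T. d s) + (LINT s:T - A|lambda_Delta T. d s)"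
      using set_integral_Un[OF _ si[OF A id] si[OF sets.Diff[OF TT A] id]] by simp
    then show ?case using whole compl.IH by simp
  next
    case (union A)
    then have A: "A i \<in> sets (lambda_Delta T)" for i by (auto simp: G_sets)
    have "(LINT s:(\<Union>i. A i)|lambda_Delta T. d s) = (\<Sum>i. LINT s:A i|lambda_Delta T. d s)"
    proof (rule lebesgue_integral_countable_add)
      show "set_integrable (lambda_Delta T) (\<Union> (range A)) d" using A by (intro si id) auto
    qed (use A union.hyps in \<open>auto simp: disjoint_family_on_def\<close>)
    then show ?case using union.IH by simp
  qed
  then have "AE s in lambda_Delta T. d s = 0"
    using id zero by (intro density_unique_real) auto
  then show ?thesis by (simp add: d_def)
qed

text \<open>\<open>rho T\<close> is constantly \<open>t\<close> on the gap after \<open>t\<close>,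
  so the point carries at least the length of the gap.\<close>

lemma right_scattered_atom:
  assumes T: "time_scale T" and t: "t \<in> right_scattered T"
  shows "emeasure (lambda_Delta T) {t} > 0"
proof -
  note TD = time_scaleD[OF T]
  define u where "u = Inf {u \<in> T. u > t}"
  have tT: "t \<in> T" and t1: "t < 1" and tu: "t < u"
    using t TD(5) unfolding right_scattered_def u_def by force+
  have t0: "0 \<le> t" using tT TD(5) by auto
  have bdd: "bdd_below {u \<in> T. u > t}" by (auto intro!: bdd_belowI[of _ t])
  have "u \<le> 1" unfolding u_def using TD(4) t1 bdd by (intro cInf_lower) auto
  have rho: "rho T s = t" if "s \<in> {t<..<u}" for s
  proof -
    have s01: "s \<in> {0..1}" using that t0 \<open>u \<le> 1\<close> by auto
    have "\<not> t < rho T s"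
    proof
      assume "t < rho T s"
      then have "u \<le> rho T s" unfolding u_def using bdd rho_props(1)[OF T s01] by (intro cInf_lower) auto
      then show False using rho_props(2)[OF T s01] that by auto
    qed
    then show ?thesis using rho_props(3)[OF T s01 tT] that by auto
  qed
  have "{t} \<in> sets (restrict_space borel T)"
    using tT by (auto simp: sets_restrict_space intro!: image_eqI[of _ _ "{t}"])
  then have "emeasure (lambda_Delta T) {t} = emeasure unit_lebesgue (rho T -` {t} \<inter> space unit_lebesgue)"
    unfolding lambda_Delta_def by (rule emeasure_distr[OF measurable_rho[OF T]])
  moreover have "emeasure unit_lebesgue {t<..<u} \<le> emeasure unit_lebesgue (rho T -` {t} \<inter> space unit_lebesgue)"
  proof (rule emeasure_mono)
    show "{t<..<u} \<subseteq> rho T -` {t} \<inter> space unit_lebesgue"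
      using rho t0 \<open>u \<le> 1\<close> by (auto simp: space_restrict_space)
    show "rho T -` {t} \<inter> space unit_lebesgue \<in> sets unit_lebesgue"
      using \<open>{t} \<in> _\<close> by (rule measurable_sets[OF measurable_rho[OF T]])
  qed
  moreover have "emeasure unit_lebesgue {t<..<u} = ennreal (u - t)"
    using t0 \<open>u \<le> 1\<close> tu by (subst emeasure_restrict_space) auto
  ultimately have "ennreal (u - t) \<le> emeasure (lambda_Delta T) {t}" by simp
  moreover have "0 < ennreal (u - t)" using tu by simp
  ultimately show ?thesis by (rule order_less_le_trans[rotated])
qed

text \<open>An atom lies in no null set. In particular the value of a chosen derivative at a
  right-scattered point is the value of any known derivative.\<close>

lemma AE_lambda_Delta_right_scattered:
  assumes "time_scale T" "AE s in lambda_Delta T. P s" "t \<in> right_scattered T"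
  shows "P t"
proof (rule ccontr)
  assume "\<not> P t"
  have tT: "t \<in> T" using assms(3) by (auto simp: right_scattered_def)
  obtain N where N: "N \<in> null_sets (lambda_Delta T)" "{s \<in> space (lambda_Delta T). \<not> P s} \<subseteq> N"
    using assms(2) unfolding eventually_ae_filter by auto
  then have "{t} \<subseteq> N" using \<open>\<not> P t\<close> tT by (auto simp: space_lambda_Delta)
  then have "emeasure (lambda_Delta T) {t} \<le> emeasure (lambda_Delta T) N"
    using N(1) by (intro emeasure_mono) auto
  then show False using N(1) right_scattered_atom[OF assms(1,3)] by auto
qed

section \<open>A variational principle\<close>

text \<open>A descending sequence is built by choosing nearly lowest points in shrinking sets
  \<open>S\<close>; the drops of \<open>\<phi>\<close> bound its total length, so it converges. The
  limit lies in all these sets and nothing in its own set is lower. The conclusion is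
  \<open>d x y = 0\<close> because the distance of densities does not separate versions.\<close>

lemma ekeland_minimal:
  fixes d :: "'a \<Rightarrow> 'a \<Rightarrow> real" and \<phi> :: "'a \<Rightarrow> real"
  assumes ne: "x0 \<in> A"
    and nonneg: "\<And>x. x \<in> A \<Longrightarrow> 0 \<le> \<phi> x"
    and d_nonneg: "\<And>x y. x \<in> A \<Longrightarrow> y \<in> A \<Longrightarrow> 0 \<le> d x y"
    and refl: "\<And>x. x \<in> A \<Longrightarrow> d x x = 0"
    and tri: "\<And>x y z. x \<in> A \<Longrightarrow> y \<in> A \<Longrightarrow> z \<in> A \<Longrightarrow> d x z \<le> d x y + d y z"
    and comp: "\<And>X. (\<And>n::nat. X n \<in> A) \<Longrightarrow> summable (\<lambda>n. d (X n) (X (Suc n))) \<Longrightarrow>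
      \<exists>x\<in>A. (\<lambda>n. d (X n) x) \<longlonglongrightarrow> 0"
    and cont: "\<And>X x. (\<And>n::nat. X n \<in> A) \<Longrightarrow> x \<in> A \<Longrightarrow> (\<lambda>n. d (X n) x) \<longlonglongrightarrow> 0 \<Longrightarrow> (\<lambda>n. \<phi> (X n)) \<longlonglongrightarrow> \<phi> x"
  shows "\<exists>x\<in>A. \<forall>y\<in>A. d x y \<le> \<phi> x - \<phi> y \<longrightarrow> d x y = 0"
proof -
  \<comment> \<open>The points whose decrease of \<open>\<phi>\<close> pays for the distance from
    \<open>x\<close>; by the triangle inequality this is a transitive relation.\<close>
  define S where "S x = {y \<in> A. d x y \<le> \<phi> x - \<phi> y}" for x
  have S_refl: "x \<in> S x" if "x \<in> A" for x using that refl by (simp add: S_def)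
  have bdd: "bdd_below (\<phi> ` S x)" for x
    by (rule bdd_belowI[of _ 0]) (auto simp: S_def intro: nonneg)
  have step: "\<exists>y\<in>S x. \<phi> y \<le> Inf (\<phi> ` S x) + (1 / 2) ^ n" if x: "x \<in> A" for x and n :: nat
  proof -
    have "\<phi> ` S x \<noteq> {}" using S_refl[OF x] by auto
    from cInf_lessD[OF this, of "Inf (\<phi> ` S x) + (1 / 2) ^ n"]
    obtain z where "z \<in> \<phi> ` S x" "z < Inf (\<phi> ` S x) + (1 / 2) ^ n" by auto
    then obtain y where "y \<in> S x" "\<phi> y < Inf (\<phi> ` S x) + (1 / 2) ^ n" by blast
    then show ?thesis by (intro bexI[of _ y]) simp_all
  qed
  \<comment> \<open>The infimum over \<open>S x\<close> need not be attained; the slack only has to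
    tend to 0 with \<open>n\<close>.\<close>
  define p where "p n x = (SOME y. y \<in> S x \<and> \<phi> y \<le> Inf (\<phi> ` S x) + (1 / 2) ^ n)" for n x
  have p: "p n x \<in> S x \<and> \<phi> (p n x) \<le> Inf (\<phi> ` S x) + (1 / 2) ^ n" if "x \<in> A" for n x
    unfolding p_def by (rule someI_ex) (use step[OF that] in blast)
  define X where "X = rec_nat x0 p"
  have X_Suc: "X (Suc n) = p n (X n)" for n by (simp add: X_def)
  have XA: "X n \<in> A" for n
  proof (induction n)
    case 0
    then show ?case using ne by (simp add: X_def)
  next
    case (Suc n)
    then show ?case using p[of "X n" n] by (simp add: X_Suc S_def)
  qed
  have XS: "d (X n) (X (Suc n)) \<le> \<phi> (X n) - \<phi> (X (Suc n))" for n
    using p[OF XA, of n n] by (simp add: X_Suc S_def)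
  have inf: "\<phi> (X (Suc n)) - (1 / 2) ^ n \<le> \<phi> y" if "y \<in> S (X n)" for n y
  proof -
    have "Inf (\<phi> ` S (X n)) \<le> \<phi> y" using that bdd by (intro cInf_lower) auto
    then show ?thesis using p[OF XA, of n n] by (simp add: X_Suc)
  qed
  have "summable (\<lambda>n. d (X n) (X (Suc n)))"
  proof (rule summableI_nonneg_bounded)
    show "0 \<le> d (X n) (X (Suc n))" for n by (rule d_nonneg[OF XA XA])
    have "(\<Sum>i<n. d (X i) (X (Suc i))) \<le> \<phi> (X 0) - \<phi> (X n)" for n
    proof (induction n)
      case (Suc n)
      then show ?case using XS[of n] by simp
    qed simp
    then show "(\<Sum>i<n. d (X i) (X (Suc i))) \<le> \<phi> (X 0)" for n
      using nonneg[OF XA[of n]] by (smt (verit))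
  qed
  from comp[OF XA this] obtain x where x: "x \<in> A" "(\<lambda>n. d (X n) x) \<longlonglongrightarrow> 0" by blast
  have \<phi>lim: "(\<lambda>n. \<phi> (X n)) \<longlonglongrightarrow> \<phi> x" by (rule cont[OF XA x])
  have far: "d (X n) (X (n + k)) \<le> \<phi> (X n) - \<phi> (X (n + k))" for n k
  proof (induction k)
    case 0
    show ?case using refl[OF XA] by simp
  next
    case (Suc k)
    have "d (X n) (X (n + Suc k)) \<le> d (X n) (X (n + k)) + d (X (n + k)) (X (Suc (n + k)))"
      using tri[OF XA XA XA] by simp
    then show ?case using Suc XS[of "n + k"] by simp
  qed
  have xS: "d (X n) x \<le> \<phi> (X n) - \<phi> x" for n
  proof (rule LIMSEQ_le_const)
    show "(\<lambda>k. \<phi> (X n) - \<phi> (X (k + n)) + d (X (k + n)) x) \<longlonglongrightarrow> \<phi> (X n) - \<phi> x"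
      using tendsto_add[OF tendsto_diff[OF tendsto_const[of "\<phi> (X n)"] LIMSEQ_ignore_initial_segment[OF \<phi>lim, of n]]
          LIMSEQ_ignore_initial_segment[OF x(2), of n]] by simp
    show "\<exists>N. \<forall>k\<ge>N. d (X n) x \<le> \<phi> (X n) - \<phi> (X (k + n)) + d (X (k + n)) x"
    proof (intro exI allI impI)
      fix k
      show "d (X n) x \<le> \<phi> (X n) - \<phi> (X (k + n)) + d (X (k + n)) x"
        using tri[OF XA XA x(1), of n "k + n"] far[of n k] by (simp add: add.commute)
    qed
  qed
  have "d x y = 0" if y: "y \<in> A" "d x y \<le> \<phi> x - \<phi> y" for y
  proof -
    \<comment> \<open>A point dominated by the limit is dominated by every \<open>X n\<close>, so
      \<open>\<phi> y\<close> is bounded below by nearly minimal values that tend to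
      \<open>\<phi> x\<close>.\<close>
    have "y \<in> S (X n)" for n
      using tri[OF XA x(1) y(1), of n] xS[of n] y by (simp add: S_def)
    then have "\<phi> (X (Suc n)) - (1 / 2) ^ n \<le> \<phi> y" for n by (rule inf)
    moreover have "(\<lambda>n. \<phi> (X (Suc n)) - (1 / 2) ^ n) \<longlonglongrightarrow> \<phi> x - 0"
      by (intro tendsto_diff LIMSEQ_Suc[OF \<phi>lim] LIMSEQ_power_zero) simp
    ultimately have "\<phi> x - 0 \<le> \<phi> y" by (intro LIMSEQ_le_const2[of _ "\<phi> x - 0" "\<phi> y"]) auto
    then show ?thesis using y d_nonneg[OF x(1) y(1)] by simp
  qed
  with x(1) show ?thesis by blast
qed

section \<open>Mean-square distance\<close>

definition l2_norm :: "'a measure \<Rightarrow> ('a \<Rightarrow> real) \<Rightarrow> real" where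
  "l2_norm M f = sqrt (\<integral>x. (f x)\<^sup>2 \<partial>M)"

text \<open>All densities that occur are bounded and all measures are probabilities, so in this
  class products and squares are integrable without further conditions.\<close>

definition bdd_meas :: "'a measure \<Rightarrow> ('a \<Rightarrow> real) \<Rightarrow> bool" where
  "bdd_meas M f \<longleftrightarrow> f \<in> borel_measurable M \<and> (\<exists>C. \<forall>x\<in>space M. \<bar>f x\<bar> \<le> C)"

lemma bdd_measI: "f \<in> borel_measurable M \<Longrightarrow> (\<And>x. x \<in> space M \<Longrightarrow> \<bar>f x\<bar> \<le> C) \<Longrightarrow> bdd_meas M f"
  by (auto simp: bdd_meas_def)

lemma bdd_measE:
  assumes "bdd_meas M f"
  obtains C where "f \<in> borel_measurable M" "0 \<le> C" "\<And>x. x \<in> space M \<Longrightarrow> \<bar>f x\<bar> \<le> C"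
proof -
  from assms obtain C where C: "f \<in> borel_measurable M" "\<And>x. x \<in> space M \<Longrightarrow> \<bar>f x\<bar> \<le> C"
    by (auto simp: bdd_meas_def)
  show ?thesis by (rule that[of "max 0 C"]) (use C in \<open>auto simp: le_max_iff_disj\<close>)
qed

lemma
  assumes f: "bdd_meas M f" and g: "bdd_meas M g"
  shows bdd_meas_add: "bdd_meas M (\<lambda>x. f x + g x)"
    and bdd_meas_diff: "bdd_meas M (\<lambda>x. f x - g x)"
    and bdd_meas_times: "bdd_meas M (\<lambda>x. f x * g x)"
proof -
  obtain C where C: "f \<in> borel_measurable M" "0 \<le> C" "\<And>x. x \<in> space M \<Longrightarrow> \<bar>f x\<bar> \<le> C"
    using bdd_measE[OF f] by blast
  obtain D where D: "g \<in> borel_measurable M" "0 \<le> D" "\<And>x. x \<in> space M \<Longrightarrow> \<bar>g x\<bar> \<le> D"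
    using bdd_measE[OF g] by blast
  show "bdd_meas M (\<lambda>x. f x + g x)"
  proof (rule bdd_measI)
    show "\<bar>f x + g x\<bar> \<le> C + D" if "x \<in> space M" for x using C(3)[OF that] D(3)[OF that] by linarith
  qed (use C(1) D(1) in simp)
  show "bdd_meas M (\<lambda>x. f x - g x)"
  proof (rule bdd_measI)
    show "\<bar>f x - g x\<bar> \<le> C + D" if "x \<in> space M" for x using C(3)[OF that] D(3)[OF that] by linarith
  qed (use C(1) D(1) in simp)
  show "bdd_meas M (\<lambda>x. f x * g x)"
  proof (rule bdd_measI)
    show "\<bar>f x * g x\<bar> \<le> C * D" if "x \<in> space M" for x
      unfolding abs_mult using C(3)[OF that] D(3)[OF that] C(2) by (intro mult_mono) auto
  qed (use C(1) D(1) in simp)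
qed

text \<open>Expand the square of \<open>q * x - p * y\<close>. With the norms as weights, this
  integrates to the Cauchy-Schwarz inequality.\<close>

lemma two_mult_le_weighted:
  fixes x y p q :: real
  assumes "p > 0" "q > 0"
  shows "2 * (x * y) \<le> q / p * x\<^sup>2 + p / q * y\<^sup>2"
proof -
  have "0 \<le> (q * x - p * y)\<^sup>2 / (p * q)" using assms by simp
  also have "\<dots> = q / p * x\<^sup>2 + p / q * y\<^sup>2 - 2 * (x * y)"
    using assms by (simp add: power2_eq_square field_simps)
  finally show ?thesis by simp
qed

context prob_space
begin

lemma bdd_meas_integrable: "bdd_meas M f \<Longrightarrow> integrable M f"
  by (erule bdd_measE) (rule integrable_const_bound[OF AE_I2], auto)

lemma bdd_meas_square_integrable: "bdd_meas M f \<Longrightarrow> integrable M (\<lambda>x. (f x)\<^sup>2)"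
  using bdd_meas_integrable[OF bdd_meas_times] by (simp add: power2_eq_square)

lemma l2_norm_nonneg: "0 \<le> l2_norm M f"
  by (simp add: l2_norm_def)

lemma l2_norm_square: "(l2_norm M f)\<^sup>2 = (\<integral>x. (f x)\<^sup>2 \<partial>M)"
  by (simp add: l2_norm_def)

lemma l2_norm_cmult: "l2_norm M (\<lambda>x. c * f x) = \<bar>c\<bar> * l2_norm M f"
  by (simp add: l2_norm_def power_mult_distrib real_sqrt_mult)

lemma l2_norm_minus_commute: "l2_norm M (\<lambda>x. f x - g x) = l2_norm M (\<lambda>x. g x - f x)"
  by (simp add: l2_norm_def power2_commute)

text \<open>The weighted inequality is integrated with the norms enlarged by \<open>e\<close>, so
  that no weight is zero; then \<open>e\<close> tends to 0.\<close>

lemma l2_inner_le: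
  assumes f: "bdd_meas M f" and g: "bdd_meas M g"
  shows "(\<integral>x. f x * g x \<partial>M) \<le> l2_norm M f * l2_norm M g"
proof -
  let ?a = "l2_norm M f" and ?b = "l2_norm M g"
  have "(\<integral>x. f x * g x \<partial>M) \<le> (?a + e) * (?b + e)" if e: "e > 0" for e
  proof -
    let ?a' = "?a + e" and ?b' = "?b + e"
    have pos: "?a' > 0" "?b' > 0" using l2_norm_nonneg[of f] l2_norm_nonneg[of g] e by auto
    have "(\<integral>x. 2 * (f x * g x) \<partial>M) \<le> (\<integral>x. ?b' / ?a' * (f x)\<^sup>2 + ?a' / ?b' * (g x)\<^sup>2 \<partial>M)"
    proof (rule integral_mono)
      show "2 * (f x * g x) \<le> ?b' / ?a' * (f x)\<^sup>2 + ?a' / ?b' * (g x)\<^sup>2" for x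
        by (rule two_mult_le_weighted[OF pos])
    qed (use bdd_meas_integrable[OF bdd_meas_times[OF f g]] bdd_meas_square_integrable[OF f] bdd_meas_square_integrable[OF g] in auto)
    also have "\<dots> = ?b' / ?a' * ?a\<^sup>2 + ?a' / ?b' * ?b\<^sup>2"
      using bdd_meas_square_integrable[OF f] bdd_meas_square_integrable[OF g]
      by (simp add: l2_norm_square)
    also have "\<dots> \<le> ?b' / ?a' * ?a'\<^sup>2 + ?a' / ?b' * ?b'\<^sup>2"
      using pos e l2_norm_nonneg by (intro add_mono mult_left_mono power_mono) auto
    also have "\<dots> = 2 * (?a' * ?b')"
      using pos by (simp add: power2_eq_square)
    finally show ?thesis by simp
  qed
  then have "\<forall>\<^sub>F e in at_right 0. (\<integral>x. f x * g x \<partial>M) \<le> (?a + e) * (?b + e)"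
    by (auto simp: eventually_at_filter)
  moreover have "((\<lambda>e. (?a + e) * (?b + e)) \<longlongrightarrow> (?a + 0) * (?b + 0)) (at_right 0)"
    by (intro tendsto_intros)
  ultimately have "(\<integral>x. f x * g x \<partial>M) \<le> (?a + 0) * (?b + 0)"
    by (intro tendsto_lowerbound[of _ _ "at_right (0::real)"]) auto
  then show ?thesis by simp
qed

lemma l2_norm_triangle:
  assumes f: "bdd_meas M f" and g: "bdd_meas M g"
  shows "l2_norm M (\<lambda>x. f x + g x) \<le> l2_norm M f + l2_norm M g"
proof (rule power2_le_imp_le)
  have i: "integrable M (\<lambda>x. (f x)\<^sup>2)" "integrable M (\<lambda>x. (g x)\<^sup>2)" "integrable M (\<lambda>x. f x * g x)"
    using bdd_meas_square_integrable[OF f] bdd_meas_square_integrable[OF g] bdd_meas_integrable[OF bdd_meas_times[OF f g]] by auto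
  have "(l2_norm M (\<lambda>x. f x + g x))\<^sup>2 = (\<integral>x. (f x)\<^sup>2 + (g x)\<^sup>2 + 2 * (f x * g x) \<partial>M)"
    unfolding l2_norm_square by (intro Bochner_Integration.integral_cong) (auto simp: power2_sum)
  also have "\<dots> = (l2_norm M f)\<^sup>2 + (l2_norm M g)\<^sup>2 + 2 * (\<integral>x. f x * g x \<partial>M)"
    using i by (simp add: l2_norm_square)
  also have "\<dots> \<le> (l2_norm M f)\<^sup>2 + (l2_norm M g)\<^sup>2 + 2 * (l2_norm M f * l2_norm M g)"
    using l2_inner_le[OF f g] by simp
  also have "\<dots> = (l2_norm M f + l2_norm M g)\<^sup>2" by (simp add: power2_sum)
  finally show "(l2_norm M (\<lambda>x. f x + g x))\<^sup>2 \<le> (l2_norm M f + l2_norm M g)\<^sup>2" .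
qed (use l2_norm_nonneg in auto)

lemma l2_norm_triangle_diff:
  assumes "bdd_meas M f" "bdd_meas M g" "bdd_meas M h"
  shows "l2_norm M (\<lambda>x. f x - h x) \<le> l2_norm M (\<lambda>x. f x - g x) + l2_norm M (\<lambda>x. g x - h x)"
  using l2_norm_triangle[OF bdd_meas_diff[OF assms(1,2)] bdd_meas_diff[OF assms(2,3)]] by simp

lemma l1_le_l2_norm:
  assumes f: "bdd_meas M f"
  shows "(\<integral>x. \<bar>f x\<bar> \<partial>M) \<le> l2_norm M f"
proof -
  have "bdd_meas M (\<lambda>x. \<bar>f x\<bar>)" "bdd_meas M (\<lambda>_. 1)" using f by (auto simp: bdd_meas_def)
  from l2_inner_le[OF this] show ?thesis by (simp add: l2_norm_def prob_space)
qed

text \<open>The Riesz-Fischer argument: on a probability space the mean of an absolute increment is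
  at most its mean-square norm, so the series of increments converges absolutely almost
  everywhere.\<close>

lemma l2_summable_AE_convergent:
  fixes f :: "nat \<Rightarrow> 'a \<Rightarrow> real"
  assumes f: "\<And>n. bdd_meas M (f n)" and sum: "summable (\<lambda>n. l2_norm M (\<lambda>x. f n x - f (Suc n) x))"
  shows "AE x in M. convergent (\<lambda>n. f n x)"
proof -
  have [measurable]: "\<And>n. f n \<in> borel_measurable M" using f by (simp add: bdd_meas_def)
  define D where "D n x = \<bar>f n x - f (Suc n) x\<bar>" for n x
  have bD: "bdd_meas M (\<lambda>x. f n x - f (Suc n) x)" for n by (rule bdd_meas_diff[OF f f])
  have [measurable]: "D n \<in> borel_measurable M" for n unfolding D_def by measurable
  have iD: "integrable M (D n)" for n unfolding D_def using bdd_meas_integrable[OF bD] by simp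
  have D0: "0 \<le> D n x" for n x by (simp add: D_def)
  have "(\<integral>\<^sup>+ x. (\<Sum>n. ennreal (D n x)) \<partial>M) = (\<Sum>n. \<integral>\<^sup>+ x. ennreal (D n x) \<partial>M)"
    by (rule nn_integral_suminf) auto
  also have "\<dots> = (\<Sum>n. ennreal (\<integral>x. D n x \<partial>M))"
    using iD D0 by (intro suminf_cong nn_integral_eq_integral) auto
  also have "\<dots> \<le> (\<Sum>n. ennreal (l2_norm M (\<lambda>x. f n x - f (Suc n) x)))"
    using l1_le_l2_norm[OF bD] by (intro suminf_le ennreal_leI) (auto simp: D_def)
  also have "\<dots> < \<infinity>"
    using suminf_ennreal2[OF l2_norm_nonneg sum] by (simp add: top.not_eq_extremum[symmetric])
  finally have "AE x in M. (\<Sum>n. ennreal (D n x)) \<noteq> \<infinity>"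
    by (intro nn_integral_noteq_infinite) auto
  then show ?thesis
  proof eventually_elim
    case (elim x)
    then have "summable (\<lambda>n. D n x)"
      using summable_suminf_not_top[of "\<lambda>n. D n x"] D0 by simp
    then have "summable (\<lambda>n. norm (f n x - f (Suc n) x))" by (simp add: D_def)
    then have "summable (\<lambda>n. f n x - f (Suc n) x)" by (rule summable_norm_cancel)
    then have "convergent (\<lambda>n. \<Sum>i<n. f i x - f (Suc i) x)" by (simp add: summable_iff_convergent)
    then have "convergent (\<lambda>n. f 0 x - f n x)" by (simp only: sum_lessThan_telescope'[of "\<lambda>i. f i x"])
    then obtain L where "(\<lambda>n. f 0 x - f n x) \<longlonglongrightarrow> L" by (auto simp: convergent_def)
    from tendsto_diff[OF tendsto_const[of "f 0 x"] this] show ?case by (auto simp: convergent_def)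
  qed
qed

end

section \<open>Drifts with a bounded density\<close>

text \<open>Measurability in the parameter comes from Fubini, applied after \<open>rho T\<close> is
  composed into the integrand on the unit interval.\<close>

lemma borel_measurable_rho_integral:
  fixes k :: "real \<Rightarrow> 'a \<Rightarrow> real"
  assumes T: "time_scale T" and t: "t \<le> 1"
    and k: "(\<lambda>(x, s). k s x) \<in> borel_measurable (N \<Otimes>\<^sub>M restrict_space borel T)"
  shows "(\<lambda>x. LINT s:{0..t}|lborel. k (rho T s) x) \<in> borel_measurable N"
proof -
  interpret prob_space unit_lebesgue by (rule prob_space_unit_lebesgue)
  have "(\<lambda>p. (fst p, rho T (snd p))) \<in> measurable (N \<Otimes>\<^sub>M unit_lebesgue) (N \<Otimes>\<^sub>M restrict_space borel T)"
    using measurable_compose[OF measurable_snd measurable_rho[OF T]] by (intro measurable_Pair) auto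
  from measurable_compose[OF this k]
  have 1: "(\<lambda>p. k (rho T (snd p)) (fst p)) \<in> borel_measurable (N \<Otimes>\<^sub>M unit_lebesgue)" by simp
  have "(\<lambda>s. indicator {0..t} s :: real) \<in> borel_measurable unit_lebesgue"
    by (rule measurable_restrict_space1) auto
  from measurable_compose[OF measurable_snd this]
  have 2: "(\<lambda>p. indicator {0..t} (snd p) :: real) \<in> borel_measurable (N \<Otimes>\<^sub>M unit_lebesgue)" .
  have "(\<lambda>x. \<integral>s. indicator {0..t} s * k (rho T s) x \<partial>unit_lebesgue) \<in> borel_measurable N"
    by (rule borel_measurable_lebesgue_integral)
      (use borel_measurable_times[OF 2 1] in \<open>simp add: case_prod_unfold\<close>)
  moreover have "(\<integral>s. indicator {0..t} s * k (rho T s) x \<partial>unit_lebesgue) = (LINT s:{0..t}|lborel. k (rho T s) x)" for x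
    unfolding set_lebesgue_integral_def using t
    by (subst integral_restrict_space) (auto intro!: Bochner_Integration.integral_cong simp: indicator_def)
  ultimately show ?thesis by simp
qed

lemma rho_integral_lipschitz:
  fixes g :: "real \<Rightarrow> real"
  assumes T: "time_scale T" and g: "g \<in> borel_measurable (restrict_space borel T)"
    and C: "\<And>s. s \<in> T \<Longrightarrow> \<bar>g s\<bar> \<le> C" and s: "s \<in> {0..1}" and t: "t \<in> {0..1}"
  shows "\<bar>(LINT r:{0..s}|lborel. g (rho T r)) - (LINT r:{0..t}|lborel. g (rho T r))\<bar> \<le> C * \<bar>s - t\<bar>"
proof -
  \<comment> \<open>\<open>rho T\<close> is controlled on [0,1] only; extending the integrand by 0
    allows the estimate to be done with Lebesgue measure on the line.\<close>
  define h where "h r = indicator {0..1} r * g (rho T r)" for r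
  have "(\<lambda>r. g (rho T r)) \<in> borel_measurable unit_lebesgue"
    by (rule measurable_compose[OF measurable_rho[OF T] g])
  then have h [measurable]: "h \<in> borel_measurable borel"
    unfolding h_def by (subst (asm) borel_measurable_restrict_space_iff) auto
  have C0: "0 \<le> C" using C[OF time_scaleD(3)[OF T]] by linarith
  have hC: "\<bar>h r\<bar> \<le> C" for r
    using C[OF rho_props(1)[OF T]] C0 by (auto simp: h_def indicator_def)
  have int: "integrable lborel (\<lambda>r. indicator A r * h r)" if A: "A \<in> sets borel" "emeasure lborel A < \<infinity>" for A
  proof (rule integrableI_bounded_set[where A=A and B=C])
    show "AE x\<in>A in lborel. norm (indicator A x * h x) \<le> C" using hC C0 by (auto simp: indicator_def)
  qed (use A in \<open>auto simp: indicator_def\<close>)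
  have eq: "(LINT r:{0..u}|lborel. g (rho T r)) = (\<integral>r. indicator {0..u} r * h r \<partial>lborel)" if "u \<in> {0..1}" for u
    unfolding set_lebesgue_integral_def h_def using that
    by (intro Bochner_Integration.integral_cong) (auto simp: indicator_def)
  have main: "\<bar>(LINT r:{0..v}|lborel. g (rho T r)) - (LINT r:{0..u}|lborel. g (rho T r))\<bar> \<le> C * (v - u)"
    if uv: "u \<in> {0..1}" "v \<in> {0..1}" "u \<le> v" for u v
  proof -
    have "(LINT r:{0..v}|lborel. g (rho T r)) - (LINT r:{0..u}|lborel. g (rho T r)) =
        (\<integral>r. indicator {0..v} r * h r - indicator {0..u} r * h r \<partial>lborel)"
      unfolding eq[OF uv(1)] eq[OF uv(2)]
      by (rule Bochner_Integration.integral_diff[symmetric]) (use uv in \<open>auto intro!: int\<close>)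
    also have "\<dots> = (\<integral>r. indicator {u<..v} r * h r \<partial>lborel)"
      using uv by (intro Bochner_Integration.integral_cong) (auto simp: indicator_def)
    also have "\<bar>\<dots>\<bar> \<le> (\<integral>r. C * indicator {u<..v} r \<partial>lborel)"
    proof (rule integral_abs_bound[THEN order_trans], rule integral_mono)
      show "integrable lborel (\<lambda>r. \<bar>indicator {u<..v} r * h r\<bar>)"
        using uv by (intro integrable_abs int) auto
      show "integrable lborel (\<lambda>r. C * indicator {u<..v} r)" using uv by auto
      show "\<bar>indicator {u<..v} r * h r\<bar> \<le> C * indicator {u<..v} r" for r
        using hC by (auto simp: indicator_def)
    qed
    also have "\<dots> = C * (v - u)" using uv by simp
    finally show ?thesis .
  qed
  show ?thesis
    using main[of s t] main[of t s] s t by (cases "s \<le> t") (auto simp: abs_minus_commute)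
qed

text \<open>Uniqueness of the derivative replaces the chosen \<open>delta_deriv\<close> by any
  explicit density. Through this, hypotheses phrased with a choice become statements about
  densities.\<close>

lemma H_norm_square:
  assumes T: "time_scale T" and h: "has_delta_derivative T h g"
  shows "(H_norm T h)\<^sup>2 = (\<integral>s. (g s)\<^sup>2 \<partial>lambda_Delta T)"
    and "AE s in lambda_Delta T. delta_deriv T h s = g s"
proof -
  have dd: "has_delta_derivative T h (delta_deriv T h)"
    using someI[of "has_delta_derivative T h", OF h] h by (auto simp: delta_deriv_def)
  show ae: "AE s in lambda_Delta T. delta_deriv T h s = g s"
    by (rule delta_derivative_unique[OF T dd h])
  have "H_inner T h h = (\<integral>s. (delta_deriv T h s)\<^sup>2 \<partial>lambda_Delta T)"
    by (simp add: H_inner_def power2_eq_square)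
  also have "\<dots> = (\<integral>s. (g s)\<^sup>2 \<partial>lambda_Delta T)"
  proof (rule integral_cong_AE)
    show "(\<lambda>s. (delta_deriv T h s)\<^sup>2) \<in> borel_measurable (lambda_Delta T)"
      "(\<lambda>s. (g s)\<^sup>2) \<in> borel_measurable (lambda_Delta T)"
      using dd h by (auto simp: has_delta_derivative_def)
    show "AE s in lambda_Delta T. (delta_deriv T h s)\<^sup>2 = (g s)\<^sup>2"
      using ae by eventually_elim simp
  qed
  finally show "(H_norm T h)\<^sup>2 = (\<integral>s. (g s)\<^sup>2 \<partial>lambda_Delta T)"
    by (simp add: H_norm_def)
qed

definition primitive :: "real set \<Rightarrow> (real \<Rightarrow> (real \<Rightarrow> real) \<Rightarrow> real) \<Rightarrow> (real \<Rightarrow> real) \<Rightarrow> real \<Rightarrow> real" where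
  "primitive T g \<omega> = (\<lambda>t\<in>T. LINT s:{0..<t} \<inter> T|lambda_Delta T. g s \<omega>)"

lemma drift_map_primitive: "drift_map T \<beta> h = primitive T (\<lambda>s \<omega>. \<beta> s (random_shift T h \<omega>))"
  by (simp add: drift_map_def primitive_def fun_eq_iff)

text \<open>Here \<open>\<mu>\<close> is any probability on the path space. That it is the law of a
  sampled Brownian motion enters only when the laws are compared.\<close>

locale bounded_drift =
  fixes T :: "real set" and \<mu> :: "(real \<Rightarrow> real) measure"
    and \<beta> :: "real \<Rightarrow> (real \<Rightarrow> real) \<Rightarrow> real" and C :: real
  assumes T: "time_scale T"
    and prob_mu: "prob_space \<mu>"
    and sets_mu: "sets \<mu> = sets (path_borel T)"
    and beta_borel: "(\<lambda>(t, \<omega>). \<beta> t \<omega>) \<in> borel_measurable (restrict_space borel T \<Otimes>\<^sub>M path_borel T)"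
    and beta_bounded: "\<And>t \<omega>. t \<in> T \<Longrightarrow> \<omega> \<in> path_space T \<Longrightarrow> \<bar>\<beta> t \<omega>\<bar> \<le> C"
    and beta_adapted: "\<And>t. t \<in> T \<Longrightarrow> \<beta> t \<in> borel_measurable (canonical_filtration T t)"
begin

lemmas TD = time_scaleD[OF T]

sublocale mu: prob_space \<mu> by (rule prob_mu)
sublocale lD: prob_space "lambda_Delta T" by (rule prob_space_lambda_Delta[OF T])
sublocale PP: pair_prob_space \<mu> "lambda_Delta T" ..

lemma space_mu: "space \<mu> = path_space T"
  using sets_eq_imp_space_eq[OF sets_mu] by simp

abbreviation joint :: "((real \<Rightarrow> real) \<times> real) measure" where
  "joint \<equiv> path_borel T \<Otimes>\<^sub>M restrict_space borel T"

abbreviation prodM :: "((real \<Rightarrow> real) \<times> real) measure" where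
  "prodM \<equiv> \<mu> \<Otimes>\<^sub>M lambda_Delta T"

lemma sets_prodM: "sets prodM = sets joint"
  by (rule sets_pair_measure_cong[OF sets_mu sets_lambda_Delta])

lemma space_prodM: "space prodM = path_space T \<times> T"
  by (simp add: space_pair_measure space_mu space_lambda_Delta)

abbreviation Fa :: "real \<Rightarrow> (real \<Rightarrow> real) measure" where
  "Fa t \<equiv> augment \<mu> (canonical_filtration T t)"

lemma sub_F: "subalgebra \<mu> (canonical_filtration T t)"
  by (rule subalgebra_canonical_filtration[OF T sets_mu])

lemma Fa_mono: "s \<le> t \<Longrightarrow> f \<in> measurable (Fa s) N \<Longrightarrow> f \<in> measurable (Fa t) N"
  using sets_augment_mono[OF sub_F sub_F sets_canonical_filtration_mono, of s t]
  by (auto simp: measurable_def)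

lemma C_nonneg: "0 \<le> C"
proof -
  have "(\<lambda>t\<in>T. 0) \<in> path_space T"
    unfolding path_space_iff[OF T] using TD(3) by (auto intro: continuous_on_eq[OF continuous_on_const])
  then show ?thesis using beta_bounded[OF TD(3)] by (meson abs_ge_zero order_trans)
qed

text \<open>The bound is the one of \<open>\<beta>\<close>, which makes the class invariant under
  the drift map. It holds everywhere and not just almost everywhere, so that every path has a
  primitive in the Cameron-Martin space.\<close>

definition bdd_density :: "(real \<Rightarrow> (real \<Rightarrow> real) \<Rightarrow> real) \<Rightarrow> bool" where
  "bdd_density g \<longleftrightarrow> (\<lambda>(\<omega>, s). g s \<omega>) \<in> borel_measurable joint \<and>
     (\<forall>s\<in>T. \<forall>\<omega>\<in>path_space T. \<bar>g s \<omega>\<bar> \<le> C)"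

text \<open>Adaptedness of the primitive is a separate requirement: measurability of each
  \<open>g t\<close> and joint measurability do not directly make the integral up to
  \<open>t\<close> measurable for the information at \<open>t\<close>.\<close>

definition adapted_density :: "(real \<Rightarrow> (real \<Rightarrow> real) \<Rightarrow> real) \<Rightarrow> bool" where
  "adapted_density g \<longleftrightarrow> bdd_density g \<and>
     (\<forall>t\<in>T. g t \<in> borel_measurable (Fa t)) \<and> (\<forall>t\<in>T. (\<lambda>\<omega>. primitive T g \<omega> t) \<in> borel_measurable (Fa t))"

lemma adapted_densityD:
  assumes "adapted_density g"
  shows "bdd_density g" "\<And>t. t \<in> T \<Longrightarrow> g t \<in> borel_measurable (Fa t)"
    "\<And>t. t \<in> T \<Longrightarrow> (\<lambda>\<omega>. primitive T g \<omega> t) \<in> borel_measurable (Fa t)"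
  using assms by (auto simp: adapted_density_def)

section \<open>Primitives of bounded densities as elements of L2 of the Cameron-Martin space\<close>

lemma density_section:
  assumes g: "bdd_density g" and \<omega>: "\<omega> \<in> path_space T"
  shows "(\<lambda>s. g s \<omega>) \<in> borel_measurable (restrict_space borel T)"
proof -
  have "(\<lambda>s. (\<omega>, s)) \<in> measurable (restrict_space borel T) joint"
    using \<omega> by (intro measurable_Pair1') simp
  from measurable_compose[OF this, of "\<lambda>(\<omega>, s). g s \<omega>" borel] g show ?thesis
    by (simp add: bdd_density_def)
qed

lemma density_bdd_meas: "bdd_density g \<Longrightarrow> bdd_meas prodM (\<lambda>(\<omega>, s). g s \<omega>)"
  by (rule bdd_measI[where C=C]) (auto simp: bdd_density_def measurable_cong_sets[OF sets_prodM refl] space_prodM)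

lemma primitive_eq:
  assumes "bdd_density g" "\<omega> \<in> path_space T" "t \<in> T"
  shows "primitive T g \<omega> t = (LINT s:{0..t}|lborel. g (rho T s) \<omega>)"
  using set_integral_lambda_Delta[OF T assms(3) density_section[OF assms(1,2)]] assms(3)
  by (simp add: primitive_def)

lemma density_lipschitz:
  assumes g: "bdd_density g" and \<omega>: "\<omega> \<in> path_space T" and "s \<in> {0..1}" "t \<in> {0..1}"
  shows "\<bar>(LINT r:{0..s}|lborel. g (rho T r) \<omega>) - (LINT r:{0..t}|lborel. g (rho T r) \<omega>)\<bar> \<le> C * \<bar>s - t\<bar>"
  by (rule rho_integral_lipschitz[OF T density_section[OF g \<omega>]]) (use assms in \<open>auto simp: bdd_density_def\<close>)

lemma primitive_in_path_space:
  assumes g: "bdd_density g" and \<omega>: "\<omega> \<in> path_space T"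
  shows "primitive T g \<omega> \<in> path_space T"
  unfolding path_space_iff[OF T]
proof (intro conjI)
  show "primitive T g \<omega> \<in> extensional T" by (simp add: primitive_def)
  have "C-lipschitz_on T (primitive T g \<omega>)"
  proof (rule lipschitz_onI[OF _ C_nonneg])
    fix s t assume st: "s \<in> T" "t \<in> T"
    then show "dist (primitive T g \<omega> s) (primitive T g \<omega> t) \<le> C * dist s t"
      unfolding primitive_eq[OF g \<omega> st(1)] primitive_eq[OF g \<omega> st(2)] dist_real_def
      using TD(5) by (intro density_lipschitz[OF g \<omega>]) auto
  qed
  then show "continuous_on T (primitive T g \<omega>)" by (rule lipschitz_on_continuous_on)
  show "primitive T g \<omega> 0 = 0"
    using TD(3) by (simp add: primitive_def set_lebesgue_integral_def)
qed

lemma measurable_primitive: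
  assumes g: "bdd_density g"
  shows "primitive T g \<in> measurable (path_borel T) (path_borel T)"
proof (rule measurable_into_path_borel[OF T])
  fix t assume t: "t \<in> T"
  have "(\<lambda>\<omega>. LINT s:{0..t}|lborel. g (rho T s) \<omega>) \<in> borel_measurable (path_borel T)"
    using g t TD(5) by (intro borel_measurable_rho_integral[OF T]) (auto simp: bdd_density_def)
  then show "(\<lambda>\<omega>. primitive T g \<omega> t) \<in> borel_measurable (path_borel T)"
    by (rule subst[OF measurable_cong, rotated]) (simp add: primitive_eq[OF g _ t])
qed (simp add: primitive_in_path_space[OF g])

lemma square_integrable_section:
  assumes g: "g \<in> borel_measurable (restrict_space borel T)" and D: "\<And>s. s \<in> T \<Longrightarrow> \<bar>g s :: real\<bar> \<le> D"
  shows "g \<in> borel_measurable (lambda_Delta T)" "integrable (lambda_Delta T) g" "integrable (lambda_Delta T) (\<lambda>s. (g s)\<^sup>2)"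
proof -
  show 1: "g \<in> borel_measurable (lambda_Delta T)"
    using g by (simp add: measurable_cong_sets[OF sets_lambda_Delta refl])
  have "bdd_meas (lambda_Delta T) g"
    by (rule bdd_measI[OF 1, where C=D]) (use D in \<open>simp add: space_lambda_Delta\<close>)
  then show "integrable (lambda_Delta T) g" "integrable (lambda_Delta T) (\<lambda>s. (g s)\<^sup>2)"
    by (rule lD.bdd_meas_integrable lD.bdd_meas_square_integrable)+
qed

lemma density_section_integrable:
  assumes g: "bdd_density g" and \<omega>: "\<omega> \<in> path_space T"
  shows "integrable (lambda_Delta T) (\<lambda>s. g s \<omega>)"
  using square_integrable_section(2)[OF density_section[OF g \<omega>], of C] g \<omega> by (auto simp: bdd_density_def)

lemma primitive_has_delta_derivative:
  assumes g: "bdd_density g" and \<omega>: "\<omega> \<in> path_space T"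
  shows "has_delta_derivative T (primitive T g \<omega>) (\<lambda>s. g s \<omega>)"
  unfolding has_delta_derivative_def
  using square_integrable_section(1,3)[OF density_section[OF g \<omega>], of C] g \<omega>
  by (auto simp: bdd_density_def primitive_def)

lemma set_integrable_section:
  assumes g: "bdd_density g" and \<omega>: "\<omega> \<in> path_space T" and t: "t \<in> T"
  shows "set_integrable (lambda_Delta T) ({0..<t} \<inter> T) (\<lambda>s. g s \<omega>)"
  unfolding set_integrable_def
  by (rule integrable_mult_indicator[OF _ density_section_integrable[OF g \<omega>]])
     (auto simp: sets_lambda_Delta sets_restrict_space)

lemma primitive_diff_has_delta_derivative:
  assumes g: "bdd_density g" and k: "bdd_density k" and \<omega>: "\<omega> \<in> path_space T"
  shows "has_delta_derivative T (\<lambda>t\<in>T. primitive T g \<omega> t - primitive T k \<omega> t) (\<lambda>s. g s \<omega> - k s \<omega>)"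
  unfolding has_delta_derivative_def
proof (intro conjI ballI)
  have m: "(\<lambda>s. g s \<omega> - k s \<omega>) \<in> borel_measurable (restrict_space borel T)"
    using density_section[OF g \<omega>] density_section[OF k \<omega>] by simp
  have "\<bar>g s \<omega> - k s \<omega>\<bar> \<le> 2 * C" if "s \<in> T" for s
  proof -
    have "\<bar>g s \<omega>\<bar> \<le> C" "\<bar>k s \<omega>\<bar> \<le> C" using g k \<omega> that by (auto simp: bdd_density_def)
    then show ?thesis by linarith
  qed
  from square_integrable_section[OF m this]
  show "(\<lambda>s. g s \<omega> - k s \<omega>) \<in> borel_measurable (lambda_Delta T)"
    "integrable (lambda_Delta T) (\<lambda>s. (g s \<omega> - k s \<omega>)\<^sup>2)" by auto
  fix t assume t: "t \<in> T"
  show "(\<lambda>t\<in>T. primitive T g \<omega> t - primitive T k \<omega> t) t = (LINT s:{0..<t} \<inter> T|lambda_Delta T. g s \<omega> - k s \<omega>)"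
    using t set_integral_diff(2)[OF set_integrable_section[OF g \<omega> t] set_integrable_section[OF k \<omega> t]]
    by (simp add: primitive_def)
qed

text \<open>The squared norm is at most C^2 for every path, and at a right-scattered point the
  chosen derivative equals \<open>g\<close>, because such points are atoms.\<close>

lemma primitive_L2H_adapted:
  assumes g: "adapted_density g"
  shows "primitive T g \<in> L2H_adapted T \<mu>"
proof -
  note gd = adapted_densityD[OF g]
  have m: "primitive T g \<in> measurable (path_borel T) (path_borel T)" by (rule measurable_primitive[OF gd(1)])
  have "primitive T g \<omega> \<in> cameron_martin T" if "\<omega> \<in> path_space T" for \<omega>
    using primitive_in_path_space[OF gd(1) that] primitive_has_delta_derivative[OF gd(1) that]
    by (auto simp: cameron_martin_def)
  then have cm: "AE \<omega> in \<mu>. primitive T g \<omega> \<in> cameron_martin T"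
    by (intro AE_I2) (simp add: space_mu)
  have "(\<integral>\<^sup>+ \<omega>. ennreal ((H_norm T (primitive T g \<omega>))\<^sup>2) \<partial>\<mu>) \<le> (\<integral>\<^sup>+ \<omega>. ennreal (C\<^sup>2) \<partial>\<mu>)"
  proof (intro nn_integral_mono ennreal_leI)
    fix \<omega> assume "\<omega> \<in> space \<mu>"
    then have \<omega>: "\<omega> \<in> path_space T" by (simp add: space_mu)
    have "(H_norm T (primitive T g \<omega>))\<^sup>2 = (\<integral>s. (g s \<omega>)\<^sup>2 \<partial>lambda_Delta T)"
      by (rule H_norm_square(1)[OF T primitive_has_delta_derivative[OF gd(1) \<omega>]])
    also have "\<dots> \<le> (\<integral>s. C\<^sup>2 \<partial>lambda_Delta T)"
    proof (rule integral_mono)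
      show "integrable (lambda_Delta T) (\<lambda>s. (g s \<omega>)\<^sup>2)"
        using primitive_has_delta_derivative[OF gd(1) \<omega>] by (simp add: has_delta_derivative_def)
      fix s assume "s \<in> space (lambda_Delta T)"
      then have "\<bar>g s \<omega>\<bar> \<le> \<bar>C\<bar>" using gd(1) \<omega> C_nonneg by (simp add: bdd_density_def space_lambda_Delta)
      then show "(g s \<omega>)\<^sup>2 \<le> C\<^sup>2" by (simp only: abs_le_square_iff)
    qed auto
    also have "\<dots> = C\<^sup>2" by (simp add: lD.prob_space)
    finally show "(H_norm T (primitive T g \<omega>))\<^sup>2 \<le> C\<^sup>2" .
  qed
  also have "\<dots> < \<infinity>" by (simp add: mu.emeasure_space_1)
  finally have fin: "(\<integral>\<^sup>+ \<omega>. ennreal ((H_norm T (primitive T g \<omega>))\<^sup>2) \<partial>\<mu>) < \<infinity>" .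
  have dd: "(\<lambda>\<omega>. delta_deriv T (primitive T g \<omega>) t) \<in> borel_measurable (Fa t)" if t: "t \<in> right_scattered T" for t
  proof -
    have tT: "t \<in> T" using t by (simp add: right_scattered_def)
    have "delta_deriv T (primitive T g \<omega>) t = g t \<omega>" if "\<omega> \<in> path_space T" for \<omega>
      by (rule AE_lambda_Delta_right_scattered[OF T _ t, where P="\<lambda>t. delta_deriv T (primitive T g \<omega>) t = g t \<omega>"])
         (rule H_norm_square(2)[OF T primitive_has_delta_derivative[OF gd(1) that]])
    then show ?thesis
      using gd(2)[OF tT] by (subst measurable_cong[where g="g t"]) (auto simp: space_mu)
  qed
  show ?thesis
    unfolding L2H_adapted_def L2H_def using m cm fin gd(3) dd by blast
qed

text \<open>A pseudometric on densities; under \<open>primitive\<close> it is the distance of the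
  Hilbert space of shifts.\<close>

definition dens_dist :: "(real \<Rightarrow> (real \<Rightarrow> real) \<Rightarrow> real) \<Rightarrow> (real \<Rightarrow> (real \<Rightarrow> real) \<Rightarrow> real) \<Rightarrow> real" where
  "dens_dist g k = l2_norm prodM (\<lambda>(\<omega>, s). g s \<omega> - k s \<omega>)"

lemma density_diff_bdd_meas:
  "bdd_density g \<Longrightarrow> bdd_density k \<Longrightarrow> bdd_meas prodM (\<lambda>(\<omega>, s). g s \<omega> - k s \<omega>)"
  using bdd_meas_diff[OF density_bdd_meas density_bdd_meas, of g k] by (simp add: case_prod_unfold)

lemma dens_dist_nn_integral:
  assumes "bdd_density g" "bdd_density k"
  shows "(\<integral>\<^sup>+ \<omega>. (\<integral>\<^sup>+ s. ennreal ((g s \<omega> - k s \<omega>)\<^sup>2) \<partial>lambda_Delta T) \<partial>\<mu>) = ennreal ((dens_dist g k)\<^sup>2)"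
proof -
  let ?f = "\<lambda>(\<omega>, s). g s \<omega> - k s \<omega>"
  have b: "bdd_meas prodM ?f" by (rule density_diff_bdd_meas[OF assms])
  then have m: "?f \<in> borel_measurable prodM" by (simp add: bdd_meas_def)
  have "(\<integral>\<^sup>+ \<omega>. (\<integral>\<^sup>+ s. ennreal ((g s \<omega> - k s \<omega>)\<^sup>2) \<partial>lambda_Delta T) \<partial>\<mu>) = (\<integral>\<^sup>+ z. ennreal ((?f z)\<^sup>2) \<partial>prodM)"
    using lD.nn_integral_fst[of "\<lambda>z. ennreal ((?f z)\<^sup>2)" \<mu>] m by simp
  also have "\<dots> = ennreal (\<integral>z. (?f z)\<^sup>2 \<partial>prodM)"
    by (rule nn_integral_eq_integral[OF PP.bdd_meas_square_integrable[OF b]]) simp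
  finally show ?thesis by (simp only: dens_dist_def PP.l2_norm_square)
qed

text \<open>For each path the squared norm of the difference is the integral of the squared
  difference of the densities; Tonelli turns the iterated integral into one over the product. It
  carries the continuity hypothesis over to densities.\<close>

lemma L2H_dist_primitive:
  assumes g: "bdd_density g" and k: "bdd_density k"
  shows "L2H_dist T \<mu> (primitive T g) (primitive T k) = dens_dist g k"
proof -
  have "ennreal ((H_norm T (\<lambda>t\<in>T. primitive T g \<omega> t - primitive T k \<omega> t))\<^sup>2)
      = (\<integral>\<^sup>+ s. ennreal ((g s \<omega> - k s \<omega>)\<^sup>2) \<partial>lambda_Delta T)" if "\<omega> \<in> space \<mu>" for \<omega>
  proof -
    have d: "has_delta_derivative T (\<lambda>t\<in>T. primitive T g \<omega> t - primitive T k \<omega> t) (\<lambda>s. g s \<omega> - k s \<omega>)"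
      by (rule primitive_diff_has_delta_derivative[OF g k]) (use that in \<open>simp add: space_mu\<close>)
    then have "integrable (lambda_Delta T) (\<lambda>s. (g s \<omega> - k s \<omega>)\<^sup>2)" by (simp add: has_delta_derivative_def)
    then show ?thesis
      unfolding H_norm_square(1)[OF T d] by (intro nn_integral_eq_integral[symmetric]) auto
  qed
  then have "(\<integral>\<^sup>+ \<omega>. ennreal ((H_norm T (\<lambda>t\<in>T. primitive T g \<omega> t - primitive T k \<omega> t))\<^sup>2) \<partial>\<mu>) = ennreal ((dens_dist g k)\<^sup>2)"
    unfolding dens_dist_nn_integral[OF g k, symmetric] by (rule nn_integral_cong)
  then show ?thesis
    by (simp add: L2H_dist_def dens_dist_def PP.l2_norm_nonneg)
qed

section \<open>Random shifts and the drift evaluated along them\<close>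

lemma random_shift_in_path_space:
  assumes "\<omega> \<in> path_space T" "h \<omega> \<in> path_space T"
  shows "random_shift T h \<omega> \<in> path_space T"
  using assms TD(3) unfolding path_space_iff[OF T] random_shift_def
  by (auto intro!: continuous_on_eq[OF continuous_on_add, of T \<omega> "h \<omega>"])

lemma measurable_random_shift:
  assumes g: "bdd_density g"
  shows "random_shift T (primitive T g) \<in> measurable (path_borel T) (path_borel T)"
proof (rule measurable_into_path_borel[OF T])
  fix t assume t: "t \<in> T"
  have "(\<lambda>\<omega>. \<omega> t + primitive T g \<omega> t) \<in> borel_measurable (path_borel T)"
    using path_borel_coordinate[OF T t] measurable_compose[OF measurable_primitive[OF g] path_borel_coordinate[OF T t]]
    by (rule borel_measurable_add)
  then show "(\<lambda>\<omega>. random_shift T (primitive T g) \<omega> t) \<in> borel_measurable (path_borel T)"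
    using t by (simp add: random_shift_def)
qed (simp add: random_shift_in_path_space primitive_in_path_space[OF g])

lemma random_shift_adapted:
  assumes g: "adapted_density g"
  shows "random_shift T (primitive T g) \<in> measurable (Fa t) (canonical_filtration T t)"
proof (rule measurable_into_canonical_filtration)
  fix s assume s: "s \<in> T" "0 \<le> s" "s \<le> t"
  have "(\<lambda>\<omega>. \<omega> s) \<in> borel_measurable (Fa t)"
    by (rule measurable_augment_base[OF sub_F canonical_filtration_coordinate[OF s]])
  moreover have "(\<lambda>\<omega>. primitive T g \<omega> s) \<in> borel_measurable (Fa t)"
    by (rule Fa_mono[OF s(3) adapted_densityD(3)[OF g s(1)]])
  ultimately show "(\<lambda>\<omega>. random_shift T (primitive T g) \<omega> s) \<in> borel_measurable (Fa t)"
    using s(1) by (simp add: random_shift_def)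
qed (simp add: random_shift_in_path_space primitive_in_path_space[OF adapted_densityD(1)[OF g]] space_mu)

lemma beta_joint: "(\<lambda>(\<omega>, s). \<beta> s \<omega>) \<in> borel_measurable joint"
  using measurable_pair_swap[OF beta_borel] by (simp add: case_prod_unfold)

text \<open>Up to time \<open>t\<close> the drift sees only the path stopped at \<open>t0\<close>, which turns joint
  measurability of \<open>\<beta>\<close> into adaptedness of the integral.\<close>

lemma integral_beta_adapted:
  assumes G: "G \<in> measurable N (canonical_filtration T t0)" and t0: "t0 \<in> T"
    and t: "0 \<le> t" "t \<le> 1" "t0 \<le> t" and rho: "\<And>s. s \<in> {0..t} \<Longrightarrow> rho T s \<le> t0"
  shows "(\<lambda>\<omega>. LINT s:{0..t}|lborel. \<beta> (rho T s) (G \<omega>)) \<in> borel_measurable N"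
proof -
  have "(\<lambda>p. (stop_path T t0 (G (fst p)), snd p)) \<in> measurable (N \<Otimes>\<^sub>M restrict_space borel T) joint"
    by (intro measurable_Pair measurable_snd measurable_compose[OF measurable_fst]
        measurable_compose[OF G measurable_stop_path[OF T t0]])
  from measurable_compose[OF this beta_joint]
  have "(\<lambda>\<omega>. LINT s:{0..t}|lborel. \<beta> (rho T s) (stop_path T t0 (G \<omega>))) \<in> borel_measurable N"
    by (intro borel_measurable_rho_integral[OF T t(2)]) (simp add: case_prod_unfold)
  moreover have "(LINT s:{0..t}|lborel. \<beta> (rho T s) (stop_path T t0 (G \<omega>))) = (LINT s:{0..t}|lborel. \<beta> (rho T s) (G \<omega>))"
    if "\<omega> \<in> space N" for \<omega>
  proof (rule set_lebesgue_integral_cong)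
    have "G \<omega> \<in> path_space T" using measurable_space[OF G that] by simp
    then show "\<forall>s. s \<in> {0..t} \<longrightarrow> \<beta> (rho T s) (stop_path T t0 (G \<omega>)) = \<beta> (rho T s) (G \<omega>)"
      using t by (auto intro!: canonical_filtration_stop[OF T t0 rho beta_adapted[OF rho_props(1)[OF T]]])
  qed simp
  ultimately show ?thesis by (subst measurable_cong) (auto dest: sym)
qed

text \<open>The drift map on the level of densities: its primitive is the drift map applied to the
  primitive of \<open>g\<close>.\<close>

definition shifted_drift :: "(real \<Rightarrow> (real \<Rightarrow> real) \<Rightarrow> real) \<Rightarrow> real \<Rightarrow> (real \<Rightarrow> real) \<Rightarrow> real" where
  "shifted_drift g s \<omega> = \<beta> s (random_shift T (primitive T g) \<omega>)"

lemma density_shifted_drift: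
  assumes g: "bdd_density g"
  shows "bdd_density (shifted_drift g)"
  unfolding bdd_density_def
proof (intro conjI ballI)
  have "(\<lambda>p. (random_shift T (primitive T g) (fst p), snd p)) \<in> measurable joint joint"
    by (intro measurable_Pair measurable_snd measurable_compose[OF measurable_fst measurable_random_shift[OF g]])
  from measurable_compose[OF this beta_joint]
  show "(\<lambda>(\<omega>, s). shifted_drift g s \<omega>) \<in> borel_measurable joint"
    by (simp add: shifted_drift_def case_prod_unfold)
  show "\<bar>shifted_drift g s \<omega>\<bar> \<le> C" if "s \<in> T" "\<omega> \<in> path_space T" for s \<omega>
    unfolding shifted_drift_def
    using that by (intro beta_bounded random_shift_in_path_space primitive_in_path_space g)
qed

lemma adapted_shifted_drift:
  assumes g: "adapted_density g"
  shows "adapted_density (shifted_drift g)"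
  unfolding adapted_density_def
proof (intro conjI ballI)
  note gd = adapted_densityD[OF g]
  show d: "bdd_density (shifted_drift g)" by (rule density_shifted_drift[OF gd(1)])
  fix t assume t: "t \<in> T"
  show "shifted_drift g t \<in> borel_measurable (Fa t)"
    using measurable_compose[OF random_shift_adapted[OF g] beta_adapted[OF t]] by (simp add: shifted_drift_def[abs_def])
  have "(\<lambda>\<omega>. LINT s:{0..t}|lborel. \<beta> (rho T s) (random_shift T (primitive T g) \<omega>)) \<in> borel_measurable (Fa t)"
  proof (rule integral_beta_adapted[OF random_shift_adapted[OF g] t])
    show "rho T s \<le> t" if "s \<in> {0..t}" for s
      using rho_props(2)[OF T, of s] that t TD(5) by force
  qed (use t TD(5) in auto)
  then show "(\<lambda>\<omega>. primitive T (shifted_drift g) \<omega> t) \<in> borel_measurable (Fa t)"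
    by (rule subst[OF measurable_cong, rotated]) (simp add: primitive_eq[OF d _ t] space_mu shifted_drift_def)
qed

section \<open>Relaxation as a convex combination of densities\<close>

definition mix :: "real \<Rightarrow> (real \<Rightarrow> (real \<Rightarrow> real) \<Rightarrow> real) \<Rightarrow> (real \<Rightarrow> (real \<Rightarrow> real) \<Rightarrow> real) \<Rightarrow> real \<Rightarrow> (real \<Rightarrow> real) \<Rightarrow> real" where
  "mix \<epsilon> g k s \<omega> = (1 - \<epsilon>) * g s \<omega> + \<epsilon> * k s \<omega>"

lemma density_mix:
  assumes g: "bdd_density g" and k: "bdd_density k" and e: "0 \<le> \<epsilon>" "\<epsilon> \<le> 1"
  shows "bdd_density (mix \<epsilon> g k)"
  unfolding bdd_density_def
proof (intro conjI ballI)
  show "(\<lambda>(\<omega>, s). mix \<epsilon> g k s \<omega>) \<in> borel_measurable joint"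
    using g k by (auto simp: bdd_density_def mix_def case_prod_unfold)
  fix s \<omega> assume "s \<in> T" "\<omega> \<in> path_space T"
  then have b: "\<bar>g s \<omega>\<bar> \<le> C" "\<bar>k s \<omega>\<bar> \<le> C" using g k by (auto simp: bdd_density_def)
  have "\<bar>mix \<epsilon> g k s \<omega>\<bar> \<le> (1 - \<epsilon>) * \<bar>g s \<omega>\<bar> + \<epsilon> * \<bar>k s \<omega>\<bar>"
    unfolding mix_def using e by (intro order_trans[OF abs_triangle_ineq]) (simp add: abs_mult)
  also have "\<dots> \<le> (1 - \<epsilon>) * C + \<epsilon> * C"
    using b e by (intro add_mono mult_left_mono) auto
  finally show "\<bar>mix \<epsilon> g k s \<omega>\<bar> \<le> C" by (simp add: algebra_simps)
qed

lemma primitive_mix: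
  assumes g: "bdd_density g" and k: "bdd_density k" and \<omega>: "\<omega> \<in> path_space T" and t: "t \<in> T"
  shows "primitive T (mix \<epsilon> g k) \<omega> t = (1 - \<epsilon>) * primitive T g \<omega> t + \<epsilon> * primitive T k \<omega> t"
  unfolding primitive_def mix_def using t
  by (simp add: set_integral_add(2) set_integrable_section[OF g \<omega> t] set_integrable_section[OF k \<omega> t] set_integrable_mult_right)

lemma adapted_mix:
  assumes g: "adapted_density g" and k: "adapted_density k" and e: "0 \<le> \<epsilon>" "\<epsilon> \<le> 1"
  shows "adapted_density (mix \<epsilon> g k)"
  unfolding adapted_density_def
proof (intro conjI ballI)
  note gd = adapted_densityD[OF g] and kd = adapted_densityD[OF k]
  show "bdd_density (mix \<epsilon> g k)" by (rule density_mix[OF gd(1) kd(1) e])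
  fix t assume t: "t \<in> T"
  show "mix \<epsilon> g k t \<in> borel_measurable (Fa t)"
    unfolding mix_def[abs_def] using gd(2)[OF t] kd(2)[OF t] by simp
  have "(\<lambda>\<omega>. (1 - \<epsilon>) * primitive T g \<omega> t + \<epsilon> * primitive T k \<omega> t) \<in> borel_measurable (Fa t)"
    using gd(3)[OF t] kd(3)[OF t] by simp
  then show "(\<lambda>\<omega>. primitive T (mix \<epsilon> g k) \<omega> t) \<in> borel_measurable (Fa t)"
    by (rule subst[OF measurable_cong, rotated]) (simp add: primitive_mix[OF gd(1) kd(1) _ t] space_mu)
qed

lemma relax_primitive:
  assumes g: "bdd_density g" and \<omega>: "\<omega> \<in> path_space T"
  shows "relax T \<beta> \<epsilon> (primitive T g) \<omega> = primitive T (mix \<epsilon> g (shifted_drift g)) \<omega>"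
proof
  fix t
  show "relax T \<beta> \<epsilon> (primitive T g) \<omega> t = primitive T (mix \<epsilon> g (shifted_drift g)) \<omega> t"
  proof (cases "t \<in> T")
    case True
    then show ?thesis
      using primitive_mix[OF g density_shifted_drift[OF g] \<omega> True, of \<epsilon>]
      by (simp add: relax_def primitive_def shifted_drift_def)
  qed (simp add: relax_def primitive_def)
qed

lemma AE_prodM_sections:
  assumes "AE z in prodM. Q z"
  shows "AE \<omega> in \<mu>. AE s in lambda_Delta T. Q (\<omega>, s)"
  using PP.AE_pair[OF assms] .

lemma adapted_density_complete:
  assumes X: "\<And>n. adapted_density (X n)" and sum: "summable (\<lambda>n. dens_dist (X n) (X (Suc n)))"
  shows "\<exists>g. adapted_density g \<and> (\<lambda>n. dens_dist (X n) g) \<longlonglongrightarrow> 0"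
proof -
  note Xd = adapted_densityD[OF X]
  have Xm: "(\<lambda>(\<omega>, s). X n s \<omega>) \<in> borel_measurable joint" and XC: "\<And>s \<omega>. s \<in> T \<Longrightarrow> \<omega> \<in> path_space T \<Longrightarrow> \<bar>X n s \<omega>\<bar> \<le> C" for n
    using Xd(1)[of n] by (auto simp: bdd_density_def)
  \<comment> \<open>Where the sequence diverges, \<open>lim\<close> is arbitrary; the truncation
    restores the bound \<open>C\<close> there and changes nothing where it converges.\<close>
  define g where "g s \<omega> = max (- C) (min C (lim (\<lambda>n. X n s \<omega>)))" for s \<omega>
  have "AE z in prodM. convergent (\<lambda>n. (\<lambda>(\<omega>, s). X n s \<omega>) z)"
  proof (rule PP.l2_summable_AE_convergent)
    show "bdd_meas prodM (\<lambda>(\<omega>, s). X n s \<omega>)" for n by (rule density_bdd_meas[OF Xd(1)])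
    show "summable (\<lambda>n. l2_norm prodM (\<lambda>x. (\<lambda>(\<omega>, s). X n s \<omega>) x - (\<lambda>(\<omega>, s). X (Suc n) s \<omega>) x))"
      using sum by (simp add: dens_dist_def case_prod_unfold)
  qed
  then have conv: "AE z in prodM. (\<lambda>n. X n (snd z) (fst z)) \<longlonglongrightarrow> g (snd z) (fst z)"
    using AE_space
  proof eventually_elim
    case (elim z)
    then have z: "fst z \<in> path_space T" "snd z \<in> T" by (auto simp: space_prodM)
    have "(\<lambda>n. X n (snd z) (fst z)) \<longlonglongrightarrow> lim (\<lambda>n. X n (snd z) (fst z))"
      using elim(1) by (simp add: convergent_LIMSEQ_iff case_prod_unfold)
    then have "(\<lambda>n. max (- C) (min C (X n (snd z) (fst z)))) \<longlonglongrightarrow> g (snd z) (fst z)"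
      unfolding g_def by (intro tendsto_max tendsto_min tendsto_const)
    moreover have "max (- C) (min C (X n (snd z) (fst z))) = X n (snd z) (fst z)" for n
      using XC[OF z(2,1), of n] by (simp add: abs_le_iff)
    ultimately show ?case by simp
  qed
  have gm: "(\<lambda>(\<omega>, s). g s \<omega>) \<in> borel_measurable joint"
    using Xm unfolding g_def case_prod_unfold
    by (intro borel_measurable_max borel_measurable_min borel_measurable_const borel_measurable_lim_metric)
  have gC: "\<bar>g s \<omega>\<bar> \<le> C" for s \<omega>
    using C_nonneg by (auto simp: g_def)
  have gd: "bdd_density g" using gm gC by (simp add: bdd_density_def)
  have "adapted_density g"
    unfolding adapted_density_def
  proof (intro conjI ballI gd)
    fix t assume t: "t \<in> T"
    \<comment> \<open>A fixed time may be null for \<open>lambda_Delta T\<close>, so almost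
      everywhere convergence says nothing about it; but \<open>lim\<close> of measurable functions
      is measurable whether or not the sequence converges.\<close>
    show "g t \<in> borel_measurable (Fa t)"
      using Xd(2)[OF t] unfolding g_def[abs_def]
      by (intro borel_measurable_max borel_measurable_min borel_measurable_const borel_measurable_lim_metric)
    \<comment> \<open>The primitive of \<open>g\<close> is identified with this limit for almost
      every path by dominated convergence in time; the exceptional paths are absorbed by the
      augmentation.\<close>
    have m: "(\<lambda>\<omega>. lim (\<lambda>n. primitive T (X n) \<omega> t)) \<in> borel_measurable (Fa t)"
      by (intro borel_measurable_lim_metric Xd(3)[OF t])
    show "(\<lambda>\<omega>. primitive T g \<omega> t) \<in> borel_measurable (Fa t)"
    proof (rule augment_AE_measurable[OF sub_F m])
      show "AE \<omega> in \<mu>. lim (\<lambda>n. primitive T (X n) \<omega> t) = primitive T g \<omega> t"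
        using AE_prodM_sections[OF conv] AE_space
      proof eventually_elim
        case (elim \<omega>)
        then have \<omega>: "\<omega> \<in> path_space T" by (simp add: space_mu)
        have "(\<lambda>n. primitive T (X n) \<omega> t) \<longlonglongrightarrow> primitive T g \<omega> t"
          unfolding primitive_def restrict_apply'[OF t] set_lebesgue_integral_def
        proof (rule integral_dominated_convergence[where w="\<lambda>_. C"])
          have A: "{0..<t} \<inter> T \<in> sets (lambda_Delta T)" by (auto simp: sets_lambda_Delta sets_restrict_space)
          show "(\<lambda>s. indicator ({0..<t} \<inter> T) s *\<^sub>R g s \<omega>) \<in> borel_measurable (lambda_Delta T)"
            using set_integrable_section[OF gd \<omega> t] by (simp add: set_integrable_def borel_measurable_integrable)
          show "(\<lambda>s. indicator ({0..<t} \<inter> T) s *\<^sub>R X n s \<omega>) \<in> borel_measurable (lambda_Delta T)" for n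
            using set_integrable_section[OF Xd(1) \<omega> t, of n] by (simp add: set_integrable_def borel_measurable_integrable)
          show "AE s in lambda_Delta T. (\<lambda>n. indicator ({0..<t} \<inter> T) s *\<^sub>R X n s \<omega>) \<longlonglongrightarrow> indicator ({0..<t} \<inter> T) s *\<^sub>R g s \<omega>"
            using elim(1) by eventually_elim (intro tendsto_scaleR tendsto_const, simp)
          show "AE s in lambda_Delta T. norm (indicator ({0..<t} \<inter> T) s *\<^sub>R X n s \<omega>) \<le> C" for n
            using XC[OF _ \<omega>, of _ n] C_nonneg by (intro AE_I2) (auto simp: indicator_def space_lambda_Delta)
        qed simp
        then show ?case by (rule limI)
      qed
    qed
  qed
  moreover have "(\<lambda>n. dens_dist (X n) g) \<longlonglongrightarrow> 0"
  proof -
    have "(\<lambda>n. \<integral>z. (case z of (\<omega>, s) \<Rightarrow> X n s \<omega> - g s \<omega>)\<^sup>2 \<partial>prodM) \<longlonglongrightarrow> (\<integral>z. 0 \<partial>prodM)"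
    proof (rule integral_dominated_convergence[where w="\<lambda>_. (2 * C)\<^sup>2"])
      have "(\<lambda>(\<omega>, s). X n s \<omega> - g s \<omega>) \<in> borel_measurable prodM" for n
        using density_diff_bdd_meas[OF Xd(1) gd, of n] by (simp add: bdd_meas_def)
      then show "(\<lambda>z. (case z of (\<omega>, s) \<Rightarrow> X n s \<omega> - g s \<omega>)\<^sup>2) \<in> borel_measurable prodM" for n
        by simp
      show "AE z in prodM. (\<lambda>n. (case z of (\<omega>, s) \<Rightarrow> X n s \<omega> - g s \<omega>)\<^sup>2) \<longlonglongrightarrow> 0"
        using conv
      proof eventually_elim
        case (elim z)
        from tendsto_power[OF tendsto_diff[OF elim tendsto_const[of "g (snd z) (fst z)"]], of 2]
        show ?case by (simp add: case_prod_unfold)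
      qed
      show "AE z in prodM. norm ((case z of (\<omega>, s) \<Rightarrow> X n s \<omega> - g s \<omega>)\<^sup>2) \<le> (2 * C)\<^sup>2" for n
      proof (rule AE_I2)
        fix z assume "z \<in> space prodM"
        then obtain \<omega> s where z: "z = (\<omega>, s)" "\<omega> \<in> path_space T" "s \<in> T" by (auto simp: space_prodM)
        have "\<bar>X n s \<omega> - g s \<omega>\<bar> \<le> \<bar>2 * C\<bar>" using XC[OF z(3,2), of n] gC[of s \<omega>] C_nonneg by linarith
        then show "norm ((case z of (\<omega>, s) \<Rightarrow> X n s \<omega> - g s \<omega>)\<^sup>2) \<le> (2 * C)\<^sup>2"
          unfolding abs_le_square_iff by (simp add: z(1))
      qed
    qed auto
    from tendsto_real_sqrt[OF this] show ?thesis
      by (simp add: dens_dist_def l2_norm_def)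
  qed
  ultimately show ?thesis by blast
qed

lemma dens_dist_triangle:
  "bdd_density f \<Longrightarrow> bdd_density g \<Longrightarrow> bdd_density h \<Longrightarrow> dens_dist f h \<le> dens_dist f g + dens_dist g h"
  using PP.l2_norm_triangle_diff[OF density_bdd_meas density_bdd_meas density_bdd_meas, of f g h]
  by (simp add: dens_dist_def case_prod_unfold)

lemma dens_dist_nonneg: "0 \<le> dens_dist g k"
  by (simp add: dens_dist_def PP.l2_norm_nonneg)

lemma dens_dist_commute: "dens_dist g k = dens_dist k g"
  using PP.l2_norm_minus_commute[of "\<lambda>(\<omega>, s). g s \<omega>" "\<lambda>(\<omega>, s). k s \<omega>"]
  by (simp add: dens_dist_def case_prod_unfold)

lemma dens_dist_mix_left:
  assumes "0 \<le> \<epsilon>"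
  shows "dens_dist g (mix \<epsilon> g k) = \<epsilon> * dens_dist g k"
proof -
  have "(\<lambda>(\<omega>, s). g s \<omega> - mix \<epsilon> g k s \<omega>) = (\<lambda>z. \<epsilon> * (case z of (\<omega>, s) \<Rightarrow> g s \<omega> - k s \<omega>))"
    by (auto simp: fun_eq_iff mix_def algebra_simps)
  then show ?thesis using assms by (simp add: dens_dist_def PP.l2_norm_cmult)
qed

lemma dens_dist_mix_right:
  assumes "\<epsilon> \<le> 1"
  shows "dens_dist (mix \<epsilon> g k) k = (1 - \<epsilon>) * dens_dist g k"
proof -
  have "(\<lambda>(\<omega>, s). mix \<epsilon> g k s \<omega> - k s \<omega>) = (\<lambda>z. (1 - \<epsilon>) * (case z of (\<omega>, s) \<Rightarrow> g s \<omega> - k s \<omega>))"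
    by (auto simp: fun_eq_iff mix_def algebra_simps)
  then show ?thesis using assms by (simp add: dens_dist_def PP.l2_norm_cmult)
qed

text \<open>A null set of the product has null sections for almost every path, so one exceptional
  set of paths serves all times at once.\<close>

lemma dens_dist_zero_primitive:
  assumes g: "bdd_density g" and k: "bdd_density k" and z: "dens_dist g k = 0"
  shows "AE \<omega> in \<mu>. primitive T g \<omega> = primitive T k \<omega>"
proof -
  let ?f = "\<lambda>(\<omega>, s). g s \<omega> - k s \<omega>"
  have b: "bdd_meas prodM ?f" by (rule density_diff_bdd_meas[OF g k])
  have "(\<integral>z. (?f z)\<^sup>2 \<partial>prodM) = 0"
    using z by (simp add: PP.l2_norm_square[symmetric] dens_dist_def)
  then have "AE z in prodM. (?f z)\<^sup>2 = 0"
    by (subst (asm) integral_nonneg_eq_0_iff_AE[OF PP.bdd_meas_square_integrable[OF b]]) auto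
  then have "AE \<omega> in \<mu>. AE s in lambda_Delta T. (?f (\<omega>, s))\<^sup>2 = 0" by (rule AE_prodM_sections)
  then show ?thesis
    using AE_space
  proof eventually_elim
    case (elim \<omega>)
    then have \<omega>: "\<omega> \<in> path_space T" by (simp add: space_mu)
    show ?case
    proof
      fix t
      show "primitive T g \<omega> t = primitive T k \<omega> t"
      proof (cases "t \<in> T")
        case True
        have "(LINT s:{0..<t} \<inter> T|lambda_Delta T. g s \<omega>) = (LINT s:{0..<t} \<inter> T|lambda_Delta T. k s \<omega>)"
          unfolding set_lebesgue_integral_def
        proof (rule integral_cong_AE)
          show "AE s in lambda_Delta T. indicator ({0..<t} \<inter> T) s *\<^sub>R g s \<omega> = indicator ({0..<t} \<inter> T) s *\<^sub>R k s \<omega>"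
            using elim(1) by eventually_elim simp
        qed (use set_integrable_section[OF g \<omega> True] set_integrable_section[OF k \<omega> True] in
            \<open>auto simp: set_integrable_def dest: borel_measurable_integrable\<close>)
        then show ?thesis by (simp add: primitive_def)
      qed (simp add: primitive_def)
    qed
  qed
qed

text \<open>With \<open>r g\<close> the distance from \<open>g\<close> to its shifted drift, a relaxation step of size
  \<open>\<epsilon>\<close> moves \<open>g\<close> by \<open>\<epsilon> * r g\<close> and, by the second hypothesis, lowers \<open>r\<close> by at least
  \<open>(1 - sqrt K) * \<epsilon> * r g\<close>. So a minimal point for \<open>r / (1 - sqrt K)\<close> in Ekeland's sense is a
  fixed point.\<close>

lemma shifted_drift_fixed_point:
  assumes i: "L2H_adapted_continuous T \<mu> (drift_map T \<beta>)"
    and K: "0 \<le> K" "K < 1"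
    and ii: "\<forall>h\<in>L2H_adapted T \<mu>. \<exists>\<epsilon>. 0 < \<epsilon> \<and> \<epsilon> \<le> 1 \<and>
      (\<integral>\<^sup>+ \<omega>. (\<integral>\<^sup>+ s. ennreal ((\<beta> s (random_shift T (relax T \<beta> \<epsilon> h) \<omega>) - \<beta> s (random_shift T h \<omega>))\<^sup>2)
          \<partial>lambda_Delta T) \<partial>\<mu>)
      \<le> ennreal (K * \<epsilon>\<^sup>2) *
        (\<integral>\<^sup>+ \<omega>. (\<integral>\<^sup>+ s. ennreal ((delta_deriv T (h \<omega>) s - \<beta> s (random_shift T h \<omega>))\<^sup>2)
          \<partial>lambda_Delta T) \<partial>\<mu>)"
  shows "\<exists>g. adapted_density g \<and> dens_dist g (shifted_drift g) = 0"
proof -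
  let ?N = shifted_drift
  define r where "r g = dens_dist g (?N g)" for g
  have relaxation: "\<exists>\<epsilon>. 0 < \<epsilon> \<and> \<epsilon> \<le> 1 \<and> dens_dist (?N (mix \<epsilon> g (?N g))) (?N g) \<le> sqrt K * \<epsilon> * r g"
    if g: "adapted_density g" for g
  proof -
    note gd = adapted_densityD(1)[OF g]
    obtain \<epsilon> where e: "0 < \<epsilon>" "\<epsilon> \<le> 1" and le:
      "(\<integral>\<^sup>+ \<omega>. (\<integral>\<^sup>+ s. ennreal ((\<beta> s (random_shift T (relax T \<beta> \<epsilon> (primitive T g)) \<omega>) - \<beta> s (random_shift T (primitive T g) \<omega>))\<^sup>2)
          \<partial>lambda_Delta T) \<partial>\<mu>)
      \<le> ennreal (K * \<epsilon>\<^sup>2) *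
        (\<integral>\<^sup>+ \<omega>. (\<integral>\<^sup>+ s. ennreal ((delta_deriv T (primitive T g \<omega>) s - \<beta> s (random_shift T (primitive T g) \<omega>))\<^sup>2)
          \<partial>lambda_Delta T) \<partial>\<mu>)" (is "?I \<le> _ * ?J")
      using ii primitive_L2H_adapted[OF g] by blast
    let ?m = "mix \<epsilon> g (?N g)"
    have md: "bdd_density ?m" using e by (intro density_mix gd density_shifted_drift) auto
    \<comment> \<open>The relaxed shift is the primitive of the mixed density, so the left side of
      (ii) is the squared distance of two shifted drifts.\<close>
    have "?I = (\<integral>\<^sup>+ \<omega>. (\<integral>\<^sup>+ s. ennreal ((?N ?m s \<omega> - ?N g s \<omega>)\<^sup>2) \<partial>lambda_Delta T) \<partial>\<mu>)"
      by (intro nn_integral_cong) (simp add: shifted_drift_def random_shift_def relax_primitive[OF gd] space_mu cong: restrict_cong)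
    also have "\<dots> = ennreal ((dens_dist (?N ?m) (?N g))\<^sup>2)"
      by (rule dens_dist_nn_integral[OF density_shifted_drift[OF md] density_shifted_drift[OF gd]])
    finally have lhs: "?I = ennreal ((dens_dist (?N ?m) (?N g))\<^sup>2)" .
    \<comment> \<open>The chosen derivative of the primitive is replaced by \<open>g\<close>, so the
      right side of (ii) contains the squared residual of \<open>g\<close>.\<close>
    have "?J = (\<integral>\<^sup>+ \<omega>. (\<integral>\<^sup>+ s. ennreal ((g s \<omega> - ?N g s \<omega>)\<^sup>2) \<partial>lambda_Delta T) \<partial>\<mu>)"
    proof (rule nn_integral_cong, rule nn_integral_cong_AE)
      fix \<omega> assume "\<omega> \<in> space \<mu>"
      then have \<omega>: "\<omega> \<in> path_space T" by (simp add: space_mu)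
      show "AE s in lambda_Delta T. ennreal ((delta_deriv T (primitive T g \<omega>) s - \<beta> s (random_shift T (primitive T g) \<omega>))\<^sup>2) = ennreal ((g s \<omega> - ?N g s \<omega>)\<^sup>2)"
        using H_norm_square(2)[OF T primitive_has_delta_derivative[OF gd \<omega>]]
        by eventually_elim (simp add: shifted_drift_def)
    qed
    also have "\<dots> = ennreal ((r g)\<^sup>2)"
      unfolding r_def by (rule dens_dist_nn_integral[OF gd density_shifted_drift[OF gd]])
    finally have "ennreal ((dens_dist (?N ?m) (?N g))\<^sup>2) \<le> ennreal (K * \<epsilon>\<^sup>2) * ennreal ((r g)\<^sup>2)"
      using le lhs by simp
    then have "(dens_dist (?N ?m) (?N g))\<^sup>2 \<le> K * \<epsilon>\<^sup>2 * (r g)\<^sup>2"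
      using K by (simp add: ennreal_mult'[symmetric])
    also have "\<dots> = (sqrt K * \<epsilon> * r g)\<^sup>2" using K by (simp add: power_mult_distrib)
    finally have "dens_dist (?N ?m) (?N g) \<le> sqrt K * \<epsilon> * r g"
      by (rule power2_le_imp_le) (use K e in \<open>simp add: r_def dens_dist_nonneg\<close>)
    with e show ?thesis by blast
  qed
  have sK: "sqrt K < 1" using K by simp
  define \<phi> where "\<phi> g = r g / (1 - sqrt K)" for g
  have "\<exists>g\<in>Collect adapted_density. \<forall>k\<in>Collect adapted_density. dens_dist g k \<le> \<phi> g - \<phi> k \<longrightarrow> dens_dist g k = 0"
  proof (rule ekeland_minimal)
    have z: "bdd_density (\<lambda>_ _. 0)" using C_nonneg by (simp add: bdd_density_def)
    have "adapted_density (\<lambda>_ _. 0)"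
      unfolding adapted_density_def using z by (auto simp: primitive_def)
    then show "(\<lambda>_ _. 0) \<in> Collect adapted_density" by simp
    show "0 \<le> \<phi> g" for g using sK by (simp add: \<phi>_def r_def dens_dist_nonneg)
    show "0 \<le> dens_dist g k" for g k by (rule dens_dist_nonneg)
    show "dens_dist g g = 0" for g by (simp add: dens_dist_def l2_norm_def case_prod_unfold)
    show "dens_dist f h \<le> dens_dist f g + dens_dist g h"
      if "f \<in> Collect adapted_density" "g \<in> Collect adapted_density" "h \<in> Collect adapted_density" for f g h
      using that by (intro dens_dist_triangle) (auto dest: adapted_densityD)
    show "\<exists>g\<in>Collect adapted_density. (\<lambda>n. dens_dist (X n) g) \<longlonglongrightarrow> 0"
      if "\<And>n. X n \<in> Collect adapted_density" "summable (\<lambda>n. dens_dist (X n) (X (Suc n)))" for X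
      using adapted_density_complete[of X] that by auto
    show "(\<lambda>n. \<phi> (X n)) \<longlonglongrightarrow> \<phi> g"
      if X: "\<And>n. X n \<in> Collect adapted_density" and g: "g \<in> Collect adapted_density"
        and lim: "(\<lambda>n. dens_dist (X n) g) \<longlonglongrightarrow> 0" for X g
    proof -
      have Xa: "adapted_density (X n)" for n using X by simp
      have ga: "adapted_density g" using g by simp
      note Xd = adapted_densityD(1)[OF Xa] and gd = adapted_densityD(1)[OF ga]
      \<comment> \<open>Hypothesis (i) read through the isometry between densities and their
        primitives.\<close>
      have Nlim: "(\<lambda>n. dens_dist (?N (X n)) (?N g)) \<longlonglongrightarrow> 0"
      proof (rule LIMSEQ_I)
        fix e :: real assume "0 < e"
        then obtain d where d: "d > 0" "\<And>k. k \<in> L2H_adapted T \<mu> \<Longrightarrow> L2H_dist T \<mu> k (primitive T g) < d \<Longrightarrow>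
            L2H_dist T \<mu> (drift_map T \<beta> k) (drift_map T \<beta> (primitive T g)) < e"
          using i primitive_L2H_adapted[OF ga] unfolding L2H_adapted_continuous_def by meson
        have "\<forall>\<^sub>F n in sequentially. dens_dist (X n) g < d"
          using order_tendstoD(2)[OF lim d(1)] .
        then obtain n0 where n0: "\<And>n. n \<ge> n0 \<Longrightarrow> dens_dist (X n) g < d" by (auto simp: eventually_sequentially)
        have "dens_dist (?N (X n)) (?N g) < e" if "n \<ge> n0" for n
        proof -
          have dm: "drift_map T \<beta> (primitive T k) = primitive T (?N k)" for k
            by (simp add: drift_map_primitive shifted_drift_def[abs_def])
          have "L2H_dist T \<mu> (primitive T (?N (X n))) (primitive T (?N g)) < e"
            using d(2)[OF primitive_L2H_adapted[OF Xa, of n]] n0[OF that]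
            by (simp add: L2H_dist_primitive[OF Xd gd] dm)
          then show ?thesis
            by (simp add: L2H_dist_primitive[OF density_shifted_drift[OF Xd] density_shifted_drift[OF gd]])
        qed
        then show "\<exists>n0. \<forall>n\<ge>n0. norm (dens_dist (?N (X n)) (?N g) - 0) < e"
          using dens_dist_nonneg by (intro exI[of _ n0]) simp
      qed
      have "(\<lambda>n. r (X n) - r g) \<longlonglongrightarrow> 0"
      proof (rule Lim_null_comparison)
        show "(\<lambda>n. dens_dist (X n) g + dens_dist (?N (X n)) (?N g)) \<longlonglongrightarrow> 0"
          using tendsto_add[OF lim Nlim] by simp
        have "\<bar>r (X n) - r g\<bar> \<le> dens_dist (X n) g + dens_dist (?N (X n)) (?N g)" for n
        proof -
          note NX = density_shifted_drift[OF Xd[of n]] and Ng = density_shifted_drift[OF gd]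
          have "r (X n) \<le> dens_dist (X n) g + (dens_dist g (?N g) + dens_dist (?N g) (?N (X n)))"
            unfolding r_def
            using dens_dist_triangle[OF Xd[of n] gd NX] dens_dist_triangle[OF gd Ng NX] by simp
          moreover have "r g \<le> dens_dist g (X n) + (dens_dist (X n) (?N (X n)) + dens_dist (?N (X n)) (?N g))"
            unfolding r_def
            using dens_dist_triangle[OF gd Xd[of n] Ng] dens_dist_triangle[OF Xd[of n] NX Ng] by simp
          ultimately show ?thesis
            using dens_dist_commute[of g "X n"] dens_dist_commute[of "?N g" "?N (X n)"] by (simp add: r_def abs_le_iff)
        qed
        then show "\<forall>\<^sub>F n in sequentially. norm (r (X n) - r g) \<le> dens_dist (X n) g + dens_dist (?N (X n)) (?N g)"
          by simp
      qed
      then have "(\<lambda>n. r (X n)) \<longlonglongrightarrow> r g" by (simp add: LIM_zero_iff)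
      then show ?thesis unfolding \<phi>_def using sK by (intro tendsto_intros) auto
    qed
  qed
  then obtain g where g: "adapted_density g" and
    min: "\<And>k. adapted_density k \<Longrightarrow> dens_dist g k \<le> \<phi> g - \<phi> k \<Longrightarrow> dens_dist g k = 0" by auto
  note gd = adapted_densityD(1)[OF g]
  obtain \<epsilon> where e: "0 < \<epsilon>" "\<epsilon> \<le> 1" and le: "dens_dist (?N (mix \<epsilon> g (?N g))) (?N g) \<le> sqrt K * \<epsilon> * r g"
    using relaxation[OF g] by blast
  let ?m = "mix \<epsilon> g (?N g)"
  have ma: "adapted_density ?m" using e by (intro adapted_mix g adapted_shifted_drift) auto
  note md = adapted_densityD(1)[OF ma]
  have gm: "dens_dist g ?m = \<epsilon> * r g" unfolding r_def using e by (intro dens_dist_mix_left) auto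
  \<comment> \<open>Through the old target \<open>?N g\<close>: the distance to it has shrunk by the
    exact factor \<open>1 - \<epsilon>\<close>, while the target itself has moved by at most
    \<open>sqrt K * \<epsilon> * r g\<close>.\<close>
  have "r ?m \<le> dens_dist ?m (?N g) + dens_dist (?N g) (?N ?m)"
    unfolding r_def by (intro dens_dist_triangle md density_shifted_drift gd)
  also have "\<dots> \<le> (1 - \<epsilon>) * r g + sqrt K * \<epsilon> * r g"
    using le dens_dist_mix_right[OF e(2), of g "?N g"] dens_dist_commute[of "?N g" "?N ?m"] by (simp add: r_def)
  finally have "(1 - sqrt K) * (\<epsilon> * r g) \<le> r g - r ?m" by (simp add: algebra_simps)
  then have "\<epsilon> * r g \<le> \<phi> g - \<phi> ?m"
    using sK by (simp add: \<phi>_def diff_divide_distrib[symmetric] pos_le_divide_eq mult.commute)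
  then have "dens_dist g ?m = 0" using min[OF ma] gm by simp
  then have "r g = 0" using gm e by simp
  then show ?thesis using g by (auto simp: r_def)
qed

text \<open>The comparison is made on \<open>M\<close>, where the Brownian path is known at all
  times of [0,1] and not only on \<open>T\<close>. Almost surely the shift is also the primitive of
  its shifted drift, whose explicit form through \<open>\<beta>\<close> gives adaptedness at times
  outside \<open>T\<close>.\<close>

lemma shifted_law_equivalent:
  assumes bm: "standard_brownian_motion M b" and mu: "\<mu> = sampled_law T M b"
    and g: "adapted_density g" and fp: "dens_dist g (shifted_drift g) = 0"
  shows "absolutely_continuous \<mu> (distr \<mu> (path_borel T) (random_shift T (primitive T g)))"
    and "absolutely_continuous (distr \<mu> (path_borel T) (random_shift T (primitive T g))) \<mu>"
proof -
  interpret M: prob_space M using bm by (simp add: standard_brownian_motion_def)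
  note gd = adapted_densityD(1)[OF g]
  let ?k = "shifted_drift g" and ?F = "random_shift T (primitive T g)" and ?w = "sample_path T b"
  have kd: "bdd_density ?k" by (rule density_shifted_drift[OF gd])
  have bm_meas: "b t \<in> borel_measurable M" if "t \<in> T" for t
    using bm that TD(5) by (auto simp: standard_brownian_motion_def)
  have w_sp: "?w x \<in> path_space T" if "x \<in> space M" for x
    unfolding path_space_iff[OF T]
  proof (intro conjI)
    have "continuous_on T (\<lambda>t. b t x)" "b 0 x = 0"
      using bm that TD(5) by (auto simp: standard_brownian_motion_def intro: continuous_on_subset)
    then show "continuous_on T (?w x)" "?w x 0 = 0"
      using TD(3) by (auto simp: sample_path_def intro: continuous_on_eq)
  qed (simp add: sample_path_def)
  have w: "?w \<in> measurable M (path_borel T)"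
    by (rule measurable_into_path_borel[OF T w_sp]) (use bm_meas in \<open>auto simp: sample_path_def\<close>)
  have mu_distr: "\<mu> = distr M (path_borel T) ?w" using mu by (simp add: sampled_law_def)
  \<comment> \<open>The primitive of \<open>?k\<close>, continued from \<open>T\<close> to [0,1] as
    a Lebesgue integral.\<close>
  define U where "U t x = (LINT s:{0..t}|lborel. ?k (rho T s) (?w x))" for t x
  have U_meas: "U t \<in> borel_measurable M" if "t \<in> {0..1}" for t
    unfolding U_def
    using measurable_compose[OF w borel_measurable_rho_integral[OF T _ kd[unfolded bdd_density_def, THEN conjunct1]]] that
    by auto
  have U_lip: "\<bar>U s x - U t x\<bar> \<le> C * \<bar>s - t\<bar>" if "x \<in> space M" "s \<in> {0..1}" "t \<in> {0..1}" for s t x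
    unfolding U_def by (rule density_lipschitz[OF kd w_sp[OF that(1)] that(2,3)])
  have U0: "U 0 x = 0" for x
  proof -
    have "AE s in lborel. indicator {0..0} s *\<^sub>R ?k (rho T s) (?w x) = 0"
      using AE_lborel_singleton[of "0 :: real"] by eventually_elim simp
    then have "(LINT s:{0..0}|lborel. ?k (rho T s) (?w x)) = 0"
      unfolding set_lebesgue_integral_def by (rule integral_eq_zero_AE)
    then show ?thesis by (simp add: U_def)
  qed
  have U_adapted: "\<exists>U'\<in>borel_measurable (process_sigma (space M) {0..t} b). AE x in M. U t x = U' x" if t: "t \<in> {0..1}" for t
  proof -
    \<comment> \<open>The last point of \<open>T\<close> not after \<open>t\<close>. On [0,t] the
      values of \<open>rho T\<close> do not exceed it, so the integral needs the path up to
      \<open>t0\<close> only.\<close>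
    define t0 where "t0 = Sup {u \<in> T. u \<le> t}"
    have ne: "{u \<in> T. u \<le> t} \<noteq> {}" and bdd: "bdd_above {u \<in> T. u \<le> t}"
      using TD(3) t by (auto intro!: bdd_aboveI[of _ t])
    have "t0 \<in> closure {u \<in> T. u \<le> t}" unfolding t0_def by (rule closure_contains_Sup[OF ne bdd])
    moreover have "closed {u \<in> T. u \<le> t}"
      using closed_Int[OF TD(1) closed_atMost[of t]] by (simp add: Int_def)
    ultimately have t0: "t0 \<in> T" "t0 \<le> t" by auto
    have rho_le: "rho T s \<le> t0" if "s \<in> {0..t}" for s
    proof -
      have "rho T s \<in> T" "rho T s \<le> s" using rho_props[OF T, of s] that t by auto
      then show ?thesis unfolding t0_def using that bdd by (intro cSup_upper) auto
    qed
    have "(\<lambda>\<omega>. LINT s:{0..t}|lborel. \<beta> (rho T s) (?F \<omega>)) \<in> borel_measurable (Fa t0)"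
      by (rule integral_beta_adapted[OF random_shift_adapted[OF g] t0(1)]) (use t t0 rho_le in auto)
    \<comment> \<open>Replacing the integral by a version for the raw canonical filtration makes its
      composition with the sampled path measurable for the raw past of \<open>b\<close>.\<close>
    then obtain f where f: "f \<in> borel_measurable (canonical_filtration T t0)"
        "AE \<omega> in \<mu>. (LINT s:{0..t}|lborel. \<beta> (rho T s) (?F \<omega>)) = f \<omega>"
      using augment_version[OF sub_F] by blast
    have "?w \<in> measurable (process_sigma (space M) {0..t} b) (canonical_filtration T t0)"
    proof (rule measurable_into_canonical_filtration)
      fix s assume "s \<in> T" "0 \<le> s" "s \<le> t0"
      then show "(\<lambda>x. ?w x s) \<in> borel_measurable (process_sigma (space M) {0..t} b)"
        using measurable_process_sigma_component[of s "{0..t}" b "space M"] t0 by (simp add: sample_path_def)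
    qed (simp add: w_sp)
    from measurable_compose[OF this f(1)]
    have "(\<lambda>x. f (?w x)) \<in> borel_measurable (process_sigma (space M) {0..t} b)" .
    moreover have "AE x in M. (LINT s:{0..t}|lborel. \<beta> (rho T s) (?F (?w x))) = f (?w x)"
      by (rule AE_distrD[OF w f(2)[unfolded mu_distr]])
    then have "AE x in M. U t x = f (?w x)"
      by (simp add: U_def shifted_drift_def)
    ultimately show ?thesis by (intro bexI[of _ "\<lambda>x. f (?w x)"])
  qed
  let ?Y = "\<lambda>t x. b t x + U t x"
  have Y_eq: "sample_path T ?Y x = random_shift T (primitive T ?k) (?w x)" if "x \<in> space M" for x
    using primitive_eq[OF kd w_sp[OF that]] by (auto simp: sample_path_def random_shift_def U_def fun_eq_iff)
  have Y_meas: "sample_path T ?Y \<in> measurable M (path_borel T)"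
    using measurable_compose[OF w measurable_random_shift[OF kd]] by (subst measurable_cong[OF Y_eq])
  \<comment> \<open>Here the fixed point property returns from \<open>?k\<close> to the given
    density \<open>g\<close>.\<close>
  have "AE \<omega> in \<mu>. primitive T g \<omega> = primitive T ?k \<omega>" by (rule dens_dist_zero_primitive[OF gd kd fp])
  then have "AE x in M. primitive T g (?w x) = primitive T ?k (?w x)"
    unfolding mu_distr by (rule AE_distrD[OF w])
  then have "AE x in M. ?F (?w x) = sample_path T ?Y x"
    using AE_space by eventually_elim (simp add: Y_eq random_shift_def)
  then have "distr M (path_borel T) (\<lambda>x. ?F (?w x)) = distr M (path_borel T) (sample_path T ?Y)"
    using measurable_compose[OF w measurable_random_shift[OF gd]] Y_meas by (intro distr_cong_AE) auto
  then have law: "distr \<mu> (path_borel T) ?F = sampled_law T M ?Y"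
    unfolding mu_distr sampled_law_def distr_distr[OF measurable_random_shift[OF gd] w] comp_def .
  note eqv = brownian_shift_equivalent[OF T bm C_nonneg U0 U_lip U_meas U_adapted w Y_meas]
  show "absolutely_continuous \<mu> (distr \<mu> (path_borel T) ?F)"
    unfolding law unfolding mu using eqv(1) by simp
  show "absolutely_continuous (distr \<mu> (path_borel T) ?F) \<mu>"
    unfolding law unfolding mu using eqv(2) by simp
qed

end

section \<open>Strong solutions\<close>

lemma sets_augment_subset:
  assumes G: "subalgebra Q G" and G': "subalgebra Q G'" and sub: "sets G \<subseteq> sets (augment Q G')"
  shows "sets (augment Q G) \<subseteq> sets (augment Q G')"
proof -
  have "sets G \<union> null_sets (completion Q) \<subseteq> sets (augment Q G')"
    using sub sets_augment_null[OF G'] by blast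
  from sets.sigma_sets_subset[OF this] show ?thesis by (simp add: sets_augment[OF G])
qed

lemma process_sigma_subset_augment:
  assumes G: "subalgebra Q G" and X: "\<And>s. s \<in> J \<Longrightarrow> X s \<in> borel_measurable (augment Q G)"
  shows "sets (process_sigma (space Q) J X) \<subseteq> sets (augment Q G)"
proof -
  have "{X s -` S \<inter> space Q | s S. s \<in> J \<and> S \<in> sets borel} \<subseteq> sets (augment Q G)"
  proof
    fix A assume "A \<in> {X s -` S \<inter> space Q | s S. s \<in> J \<and> S \<in> sets borel}"
    then obtain s S where "s \<in> J" "S \<in> sets borel" "A = X s -` S \<inter> space Q" by auto
    then show "A \<in> sets (augment Q G)" using measurable_sets[OF X, of s S] by simp
  qed
  from sets.sigma_sets_subset[OF this] show ?thesis by (simp add: sets_process_sigma)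
qed

lemma null_sets_completion_complete:
  assumes "complete_measure Q" shows "null_sets (completion Q) = null_sets Q"
proof
  show "null_sets (completion Q) \<subseteq> null_sets Q"
  proof
    fix A assume "A \<in> null_sets (completion Q)"
    then obtain N where N: "N \<in> null_sets Q" "A \<subseteq> N" by (auto simp: null_sets_completion_iff2)
    then have "A \<in> sets Q" using complete_measure.complete[OF assms] by blast
    then show "A \<in> null_sets Q" using N null_sets_subset by blast
  qed
qed (auto intro: null_sets_completionI)

text \<open>\<open>F\<close> is built on the canonical space and evaluated at the given
  \<open>B\<close>. Every almost sure property of \<open>F\<close> under \<open>\<mu>\<close> is
  carried to \<open>P\<close> by the sampled path of \<open>B\<close>, whose law is
  \<open>\<mu>\<close>; the equivalence of the laws is obtained on \<open>M\<close>.\<close>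

theorem corollary6p1:
  fixes T :: "real set"
    and M :: "'b measure" and b :: "real \<Rightarrow> 'b \<Rightarrow> real"
    and \<mu> :: "(real \<Rightarrow> real) measure"
    and \<beta> :: "real \<Rightarrow> (real \<Rightarrow> real) \<Rightarrow> real"
    and P :: "'a measure" and A :: "real \<Rightarrow> 'a measure" and B :: "real \<Rightarrow> 'a \<Rightarrow> real"
  assumes T: "time_scale T"
    and b: "standard_brownian_motion M b"
    and mu: "\<mu> = sampled_law T M b"
    and beta_borel: "(\<lambda>(t, \<omega>). \<beta> t \<omega>) \<in> borel_measurable (restrict_space borel T \<Otimes>\<^sub>M path_borel T)"
    and beta_bounded: "\<exists>C. \<forall>t\<in>T. \<forall>\<omega>\<in>path_space T. \<bar>\<beta> t \<omega>\<bar> \<le> C"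
    and beta_adapted: "\<forall>t\<in>T. \<beta> t \<in> borel_measurable (canonical_filtration T t)"
    and i: "L2H_adapted_continuous T \<mu> (drift_map T \<beta>)"
    and ii: "\<exists>K. 0 \<le> K \<and> K < 1 \<and> (\<forall>h\<in>L2H_adapted T \<mu>. \<exists>\<epsilon>. 0 < \<epsilon> \<and> \<epsilon> \<le> 1 \<and>
      (\<integral>\<^sup>+ \<omega>. (\<integral>\<^sup>+ s. ennreal ((\<beta> s (random_shift T (relax T \<beta> \<epsilon> h) \<omega>) - \<beta> s (random_shift T h \<omega>))\<^sup>2)
          \<partial>lambda_Delta T) \<partial>\<mu>)
      \<le> ennreal (K * \<epsilon>\<^sup>2) *
        (\<integral>\<^sup>+ \<omega>. (\<integral>\<^sup>+ s. ennreal ((delta_deriv T (h \<omega>) s - \<beta> s (random_shift T h \<omega>))\<^sup>2)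
          \<partial>lambda_Delta T) \<partial>\<mu>))"
    and space: "complete_filtered_prob_space T P A"
    and B: "sampled_brownian_motion T \<mu> P A B"
  shows "\<exists>X :: real \<Rightarrow> 'a \<Rightarrow> real.
    adapted T A X \<and>
    sample_path T X \<in> measurable P (path_borel T) \<and>
    (AE x in P. \<forall>t\<in>T.
       X t x = B t x + (LINT s:{0..<t} \<inter> T|lambda_Delta T. \<beta> s (sample_path T X x))) \<and>
    (\<exists>F \<in> measurable (path_borel T) (path_borel T).
       (\<forall>t\<in>T. \<forall>S\<in>sets (canonical_filtration T t).
          F -` S \<inter> path_space T \<in> sets (augment \<mu> (canonical_filtration T t))) \<and>
       (AE x in P. \<forall>t\<in>T. X t x = F (sample_path T B x) t)) \<and>
    (\<forall>t\<in>T. sets (augment P (process_sigma (space P) ({0..t} \<inter> T) X))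
           = sets (augment P (process_sigma (space P) ({0..t} \<inter> T) B))) \<and>
    absolutely_continuous \<mu> (sampled_law T P X) \<and>
    absolutely_continuous (sampled_law T P X) \<mu> \<and>
    \<mu> = sampled_law T P B"
proof -
  obtain C where C: "\<And>t \<omega>. t \<in> T \<Longrightarrow> \<omega> \<in> path_space T \<Longrightarrow> \<bar>\<beta> t \<omega>\<bar> \<le> C"
    using beta_bounded by blast
  obtain K where K: "0 \<le> K" "K < 1" and ii': "\<forall>h\<in>L2H_adapted T \<mu>. \<exists>\<epsilon>. 0 < \<epsilon> \<and> \<epsilon> \<le> 1 \<and>
      (\<integral>\<^sup>+ \<omega>. (\<integral>\<^sup>+ s. ennreal ((\<beta> s (random_shift T (relax T \<beta> \<epsilon> h) \<omega>) - \<beta> s (random_shift T h \<omega>))\<^sup>2)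
          \<partial>lambda_Delta T) \<partial>\<mu>)
      \<le> ennreal (K * \<epsilon>\<^sup>2) *
        (\<integral>\<^sup>+ \<omega>. (\<integral>\<^sup>+ s. ennreal ((delta_deriv T (h \<omega>) s - \<beta> s (random_shift T h \<omega>))\<^sup>2)
          \<partial>lambda_Delta T) \<partial>\<mu>)"
    using ii by (elim exE conjE)
  define W where "W = sample_path T B"
  have P: "prob_space P" "complete_measure P"
    and A_sub: "\<And>t. t \<in> T \<Longrightarrow> subalgebra P (A t)" and A_null: "\<And>t. t \<in> T \<Longrightarrow> null_sets P \<subseteq> sets (A t)"
    and A_mono: "\<And>s t. s \<in> T \<Longrightarrow> t \<in> T \<Longrightarrow> s \<le> t \<Longrightarrow> sets (A s) \<subseteq> sets (A t)"
    using space by (auto simp: complete_filtered_prob_space_def)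
  have W: "W \<in> measurable P (path_borel T)" and mu_W: "\<mu> = distr P (path_borel T) W"
    and B_adapted: "\<And>t. t \<in> T \<Longrightarrow> B t \<in> borel_measurable (A t)"
    using B by (auto simp: sampled_brownian_motion_def sampled_law_def adapted_def W_def)
  have prob_mu: "prob_space \<mu>" unfolding mu_W by (rule prob_space.prob_space_distr[OF P(1) W])
  have sets_mu: "sets \<mu> = sets (path_borel T)" unfolding mu_W by simp
  interpret bounded_drift T \<mu> \<beta> C
    by (rule bounded_drift.intro[OF T prob_mu sets_mu beta_borel C bspec[OF beta_adapted]])
  obtain g where g: "adapted_density g" and fp: "dens_dist g (shifted_drift g) = 0"
    using shifted_drift_fixed_point[OF i K ii'] by blast
  note gd = adapted_densityD(1)[OF g]
  note kd = density_shifted_drift[OF gd]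
  define F where "F = random_shift T (primitive T g)"
  define X where "X t x = F (W x) t" for t x
  have F: "F \<in> measurable (path_borel T) (path_borel T)"
    unfolding F_def by (rule measurable_random_shift[OF gd])
  have Fa: "F \<in> measurable (Fa t) (canonical_filtration T t)" for t
    unfolding F_def by (rule random_shift_adapted[OF g])
  have W_sp: "W x \<in> path_space T" if "x \<in> space P" for x
    using measurable_space[OF W that] by simp
  have F_sp: "F \<omega> \<in> path_space T" if "\<omega> \<in> path_space T" for \<omega>
    using measurable_space[OF F] that by simp
  have X_path: "sample_path T X x = F (W x)" if "x \<in> space P" for x
    using F_sp[OF W_sp[OF that]] unfolding path_space_iff[OF T]
    by (auto simp: sample_path_def X_def fun_eq_iff extensional_def)
  have X_meas: "sample_path T X \<in> measurable P (path_borel T)"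
    using measurable_compose[OF W F] by (subst measurable_cong[OF X_path])
  \<comment> \<open>Kept general in \<open>G\<close>, because it is used both for the given
    filtration and for the one generated by \<open>B\<close>.\<close>
  have W_aug: "W \<in> measurable (augment P G) (Fa t)"
    if G: "subalgebra P G" and BG: "\<And>s. s \<in> T \<Longrightarrow> s \<le> t \<Longrightarrow> B s \<in> borel_measurable G" for G t
  proof (rule measurable_augment[OF G sub_F])
    have sp: "space G = space P" using G by (simp add: subalgebra_def)
    show "W \<in> measurable G (canonical_filtration T t)"
      by (rule measurable_into_canonical_filtration)
         (use BG W_sp sp in \<open>auto simp: W_def sample_path_def\<close>)
    show "W -` N \<inter> space P \<in> null_sets (completion P)" if "N \<in> null_sets \<mu>" for N
    proof (rule null_sets_completionI)
      have "N \<in> null_sets (distr P (path_borel T) W)" using that mu_W by simp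
      then show "W -` N \<inter> space P \<in> null_sets P"
        by (simp add: null_sets_distr_iff[OF W])
    qed
  qed
  have X_coord: "X t \<in> borel_measurable (augment P G)"
    if "subalgebra P G" "\<And>s. s \<in> T \<Longrightarrow> s \<le> t \<Longrightarrow> B s \<in> borel_measurable G" and t: "t \<in> T" for G t
    using measurable_compose[OF measurable_compose[OF W_aug[OF that(1,2)] Fa] canonical_filtration_coordinate[OF t, of t]] TD(5) t
    by (auto simp: X_def[abs_def])
  \<comment> \<open>Completeness of the filtration means that augmenting it adds nothing, so
    \<open>X\<close> is adapted to \<open>A\<close> itself.\<close>
  have aug_A: "sets (augment P (A t)) = sets (A t)" if t: "t \<in> T" for t
  proof -
    have "sets (A t) \<union> null_sets (completion P) = sets (A t)"
      using A_null[OF t] null_sets_completion_complete[OF P(2)] by blast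
    moreover have "space P = space (A t)" using A_sub[OF t] by (simp add: subalgebra_def)
    ultimately show ?thesis by (simp add: sets_augment[OF A_sub[OF t]] sets.sigma_sets_eq)
  qed
  have BA: "B s \<in> borel_measurable (A t)" if "s \<in> T" "t \<in> T" "s \<le> t" for s t
    using B_adapted[OF that(1)] A_mono[OF that] A_sub[OF that(1)] A_sub[OF that(2)]
    by (auto simp: measurable_def subalgebra_def)
  have X_adapted: "adapted T A X"
    unfolding adapted_def
  proof
    fix t assume t: "t \<in> T"
    have "X t \<in> borel_measurable (augment P (A t))"
      by (rule X_coord[OF A_sub[OF t] BA t]) (use t in auto)
    then show "X t \<in> borel_measurable (A t)"
      by (simp add: measurable_cong_sets[OF aug_A[OF t] refl])
  qed
  \<comment> \<open>The fixed point identity holds for \<open>\<mu>\<close>-almost every path; the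
    law of \<open>W\<close> moves it to \<open>P\<close>. It is what turns \<open>F\<close> into a
    solution.\<close>
  have prim_eq: "AE x in P. primitive T g (W x) = primitive T (shifted_drift g) (W x)"
    by (rule AE_distrD[OF W dens_dist_zero_primitive[OF gd kd fp, unfolded mu_W]])
  have equation: "AE x in P. \<forall>t\<in>T. X t x = B t x + (LINT s:{0..<t} \<inter> T|lambda_Delta T. \<beta> s (sample_path T X x))"
    using prim_eq AE_space
  proof eventually_elim
    case (elim x)
    show ?case
    proof
      fix t assume t: "t \<in> T"
      have "X t x = W x t + primitive T g (W x) t" using t by (simp add: X_def F_def random_shift_def)
      also have "W x t = B t x" using t by (simp add: W_def sample_path_def)
      also have "primitive T g (W x) t = (LINT s:{0..<t} \<inter> T|lambda_Delta T. \<beta> s (F (W x)))"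
        unfolding elim(1) using t by (simp add: primitive_def shifted_drift_def F_def)
      finally show "X t x = B t x + (LINT s:{0..<t} \<inter> T|lambda_Delta T. \<beta> s (sample_path T X x))"
        by (simp add: X_path[OF elim(2)])
    qed
  qed
  have F_adapted: "F -` S \<inter> path_space T \<in> sets (Fa t)" if "S \<in> sets (canonical_filtration T t)" for t S
    using measurable_sets[OF Fa that] by (simp add: space_mu)
  have X_rep: "AE x in P. \<forall>t\<in>T. X t x = F (sample_path T B x) t"
    by (simp add: X_def W_def)
  have filtrations: "sets (augment P (process_sigma (space P) ({0..t} \<inter> T) X))
      = sets (augment P (process_sigma (space P) ({0..t} \<inter> T) B))" if t: "t \<in> T" for t
  proof -
    let ?GX = "process_sigma (space P) ({0..t} \<inter> T) X" and ?GB = "process_sigma (space P) ({0..t} \<inter> T) B"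
    have A_P: "f \<in> borel_measurable P" if "s \<in> T" "f \<in> borel_measurable (A s)" for f :: "'a \<Rightarrow> real" and s
      using measurable_from_subalg[OF A_sub[OF that(1)] that(2)] .
    have GX: "subalgebra P ?GX"
    proof (rule subalgebra_process_sigma)
      fix s assume "s \<in> {0..t} \<inter> T"
      then have s: "s \<in> T" by simp
      show "X s \<in> borel_measurable P"
        using A_P[OF s bspec[OF X_adapted[unfolded adapted_def] s]] .
    qed
    have GB: "subalgebra P ?GB"
    proof (rule subalgebra_process_sigma)
      fix s assume "s \<in> {0..t} \<inter> T"
      then have s: "s \<in> T" by simp
      show "B s \<in> borel_measurable P" using A_P[OF s B_adapted[OF s]] .
    qed
    have B_GB: "B s \<in> borel_measurable ?GB" if "s \<in> T" "s \<le> t" for s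
      using measurable_process_sigma_component[of s "{0..t} \<inter> T" B] that TD(5) by auto
    have X_GX: "X s \<in> borel_measurable ?GX" if "s \<in> T" "s \<le> t" for s
      using measurable_process_sigma_component[of s "{0..t} \<inter> T" X] that TD(5) by auto
    have "sets ?GX \<subseteq> sets (augment P ?GB)"
    proof (rule process_sigma_subset_augment[OF GB])
      fix s assume s: "s \<in> {0..t} \<inter> T"
      show "X s \<in> borel_measurable (augment P ?GB)"
        by (rule X_coord[OF GB B_GB]) (use s in auto)
    qed
    \<comment> \<open>The converse inclusion solves the equation for \<open>B\<close>: it is
      \<open>X\<close> minus an integral of \<open>\<beta>\<close> along \<open>X\<close>, and this
      integral up to \<open>s\<close> is determined by \<open>X\<close> up to
      \<open>s\<close>.\<close>
    moreover have "sets ?GB \<subseteq> sets (augment P ?GX)"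
    proof (rule process_sigma_subset_augment[OF GX])
      fix s assume "s \<in> {0..t} \<inter> T"
      then have s: "s \<in> T" "0 \<le> s" "s \<le> t" by auto
      have FW: "(\<lambda>x. F (W x)) \<in> measurable ?GX (canonical_filtration T s)"
      proof (rule measurable_into_canonical_filtration)
        fix r assume "r \<in> T" "0 \<le> r" "r \<le> s"
        then show "(\<lambda>x. F (W x) r) \<in> borel_measurable ?GX"
          using X_GX[of r] s by (simp add: X_def[abs_def])
      qed (simp add: F_sp W_sp)
      have "(\<lambda>x. LINT r:{0..s}|lborel. \<beta> (rho T r) (F (W x))) \<in> borel_measurable ?GX"
      proof (rule integral_beta_adapted[OF FW s(1,2)])
        show "rho T r \<le> s" if "r \<in> {0..s}" for r
          using rho_props(2)[OF T, of r] that s(1) TD(5) by force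
      qed (use s TD(5) in auto)
      then have m: "(\<lambda>x. X s x - (LINT r:{0..s}|lborel. \<beta> (rho T r) (F (W x)))) \<in> borel_measurable (augment P ?GX)"
        using X_GX[OF s(1,3)] by (intro measurable_augment_base[OF GX] borel_measurable_diff)
      show "B s \<in> borel_measurable (augment P ?GX)"
      \<comment> \<open>The equation holds only almost surely, so \<open>B s\<close> is measurable
        for the augmented sigma-field and not necessarily for the raw one.\<close>
      proof (rule augment_AE_measurable[OF GX m])
        show "AE x in P. X s x - (LINT r:{0..s}|lborel. \<beta> (rho T r) (F (W x))) = B s x"
          using prim_eq AE_space
        proof eventually_elim
          case (elim x)
          have "primitive T g (W x) s = (LINT r:{0..s}|lborel. \<beta> (rho T r) (F (W x)))"
            unfolding elim(1) primitive_eq[OF kd W_sp[OF elim(2)] s(1)]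
            by (simp add: shifted_drift_def F_def)
          moreover have "X s x = B s x + primitive T g (W x) s"
            using s by (simp add: X_def F_def random_shift_def W_def sample_path_def)
          ultimately show ?case by simp
        qed
      qed
    qed
    ultimately show ?thesis
      using sets_augment_subset[OF GX GB] sets_augment_subset[OF GB GX] by blast
  qed
  have "sampled_law T P X = distr P (path_borel T) (\<lambda>x. F (W x))"
    unfolding sampled_law_def by (rule distr_cong) (simp_all add: X_path)
  also have "\<dots> = distr \<mu> (path_borel T) F"
    unfolding mu_W by (subst distr_distr[OF F W]) (simp add: comp_def)
  finally have law: "sampled_law T P X = distr \<mu> (path_borel T) F" .
  have ac: "absolutely_continuous \<mu> (sampled_law T P X)" "absolutely_continuous (sampled_law T P X) \<mu>"
    unfolding law F_def by (rule shifted_law_equivalent[OF b mu g fp])+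
  have mu_B: "\<mu> = sampled_law T P B" using mu_W by (simp add: sampled_law_def W_def)
  show ?thesis
    by (intro exI[of _ X] conjI bexI[of _ F] ballI X_adapted X_meas equation F_adapted X_rep filtrations ac mu_B F)
qed

end
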